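(* Let $m,n\ge 1$ be integers and let $D$ be a domain in $\mathbb{C}^m$. Let $\mathcal{F}$ be a family of meromorphic mappings from $D$ into $\mathbb{P}^n$, $\mathcal{G}$ a family of holomorphic mappings from $D$ into $\mathbb{P}^n$, and $\mathcal{H}$ a collection of hyperplanes in $\mathbb{P}^n$. Suppose that, for each $f\in\mathcal{F}$, there exist a $g_f\in\mathcal{G}$ and a subset $\{H_{1,f},\ldots,H_{2n+1,f}\}\subset\mathcal{H}$ such that (a) $f(D)\not\subset H_{k,f}$ for $k=1,\ldots,2n+1$; (b) $\inf\{D(H_{1,f},\dots,H_{2n+1,f}) : f\in\mathcal{F}\}>0$; and (c) $\mathsf{supp}\,\nu(f,H_{k,f})\subseteq g_f^{-1}(H_{k,f})$ for $k=1,\ldots,2n+1$. Furthermore, assume that for any mapping in the closure of $\mathcal{G}$, its range is not a subset of any hyperplane in the closure of $\mathcal{H}$. If the family $\mathcal{G}$ is normal, then $\mathcal{F}$ is meromorphically normal.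
   Context: Homogeneous coordinates $[w_0:\cdots:w_n]$ on complex projective space $\mathbb{P}^n$ are fixed, and $\|\cdot\|$ is the Euclidean norm. Meromorphic mappings. For a meromorphic mapping $f:D\to\mathbb{P}^n$, $I(f)$ denotes its indeterminacy locus, an analytic subset of $D$ of codimension at least $2$ (empty if $m=1$); $f$ is holomorphic on $D\setminus I(f)$. Each $a\in D$ has a neighborhood $U$ with a holomorphic map $\widetilde f=(f_0,\dots,f_n):U\to\mathbb{C}^{n+1}$ such that $f(z)=[f_0(z):\cdots:f_n(z)]$ for $z\in U\setminus I(f)$ and $I(f)\cap U=\{z\in U: f_0(z)=\cdots=f_n(z)=0\}$. Any such $\widetilde f$ is called an admissible (reduced) representation of $f$ on $U$. The notation $f(D)\not\subset H$. For a hyperplane $H\subset\mathbb{P}^n$, $f(D)\not\subset H$ means that $\Gamma_f:=\overline{\{(z,f(z)):z\in D\setminus I(f)\}}$ is not a subset of $D\times H$. The divisor $\nu(f,H)$. For a holomorphic function $h\not\equiv 0$ near $a$, $\nu_h(a)$ is the order of vanishing of $h$ at $a$ (the least degree of a nonzero homogeneous term in the power series of $h$ at $a$). If $H=\{\sum_{l=0}^n a_lw_l=0\}$ and $f(D)\not\subset H$, the divisor $\nu(f,H):D\to\mathbb{Z}_{\ge0}$ is defined by $\nu(f,H)|_U:=\nu_{f^*H}$, where $f^*H:=a_0f_0+\cdots+a_nf_n$ for any admissible representation $(f_0,\dots,f_n)$ of $f$ on $U$; this is independent of choices. Its support is $\mathsf{supp}\,\nu(f,H):=\{z\in D:\nu(f,H)(z)\ne0\}$.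 The quantity $D(H_1,\dots,H_q)$. For hyperplanes $H_k=\{\sum_l a^{(k)}_lw_l=0\}$ with unit vectors $\alpha_k=(a^{(k)}_0,\dots,a^{(k)}_n)$, $k=1,\dots,n+1$, put $\mathcal{D}(H_1,\dots,H_{n+1}):=|\det[\alpha_1;\dots;\alpha_{n+1}]|$ (the matrix with rows $\alpha_k$). For $q\ge n+1$ hyperplanes, $D(H_1,\dots,H_q):=\prod_{1\le k_1<\dots<k_{n+1}\le q}\mathcal{D}(H_{k_1},\dots,H_{k_{n+1}})$. (This is unrelated to the domain $D$.) Closures and normality. $\operatorname{Hol}(D,\mathbb{P}^n)$, the space of holomorphic mappings $D\to\mathbb{P}^n$, carries the compact-open topology; the closure of $\mathcal{G}$ is taken in it, and $\mathcal{G}$ is normal if it is relatively compact in $\operatorname{Hol}(D,\mathbb{P}^n)$. The closure of $\mathcal{H}$ is taken in the dual projective space (the space of all hyperplanes in $\mathbb{P}^n$). Meromorphic normality. A sequence $\{f_j\}$ of meromorphic mappings $D\to\mathbb{P}^n$ converges meromorphically on $D$ to a meromorphic mapping $f$ if each $a\in D$ has an open neighborhood $U$ and admissible representations $(f_{j,0},\dots,f_{j,n})$ of $f_j$ on $U$, $j=1,2,\dots$, such that for each $l$ the sequence $\{f_{j,l}\}_j$ converges uniformly on compact subsets of $U$ to a holomorphic function $f_l$ on $U$, with $f_{l_0}\not\equiv0$ on $U$ for some $l_0$, and $f(z)=[f_0(z):\cdots:f_n(z)]$ for all $z\in U\setminus\bigcap_{l=0}^n f_l^{-1}\{0\}$.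 A family $\mathcal{F}$ of meromorphic mappings $D\to\mathbb{P}^n$ is meromorphically normal if every sequence in $\mathcal{F}$ has a subsequence that converges meromorphically on $D$. *)

theory Defs
  imports "HOL-Analysis.Analysis"
begin

section \<open>Complex projective space\<close>

text \<open>
  Homogeneous coordinates are indexed by a finite type \<open>'k\<close>, so \<open>'k cproj\<close> is the projective
  space of dimension \<open>CARD('k) - 1\<close>.
\<close>

definition proj_rel :: "complex^'k \<Rightarrow> complex^'k \<Rightarrow> bool" where
  "proj_rel v w \<longleftrightarrow> v \<noteq> 0 \<and> w \<noteq> 0 \<and> (\<exists>c. w = c *s v)"

lemma part_equivp_proj_rel: "part_equivp (proj_rel :: complex^'k \<Rightarrow> complex^'k \<Rightarrow> bool)"
proof (rule part_equivpI)
  have "proj_rel (1 :: complex^'k) 1"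
    unfolding proj_rel_def by (auto intro: exI[of _ 1])
  then show "\<exists>x :: complex^'k. proj_rel x x" by blast
  show "symp (proj_rel :: complex^'k \<Rightarrow> complex^'k \<Rightarrow> bool)"
  proof (rule sympI)
    fix v w :: "complex^'k"
    assume vw: "proj_rel v w"
    then obtain c where c: "w = c *s v" and nz: "v \<noteq> 0" "w \<noteq> 0"
      unfolding proj_rel_def by blast
    then have "c \<noteq> 0" by auto
    then have "v = inverse c *s w" using c by (simp add: vector_smult_assoc)
    then show "proj_rel w v" using nz unfolding proj_rel_def by blast
  qed
  show "transp (proj_rel :: complex^'k \<Rightarrow> complex^'k \<Rightarrow> bool)"
    unfolding proj_rel_def by (rule transpI) (metis vector_smult_assoc)
qed

text \<open>\<open>proj v\<close> is the point with homogeneous coordinates \<open>v\<close>; it is unspecified for \<open>v = 0\<close>.\<close>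

quotient_type 'k cproj = "complex^'k" / partial: proj_rel
  morphisms hcoords proj
  by (rule part_equivp_proj_rel)

lemma proj_eq_iff:
  assumes "v \<noteq> 0" "w \<noteq> 0"
  shows "proj v = proj w \<longleftrightarrow> (\<exists>c. w = c *s v)"
proof -
  have "proj_rel v v" "proj_rel w w"
    using assms unfolding proj_rel_def by (auto intro: exI[of _ 1])
  then have "proj v = proj w \<longleftrightarrow> proj_rel v w"
    using Quotient_rel[OF Quotient_cproj, of v w] by auto
  then show ?thesis using assms by (simp add: proj_rel_def)
qed

lemma proj_surj: "\<exists>v. v \<noteq> 0 \<and> p = proj v"
proof -
  have "proj_rel (hcoords p) (hcoords p)" "proj (hcoords p) = p"
    using Quotient_rep_reflp[OF Quotient_cproj] Quotient_abs_rep[OF Quotient_cproj] by auto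
  then show ?thesis unfolding proj_rel_def by metis
qed

text \<open>The topology is the quotient topology of the punctured coordinate space.\<close>

instantiation cproj :: (finite) topological_space
begin

definition open_cproj :: "'a cproj set \<Rightarrow> bool" where
  "open_cproj W \<longleftrightarrow> open {v. v \<noteq> 0 \<and> proj v \<in> W}"

instance
proof
  have "{v :: complex^'a. v \<noteq> 0} = - {0}" by auto
  then show "open (UNIV :: 'a cproj set)"
    using open_Compl[OF closed_singleton[of "0 :: complex^'a"]] by (simp add: open_cproj_def)
next
  fix S T :: "'a cproj set"
  assume "open S" "open T"
  moreover have "{v. v \<noteq> 0 \<and> proj v \<in> S \<inter> T}
      = {v. v \<noteq> 0 \<and> proj v \<in> S} \<inter> {v. v \<noteq> 0 \<and> proj v \<in> T}" by auto
  ultimately show "open (S \<inter> T)" by (simp add: open_cproj_def open_Int)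
next
  fix K :: "'a cproj set set"
  assume "\<forall>S\<in>K. open S"
  moreover have "{v. v \<noteq> 0 \<and> proj v \<in> \<Union>K} = (\<Union>S\<in>K. {v. v \<noteq> 0 \<and> proj v \<in> S})" by auto
  ultimately show "open (\<Union>K)" by (simp add: open_cproj_def open_UN)
qed

end


section \<open>Hyperplanes\<close>

definition hyperplane :: "complex^'k \<Rightarrow> 'k cproj set" where
  "hyperplane a = {proj w | w. w \<noteq> 0 \<and> (\<Sum>l\<in>UNIV. a $ l * w $ l) = 0}"

definition hyperplanes :: "'k::finite cproj set set" where
  "hyperplanes = {hyperplane a | a. a \<noteq> 0}"

text \<open>
  The dual projective space is again \<open>'k cproj\<close>, the point \<open>proj a\<close> standing for \<open>hyperplane a\<close>.
\<close>

definition hyperplane_closure :: "'k::finite cproj set set \<Rightarrow> 'k cproj set set" where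
  "hyperplane_closure \<H> =
     {hyperplane a | a. a \<noteq> 0 \<and> proj a \<in> closure {proj b | b. b \<noteq> 0 \<and> hyperplane b \<in> \<H>}}"

text \<open>A unit normal is determined up to a factor of modulus 1, which does not affect \<open>hyp_det\<close>.\<close>

definition unit_normal :: "'k::finite cproj set \<Rightarrow> complex^'k" where
  "unit_normal H = (SOME a. norm a = 1 \<and> H = hyperplane a)"

definition hyp_det :: "('k::finite \<Rightarrow> 'k cproj set) \<Rightarrow> real" where
  "hyp_det H = cmod (det (\<chi> i. unit_normal (H i)))"

text \<open>
  The factors are indexed by the subsets \<open>S\<close> of \<open>{1..q}\<close> with \<open>CARD('k)\<close> elements. The rows of the
  determinant are put into correspondence with \<open>S\<close> by an arbitrary bijection, since the modulus
  of the determinant does not depend on the order of the rows (see \<open>hyp_det_bij_cong\<close> below).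
\<close>

definition hyp_D :: "nat \<Rightarrow> (nat \<Rightarrow> 'k::finite cproj set) \<Rightarrow> real" where
  "hyp_D q H = (\<Prod>S | S \<subseteq> {1..q} \<and> card S = CARD('k).
     hyp_det (H \<circ> (SOME e :: 'k \<Rightarrow> nat. bij_betw e UNIV S)))"

lemma proj_in_hyperplane_iff:
  assumes "w \<noteq> 0"
  shows "proj w \<in> hyperplane a \<longleftrightarrow> (\<Sum>l\<in>UNIV. a $ l * w $ l) = 0"
proof
  assume "proj w \<in> hyperplane a"
  then obtain v where v: "v \<noteq> 0" "proj v = proj w" "(\<Sum>l\<in>UNIV. a $ l * v $ l) = 0"
    unfolding hyperplane_def by auto
  then obtain c where "w = c *s v" using proj_eq_iff[of v w] assms by auto
  then have "(\<Sum>l\<in>UNIV. a $ l * w $ l) = c * (\<Sum>l\<in>UNIV. a $ l * v $ l)"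
    by (simp add: sum_distrib_left mult.left_commute)
  then show "(\<Sum>l\<in>UNIV. a $ l * w $ l) = 0" using v by simp
qed (use assms in \<open>auto simp: hyperplane_def\<close>)

lemma hyperplane_eqD:
  fixes a b :: "complex^'k"
  assumes eq: "hyperplane a = hyperplane b" and a: "a \<noteq> 0"
  shows "\<exists>c. b = c *s a"
proof -
  obtain l where l: "a $ l \<noteq> 0" using a by (auto simp: vec_eq_iff)
  have "a $ l * b $ j = a $ j * b $ l" for j
  proof (cases "j = l")
    case False
    define w :: "complex^'k" where "w = (\<chi> i. if i = j then a $ l else if i = l then - a $ j else 0)"
    have w: "w \<noteq> 0" using l False by (auto simp: w_def vec_eq_iff intro: exI[of _ j])
    have s: "(\<Sum>i\<in>UNIV. d $ i * w $ i) = d $ j * a $ l - d $ l * a $ j" for d :: "complex^'k"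
    proof -
      have "(\<Sum>i\<in>UNIV. d $ i * w $ i) = (\<Sum>i\<in>{j, l}. d $ i * w $ i)"
        by (rule sum.mono_neutral_right) (auto simp: w_def)
      also have "\<dots> = d $ j * a $ l - d $ l * a $ j" using False by (simp add: w_def)
      finally show ?thesis .
    qed
    have "proj w \<in> hyperplane a" using proj_in_hyperplane_iff[OF w, of a] s[of a] by simp
    then have "b $ j * a $ l - b $ l * a $ j = 0"
      using eq proj_in_hyperplane_iff[OF w, of b] s[of b] by simp
    then show ?thesis by (simp add: mult.commute)
  qed (simp add: mult.commute)
  then have "b = (b $ l / a $ l) *s a"
    using l by (simp add: vec_eq_iff field_simps)
  then show ?thesis by blast
qed

lemma unit_normal:
  assumes "H \<in> hyperplanes"
  shows "norm (unit_normal H) = 1" "H = hyperplane (unit_normal H)"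
proof -
  obtain a where a: "a \<noteq> 0" "H = hyperplane a" using assms unfolding hyperplanes_def by auto
  let ?b = "inverse (norm a) *\<^sub>R a"
  have "norm ?b = 1" using a by simp
  moreover have "hyperplane ?b = hyperplane a"
    using a unfolding hyperplane_def
    by (simp add: scaleR_sum_right[symmetric] mult_scaleR_left)
  ultimately have "norm ?b = 1 \<and> H = hyperplane ?b" using a by simp
  then have "norm (unit_normal H) = 1 \<and> H = hyperplane (unit_normal H)"
    unfolding unit_normal_def by (rule someI)
  then show "norm (unit_normal H) = 1" "H = hyperplane (unit_normal H)" by auto
qed

lemma norm_vector_smult: "norm (c *s (a :: complex^'k)) = cmod c * norm a"
  by (simp add: norm_vec_def norm_mult L2_set_right_distrib)

lemma hyp_det_eq:
  fixes \<alpha> :: "'k::finite \<Rightarrow> complex^'k"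
  assumes "\<And>i. norm (\<alpha> i) = 1" and "\<And>i. H i = hyperplane (\<alpha> i)"
  shows "hyp_det H = cmod (det (\<chi> i. \<alpha> i))"
proof -
  have nz: "\<alpha> i \<noteq> 0" for i using assms(1)[of i] by auto
  have H: "H i \<in> hyperplanes" for i using nz assms(2) unfolding hyperplanes_def by auto
  have "\<exists>c. unit_normal (H i) = c *s \<alpha> i" for i
    using hyperplane_eqD[OF _ nz] unit_normal(2)[OF H, of i] assms(2)[of i] by metis
  then obtain c where c: "\<And>i. unit_normal (H i) = c i *s \<alpha> i" by metis
  have "cmod (c i) = 1" for i
    using unit_normal(1)[OF H, of i] assms(1)[of i] by (simp add: c norm_vector_smult)
  then show ?thesis
    unfolding hyp_det_def c by (simp add: det_rows_mul norm_mult prod_norm[symmetric])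
qed

lemma hyp_det_bij_cong:
  fixes e e' :: "'k::finite \<Rightarrow> nat"
  assumes e: "bij_betw e UNIV S" and e': "bij_betw e' UNIV S"
  shows "hyp_det (H \<circ> e) = hyp_det (H \<circ> e')"
proof -
  define p where "p = inv_into UNIV e' \<circ> e"
  have "bij p"
    unfolding p_def by (rule bij_betw_trans[OF e bij_betw_inv_into[OF e']])
  then have p: "p permutes UNIV" by (rule bij_imp_permutes) auto
  have "e i = e' (p i)" for i
    unfolding p_def using e e' by (metis bij_betw_def comp_apply f_inv_into_f rangeI)
  then have "(\<chi> i. unit_normal ((H \<circ> e) i))
      = (\<chi> i. (\<chi> i. unit_normal ((H \<circ> e') i)) $ p i)"
    by (simp add: vec_eq_iff)
  then show ?thesis
    unfolding hyp_det_def using det_permute_rows[OF p, of "\<chi> i. unit_normal ((H \<circ> e') i)"]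
    by (simp add: norm_mult sign_def)
qed


section \<open>Holomorphic functions of several variables and their zeros\<close>

definition holo_on :: "(complex^'m \<Rightarrow> complex) \<Rightarrow> (complex^'m) set \<Rightarrow> bool" where
  "holo_on h U \<longleftrightarrow>
     (\<forall>z\<in>U. \<exists>h'. (h has_derivative h') (at z) \<and> (\<forall>c v. h' (c *s v) = c * h' v))"

definition holo_vec_on :: "(complex^'m \<Rightarrow> complex^'k) \<Rightarrow> (complex^'m) set \<Rightarrow> bool" where
  "holo_vec_on F U \<longleftrightarrow> (\<forall>l. holo_on (\<lambda>z. F z $ l) U)"

definition has_power_series_at ::
    "(complex^'m \<Rightarrow> complex) \<Rightarrow> (('m \<Rightarrow> nat) \<Rightarrow> complex) \<Rightarrow> complex^'m \<Rightarrow> bool" where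
  "has_power_series_at h c a \<longleftrightarrow>
     (\<exists>r>0. \<forall>z\<in>ball a r.
        ((\<lambda>\<mu>. c \<mu> * (\<Prod>i\<in>UNIV. (z $ i - a $ i) ^ \<mu> i)) has_sum h z) UNIV)"

text \<open>Meaningful only for \<open>h\<close> holomorphic and not identically zero near \<open>a\<close>.\<close>

definition vanishing_order :: "(complex^'m \<Rightarrow> complex) \<Rightarrow> complex^'m \<Rightarrow> nat" where
  "vanishing_order h a =
     (LEAST d. \<exists>c \<mu>. has_power_series_at h c a \<and> c \<mu> \<noteq> 0 \<and> (\<Sum>i\<in>UNIV. \<mu> i) = d)"

text \<open>
  \<open>A\<close> is, near its point \<open>a\<close>, a complex submanifold of codimension \<open>c\<close>: some local biholomorphic
  map \<open>\<phi>\<close> (with inverse \<open>\<psi>\<close>) takes it to a coordinate subspace.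
\<close>

definition regular_point :: "(complex^'m) set \<Rightarrow> nat \<Rightarrow> complex^'m \<Rightarrow> bool" where
  "regular_point A c a \<longleftrightarrow> a \<in> A \<and>
     (\<exists>U V \<phi> \<psi> J. open U \<and> a \<in> U \<and> open V \<and> \<phi> ` U = V \<and>
        holo_vec_on \<phi> U \<and> holo_vec_on \<psi> V \<and> (\<forall>z\<in>U. \<psi> (\<phi> z) = z) \<and>
        \<phi> ` (A \<inter> U) = {w\<in>V. \<forall>j\<in>J. w $ j = 0} \<and> card (J :: 'm set) = c)"

text \<open>
  Used for analytic sets only: their regular points are dense, and their codimension is by
  definition the least codimension at a regular point (infinite for the empty set).
\<close>

definition codim_at_least :: "(complex^'m) set \<Rightarrow> nat \<Rightarrow> bool" where
  "codim_at_least A k \<longleftrightarrow> (\<forall>a c. regular_point A c a \<longrightarrow> k \<le> c)"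


section \<open>Meromorphic and holomorphic mappings into projective space\<close>

text \<open>
  A meromorphic mapping on \<open>D\<close> is a partial function whose domain of definition is the complement
  in \<open>D\<close> of its indeterminacy locus, that is, \<open>I(f) = D - dom f\<close>.
\<close>

definition admissible_rep ::
    "(complex^'m) set \<Rightarrow> (complex^'m \<rightharpoonup> 'k::finite cproj) \<Rightarrow> (complex^'m) set \<Rightarrow>
      (complex^'m \<Rightarrow> complex^'k) \<Rightarrow> bool" where
  "admissible_rep D f U F \<longleftrightarrow> open U \<and> U \<subseteq> D \<and> holo_vec_on F U \<and>
     (\<forall>z\<in>U. f z = (if F z = 0 then None else Some (proj (F z))))"

text \<open>
  That \<open>D - dom f\<close> is analytic follows from the local representations, of which it is locally the
  common zero set.
\<close>

definition meromorphic_map ::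
    "(complex^'m) set \<Rightarrow> (complex^'m \<rightharpoonup> 'k::finite cproj) \<Rightarrow> bool" where
  "meromorphic_map D f \<longleftrightarrow> dom f \<subseteq> D \<and> codim_at_least (D - dom f) 2 \<and>
     (\<forall>a\<in>D. \<exists>U F. a \<in> U \<and> admissible_rep D f U F)"

definition Hol :: "(complex^'m) set \<Rightarrow> (complex^'m \<Rightarrow> 'k::finite cproj) set" where
  "Hol D = {g \<in> extensional D. \<forall>a\<in>D. \<exists>U F. open U \<and> a \<in> U \<and> U \<subseteq> D \<and>
     holo_vec_on F U \<and> (\<forall>z\<in>U. F z \<noteq> 0 \<and> g z = proj (F z))}"

definition Hol_topology ::
    "(complex^'m) set \<Rightarrow> (complex^'m \<Rightarrow> 'k::finite cproj) topology" where
  "Hol_topology D = subtopology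
     (topology_generated_by {{g. g ` K \<subseteq> W} | K W. compact K \<and> K \<subseteq> D \<and> open W}) (Hol D)"

definition normal_family ::
    "(complex^'m) set \<Rightarrow> (complex^'m \<Rightarrow> 'k::finite cproj) set \<Rightarrow> bool" where
  "normal_family D \<G> \<longleftrightarrow> \<G> \<subseteq> Hol D \<and> compactin (Hol_topology D) (Hol_topology D closure_of \<G>)"

text \<open>The closure of the graph, taken in \<open>D \<times> UNIV\<close>.\<close>

definition graph_closure ::
    "(complex^'m) set \<Rightarrow> (complex^'m \<rightharpoonup> 'k::finite cproj) \<Rightarrow> ((complex^'m) \<times> 'k cproj) set" where
  "graph_closure D f = closure {(z, p). z \<in> D \<and> f z = Some p} \<inter> (D \<times> UNIV)"

definition range_in_hyperplane ::
    "(complex^'m) set \<Rightarrow> (complex^'m \<rightharpoonup> 'k::finite cproj) \<Rightarrow> 'k cproj set \<Rightarrow> bool" where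
  "range_in_hyperplane D f H \<longleftrightarrow> graph_closure D f \<subseteq> D \<times> H"

text \<open>
  The value does not depend on the choice of the representation and of the normal vector, since
  these are unique up to a nowhere vanishing holomorphic factor and a nonzero constant.
\<close>

definition divisor ::
    "(complex^'m) set \<Rightarrow> (complex^'m \<rightharpoonup> 'k::finite cproj) \<Rightarrow> 'k cproj set \<Rightarrow> complex^'m \<Rightarrow> nat" where
  "divisor D f H a = (SOME d. \<exists>U F \<alpha>. a \<in> U \<and> admissible_rep D f U F \<and>
     \<alpha> \<noteq> 0 \<and> H = hyperplane \<alpha> \<and>
     d = vanishing_order (\<lambda>z. \<Sum>l\<in>UNIV. \<alpha> $ l * F z $ l) a)"

definition divisor_supp ::
    "(complex^'m) set \<Rightarrow> (complex^'m \<rightharpoonup> 'k::finite cproj) \<Rightarrow> 'k cproj set \<Rightarrow> (complex^'m) set" where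
  "divisor_supp D f H = {z\<in>D. divisor D f H z \<noteq> 0}"

text \<open>
  Neighbourhoods are taken connected: otherwise the limit functions could vanish identically near
  \<open>a\<close> while being nonzero on another component of \<open>U\<close>.
\<close>

definition converges_meromorphically ::
    "(complex^'m) set \<Rightarrow> (nat \<Rightarrow> complex^'m \<rightharpoonup> 'k::finite cproj) \<Rightarrow>
      (complex^'m \<rightharpoonup> 'k cproj) \<Rightarrow> bool" where
  "converges_meromorphically D f g \<longleftrightarrow>
     (\<forall>a\<in>D. \<exists>U F G. a \<in> U \<and> connected U \<and> (\<forall>j. admissible_rep D (f j) U (F j)) \<and>
        (\<forall>l K. compact K \<and> K \<subseteq> U \<longrightarrow>
           uniform_limit K (\<lambda>j z. F j z $ l) (\<lambda>z. G z $ l) sequentially) \<and>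
        holo_vec_on G U \<and> (\<exists>l. \<exists>z\<in>U. G z $ l \<noteq> 0) \<and>
        (\<forall>z\<in>U. G z \<noteq> 0 \<longrightarrow> g z = Some (proj (G z))))"

definition meromorphically_normal ::
    "(complex^'m) set \<Rightarrow> (complex^'m \<rightharpoonup> 'k::finite cproj) set \<Rightarrow> bool" where
  "meromorphically_normal D \<F> \<longleftrightarrow>
     (\<forall>f :: nat \<Rightarrow> complex^'m \<rightharpoonup> 'k cproj. range f \<subseteq> \<F> \<longrightarrow>
        (\<exists>r g. strict_mono r \<and> meromorphic_map D g \<and> converges_meromorphically D (f \<circ> r) g))"

end

theory Submission
  imports Defs "HOL-Complex_Analysis.Great_Picard" "HOL-Library.Diagonal_Subsequence"
begin

text \<open>
  Take a sequence \<open>f\<^sub>j\<close> in the family \<open>\<F>\<close>. After passing to a subsequence the unit normals of the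
  hyperplanes \<open>H\<^sub>k\<close> attached to \<open>f\<^sub>j\<close> converge for each \<open>k\<close>, and since the product of determinants
  passes to the limit, the \<open>2 n + 1\<close> limit hyperplanes are in general position. Let \<open>h\<close> be a cluster
  point of the mappings \<open>g\<^sub>f\<close> attached to the \<open>f\<^sub>j\<close>; by hypothesis \<open>h\<close> maps \<open>D\<close> into none of the limit
  hyperplanes. It suffices to bound suitable representations of \<open>f\<^sub>j\<close> near every point \<open>a\<close> of \<open>D\<close>.

  At a point \<open>z\<close> with \<open>h z\<close> on none of the limit hyperplanes, \<open>f\<^sub>j\<close> omits all its \<open>2 n + 1\<close> hyperplanes
  near \<open>z\<close> once \<open>j\<close> is large and the mapping attached to \<open>f\<^sub>j\<close> is close to \<open>h\<close>, because the divisors are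
  supported in the preimages under that mapping. Inserting a representation into the linear forms gives \<open>2 n + 1\<close> zero-free
  functions \<open>u\<^sub>k\<close>, and general position says that at each point any \<open>n + 1\<close> of them control all the
  others up to a constant. Such systems are normal (\<open>gap_bound\<close>): writing \<open>u\<^sub>k = exp \<phi>\<^sub>k\<close> on a disc
  and dividing the harmonic functions \<open>Re \<phi>\<^sub>k\<close> by a large factor, one finds limits of which at every
  point at least \<open>n + 1\<close> attain the maximum. On some open set the same \<open>n + 1\<close> do so, hence they agree
  everywhere, and as two sets of \<open>n + 1\<close> indices out of \<open>2 n + 1\<close> meet, the maximum itself is harmonic.
  Normalising one function that is maximal at the centre to \<open>0\<close>, the maximum is \<open>0\<close> everywhere. So a
  large gap between the \<open>Re \<phi>\<^sub>k\<close> becomes relatively small on a smaller disc (\<open>gap_decay\<close>). Comparing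
  the gaps over all centres and using Harnack's inequality turns this into an absolute bound.

  At an arbitrary point \<open>a\<close>, the point \<open>h a\<close> lies on at most \<open>n\<close> of the limit hyperplanes. So near \<open>a\<close>
  the same \<open>f\<^sub>j\<close> still omit \<open>n + 1\<close> hyperplanes in general position; in particular they are holomorphic
  there and can be normalised by making one of the linear forms equal to \<open>1\<close>. A small circle around \<open>a\<close> in
  a suitable complex line avoids the preimages under \<open>h\<close> of all limit hyperplanes. Near the circle the
  normalised representations are bounded by the previous step, and the maximum principle carries the
  bound to a neighbourhood of \<open>a\<close> (\<open>bounded_normalised_reps\<close>, \<open>exists_bounded_reps_near\<close>).

  Montel's theorem and a diagonal argument over a countable cover of \<open>D\<close> finish the proof
  (\<open>normalised_reps_imp_converges_meromorphically\<close>). The normalisation survives in the limit, so the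
  limit mapping is holomorphic on all of \<open>D\<close>.

  The divisor is defined through power series. To learn from a vanishing divisor that a linear form has
  no zero one must know that holomorphic functions of several variables have power series at all;
  this is proved by expanding in one coordinate at a time (\<open>power_series_on_coordinates\<close>).
\<close>

section \<open>Gaps between logarithms of zero-free functions on a disc\<close>

lemma finite_Union_closed_interior:
  assumes "finite \<A>" and "\<And>A. A \<in> \<A> \<Longrightarrow> closed (A :: 'a::topological_space set)"
    and "\<And>A. A \<in> \<A> \<Longrightarrow> interior A = {}"
  shows "interior (\<Union>\<A>) = {}"
  using assms
proof (induction \<A> rule: finite_induct)
  case (insert A \<A>)
  have "interior (A \<union> \<Union>\<A>) = interior A"
    by (rule interior_closed_Un_empty_interior) (use insert in auto)
  then show ?case using insert by simp
qed simp

lemma holomorphic_norm_le_at_center: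
  assumes f: "f holomorphic_on S" and S: "open S" "connected S"
    and a: "a \<in> S" and le: "\<And>z. z \<in> S \<Longrightarrow> norm (f z) \<le> norm (f a)" and z: "z \<in> S"
  shows "f z = f a"
proof -
  have "f constant_on S"
    by (rule maximum_modulus_principle[OF f S S(1) order_refl a le])
  then show ?thesis using a z unfolding constant_on_def by auto
qed

text \<open>
  At each point the set of indices of maximal modulus has at least \<open>n + 1\<close> elements, for otherwise
  some \<open>n + 1\<close> of the remaining functions would control the maximum. The finitely many closed sets on
  which given \<open>n + 1\<close> functions are all maximal cover a ball, so one of them has interior; there the
  quotients of these functions have modulus \<open>1\<close>, hence they have modulus \<open>1\<close> on all of \<open>S\<close>. Any other
  set of \<open>n + 1\<close> indices meets this one because \<open>2 * (n + 1) > 2 * n + 1\<close>, so one zero-free function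
  \<open>E q\<close> realises the maximum everywhere. Finally \<open>1 / E q\<close> attains its maximal modulus at \<open>a\<close>.
\<close>

lemma units_with_dominating_subsets_are_bounded:
  fixes E :: "'i \<Rightarrow> complex \<Rightarrow> complex"
  assumes I: "finite I" "card I = 2 * n + 1"
    and S: "open S" "connected S" "a \<in> S"
    and hol: "\<And>i. i \<in> I \<Longrightarrow> E i holomorphic_on S"
    and zero: "\<And>i. i \<in> I \<Longrightarrow> (\<forall>z\<in>S. E i z = 0) \<or> (\<forall>z\<in>S. E i z \<noteq> 0)"
    and dom: "\<And>z l J. z \<in> S \<Longrightarrow> l \<in> I \<Longrightarrow> J \<subseteq> I \<Longrightarrow> card J = Suc n \<Longrightarrow>
                \<exists>k\<in>J. norm (E l z) \<le> norm (E k z)"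
    and k0: "k0 \<in> I" "\<And>z. z \<in> S \<Longrightarrow> E k0 z = 1"
    and ctr: "\<And>i. i \<in> I \<Longrightarrow> norm (E i a) \<le> 1"
    and i: "i \<in> I" and z: "z \<in> S"
  shows "norm (E i z) \<le> 1"
proof -
  define M where "M z = {i\<in>I. \<forall>l\<in>I. norm (E l z) \<le> norm (E i z)}" for z
  have card_M: "Suc n \<le> card (M z)" if "z \<in> S" for z
  proof (rule ccontr)
    assume "\<not> Suc n \<le> card (M z)"
    moreover have "card (I - M z) = card I - card (M z)"
      by (rule card_Diff_subset) (use I in \<open>auto simp: M_def intro: finite_subset[OF _ I(1)]\<close>)
    ultimately have "Suc n \<le> card (I - M z)" using I by linarith
    then obtain J where J: "J \<subseteq> I - M z" "card J = Suc n"
      by (rule obtain_subset_with_card_n)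
    obtain q where q: "q \<in> I" "\<And>l. l \<in> I \<Longrightarrow> norm (E l z) \<le> norm (E q z)"
    proof -
      have "Max ((\<lambda>i. norm (E i z)) ` I) \<in> (\<lambda>i. norm (E i z)) ` I"
        using I by (intro Max_in) auto
      then obtain q where "q \<in> I" "Max ((\<lambda>i. norm (E i z)) ` I) = norm (E q z)" by auto
      with that[of q] show ?thesis using I by (metis Max_ge finite_imageI imageI)
    qed
    obtain k where "k \<in> J" "norm (E q z) \<le> norm (E k z)"
      using dom[OF \<open>z \<in> S\<close> q(1), of J] J by auto
    then have "k \<in> M z" using q J unfolding M_def by force
    then show False using J \<open>k \<in> J\<close> by auto
  qed
  obtain r where r: "r > 0" "cball a r \<subseteq> S" using S open_contains_cball by blast
  define \<J> where "\<J> = {J. J \<subseteq> I \<and> card J = Suc n}"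
  define Z where "Z J = {z \<in> cball a r. J \<subseteq> M z}" for J
  have contE: "continuous_on (cball a r) (E i)" if "i \<in> I" for i
    using holomorphic_on_imp_continuous_on[OF hol[OF that]] r(2) continuous_on_subset by blast
  have clZ: "closed (Z J)" if "J \<in> \<J>" for J
  proof -
    have "Z J = cball a r \<inter> (\<Inter>i\<in>J. \<Inter>l\<in>I. {z \<in> cball a r. norm (E l z) \<le> norm (E i z)})"
      using that unfolding Z_def M_def \<J>_def by auto
    moreover have "closed {z \<in> cball a r. norm (E l z) \<le> norm (E i z)}" if "i \<in> I" "l \<in> I" for i l
      by (rule continuous_on_closed_Collect_le) (use contE that in \<open>auto intro!: continuous_intros\<close>)
    ultimately show ?thesis using that unfolding \<J>_def by (auto intro!: closed_Int closed_INT)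
  qed
  have "cball a r \<subseteq> \<Union>(Z ` \<J>)"
  proof
    fix z assume z: "z \<in> cball a r"
    then have "Suc n \<le> card (M z)" using card_M r by auto
    then obtain J where "J \<subseteq> M z" "card J = Suc n" by (rule obtain_subset_with_card_n)
    then show "z \<in> \<Union>(Z ` \<J>)" using z unfolding Z_def \<J>_def M_def by auto
  qed
  then have "ball a r \<subseteq> interior (\<Union>(Z ` \<J>))"
    by (meson ball_subset_cball interior_maximal open_ball order_trans)
  then have "interior (\<Union>(Z ` \<J>)) \<noteq> {}" using r by auto
  moreover have "finite (Z ` \<J>)" unfolding \<J>_def using I by simp
  ultimately obtain J where J: "J \<in> \<J>" "interior (Z J) \<noteq> {}"
    using finite_Union_closed_interior[of "Z ` \<J>"] clZ by blast
  then obtain p where p: "p \<in> interior (Z J)" by auto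
  have VS: "interior (Z J) \<subseteq> S" using interior_subset[of "Z J"] r(2) unfolding Z_def by blast
  have "J \<noteq> {}" using J unfolding \<J>_def by auto
  then obtain q where q: "q \<in> J" by auto
  have JI: "J \<subseteq> I" "card J = Suc n" using J unfolding \<J>_def by auto
  have VM: "J \<subseteq> M z" if "z \<in> interior (Z J)" for z
    using that interior_subset[of "Z J"] unfolding Z_def by auto
  have max1: "1 \<le> norm (E j z)" if "j \<in> M z" "z \<in> S" for j z
    using that k0 unfolding M_def by force
  have nz: "E j z \<noteq> 0" if "j \<in> J" "z \<in> S" for j z
  proof -
    have "E j p \<noteq> 0" using max1[of j p] VM[OF p] that p VS by force
    then show ?thesis using zero[of j] JI p VS that by blast
  qed
  have same: "norm (E j z) = norm (E q z)" if j: "j \<in> J" and z: "z \<in> S" for j z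
  proof -
    have h: "(\<lambda>z. E j z / E q z) holomorphic_on S"
      using hol JI j q nz by (intro holomorphic_intros) auto
    have one: "norm (E j z / E q z) = 1" if "z \<in> interior (Z J)" for z
    proof -
      have "norm (E j z) = norm (E q z)"
        using VM[OF that] j q JI unfolding M_def by (intro antisym) auto
      then show ?thesis using nz[OF q, of z] that VS by (auto simp: norm_divide)
    qed
    have "(\<lambda>z. E j z / E q z) constant_on S"
      by (rule maximum_modulus_principle[OF h S(1,2) open_interior VS p]) (simp only: one p)
    then have "E j z / E q z = E j p / E q p"
      using z p VS unfolding constant_on_def by (metis subsetD)
    then have "norm (E j z / E q z) = 1" using one[OF p] by simp
    then show ?thesis using nz[OF q z] by (simp add: norm_divide)
  qed
  have max: "norm (E l z) \<le> norm (E q z)" if z: "z \<in> S" and l: "l \<in> I" for l z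
  proof -
    \<comment> \<open>Here the number \<open>2 * n + 1\<close> of functions matters.\<close>
    have "J \<inter> M z \<noteq> {}"
    proof
      assume "J \<inter> M z = {}"
      then have "card (J \<union> M z) = card J + card (M z)"
        using I JI by (intro card_Un_disjoint) (auto simp: M_def intro: finite_subset[OF _ I(1)])
      moreover have "card (J \<union> M z) \<le> card I" using I JI by (intro card_mono) (auto simp: M_def)
      ultimately show False using card_M[OF z] JI I by linarith
    qed
    then obtain j where "j \<in> J" "j \<in> M z" by auto
    then show ?thesis using same[OF \<open>j \<in> J\<close> z] l unfolding M_def by auto
  qed
  have h: "(\<lambda>z. inverse (E q z)) holomorphic_on S"
    using hol JI q nz by (intro holomorphic_intros) auto
  have ge1: "1 \<le> norm (E q z)" if "z \<in> S" for z using max[OF that k0(1)] k0(2)[OF that] by simp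
  have qa: "norm (E q a) = 1" using ge1[OF S(3)] ctr[of q] q JI by (intro antisym) auto
  have "inverse (E q z) = inverse (E q a)"
    by (rule holomorphic_norm_le_at_center[OF h S _ z])
       (use ge1 qa in \<open>auto simp: norm_inverse intro!: inverse_le_1_iff[THEN iffD2]\<close>)
  then have "norm (E q z) = 1" using qa by simp
  then show ?thesis using max[OF z i] by simp
qed

lemma finite_common_subsequence:
  assumes "finite I"
    and ex: "\<And>i s. i \<in> I \<Longrightarrow> strict_mono (s :: nat \<Rightarrow> nat) \<Longrightarrow> \<exists>r. strict_mono r \<and> P i (s \<circ> r)"
    and stable: "\<And>i s r. i \<in> I \<Longrightarrow> P i s \<Longrightarrow> strict_mono (r :: nat \<Rightarrow> nat) \<Longrightarrow> P i (s \<circ> r)"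
  obtains r where "strict_mono (r :: nat \<Rightarrow> nat)" "\<And>i. i \<in> I \<Longrightarrow> P i r"
proof -
  have "\<exists>r. strict_mono (r :: nat \<Rightarrow> nat) \<and> (\<forall>i\<in>I. P i r)"
    using assms
  proof (induction I rule: finite_induct)
    case empty
    then show ?case by (auto intro!: exI[of _ id] simp: strict_mono_def)
  next
    case (insert i I)
    have "\<exists>r. strict_mono r \<and> (\<forall>i\<in>I. P i r)"
      by (rule insert.IH) (use insert.prems in blast)+
    then obtain r where r: "strict_mono r" "\<forall>i\<in>I. P i r" by blast
    obtain s where s: "strict_mono s" "P i (r \<circ> s)" using insert.prems(1)[OF insertI1 r(1)] by blast
    have "\<forall>i\<in>I. P i (r \<circ> s)" using insert.prems(2)[OF _ _ s(1)] r by blast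
    then show ?case using s r strict_mono_o by blast
  qed
  then show ?thesis using that by blast
qed

text \<open>
  The functions \<open>\<phi> i\<close> are logarithms of zero-free functions, and the second clause is the trace of
  general position: any \<open>n + 1\<close> of the moduli bound the others up to the factor \<open>exp C\<close>.
\<close>

definition balanced :: "'i set \<Rightarrow> nat \<Rightarrow> real \<Rightarrow> complex set \<Rightarrow> ('i \<Rightarrow> complex \<Rightarrow> complex) \<Rightarrow> bool" where
  "balanced I n C U \<phi> \<longleftrightarrow> (\<forall>i\<in>I. \<phi> i holomorphic_on U) \<and>
     (\<forall>z\<in>U. \<forall>l\<in>I. \<forall>J\<subseteq>I. card J = Suc n \<longrightarrow> (\<exists>k\<in>J. Re (\<phi> l z) \<le> Re (\<phi> k z) + C))"

text \<open>
  For \<open>U = {a}\<close> the index \<open>k\<close> is almost maximal at the point \<open>a\<close>; for a disc \<open>U\<close> the constant \<open>C\<close>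
  bounds the gap between the largest real part and that of \<open>\<phi> k\<close>.
\<close>

definition dominant ::
    "'i set \<Rightarrow> real \<Rightarrow> ('i \<Rightarrow> complex \<Rightarrow> complex) \<Rightarrow> complex set \<Rightarrow> 'i \<Rightarrow> bool" where
  "dominant I C \<phi> U k \<longleftrightarrow> k \<in> I \<and> (\<forall>l\<in>I. \<forall>z\<in>U. Re (\<phi> l z) \<le> Re (\<phi> k z) + C)"

lemma dominantD:
  "dominant I C \<phi> U k \<Longrightarrow> l \<in> I \<Longrightarrow> z \<in> U \<Longrightarrow> Re (\<phi> l z) \<le> Re (\<phi> k z) + C"
  unfolding dominant_def by blast

lemma dominant_mono:
  "dominant I C \<phi> U k \<Longrightarrow> C \<le> C' \<Longrightarrow> V \<subseteq> U \<Longrightarrow> dominant I C' \<phi> V k"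
  unfolding dominant_def by fastforce

text \<open>
  If this failed for every \<open>K\<close>, there would be counterexamples with gaps \<open>M j\<close> tending to infinity.
  Passing to the \<open>M j\<close>-th roots of the quotients of the underlying zero-free functions makes the
  additive error \<open>C\<close> disappear in the limit. By Montel and Hurwitz the limits are zero-free or
  identically zero, and \<open>units_with_dominating_subsets_are_bounded\<close> contradicts the assumed growth.
\<close>

lemma unit_disc_gap_decay_fixed:
  fixes I :: "'i set"
  assumes I: "finite I" "card I = 2 * n + 1" and \<epsilon>: "0 < \<epsilon>" and k: "k \<in> I" and l: "l \<in> I"
  shows "\<exists>K. \<forall>\<phi> M. balanced I n C (ball 0 1) \<phi> \<longrightarrow> dominant I C \<phi> {0} k \<longrightarrow> K \<le> M \<longrightarrow>
      dominant I M \<phi> (ball 0 1) k \<longrightarrow>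
      (\<forall>z\<in>ball 0 (1/2). Re (\<phi> l z) \<le> Re (\<phi> k z) + \<epsilon> * M)"
    (is "\<exists>K. \<forall>\<phi> M. ?P K \<phi> M")
proof (rule ccontr)
  assume "\<not> ?thesis"
  then have "\<forall>j. \<exists>\<phi> M. \<not> ?P (real j + 1) \<phi> M" by blast
  then obtain \<phi> M where "\<And>j. \<not> ?P (real j + 1) (\<phi> j) (M j)" by metis
  then have bal: "\<And>j. balanced I n C (ball 0 1) (\<phi> j)" and domk: "\<And>j. dominant I C (\<phi> j) {0} k"
    and M: "\<And>j. real j + 1 \<le> M j"
    and domM: "\<And>j. dominant I (M j) (\<phi> j) (ball 0 1) k"
    and ex: "\<And>j. \<exists>z\<in>ball 0 (1/2). Re (\<phi> j l z) > Re (\<phi> j k z) + \<epsilon> * M j"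
    by (force simp: not_le)+
  have Mpos: "0 < M j" for j using M[of j] by linarith
  have hol: "\<phi> j i holomorphic_on ball 0 1" if "i \<in> I" for j i
    using bal[of j] that unfolding balanced_def by blast
  \<comment> \<open>The \<open>M j\<close>-th roots of the quotients of the zero-free functions.\<close>
  define E where "E i j z = exp ((\<phi> j i z - \<phi> j k z) / of_real (M j))" for i j z
  have norm_E: "norm (E i j z) = exp ((Re (\<phi> j i z) - Re (\<phi> j k z)) / M j)" for i j z
    unfolding E_def norm_exp_eq_Re by simp
  have holE: "E i j holomorphic_on ball 0 1" if "i \<in> I" for i j
    unfolding E_def using hol that k Mpos[of j] by (intro holomorphic_intros) auto
  have E_le: "norm (E i j z) \<le> exp 1" if "i \<in> I" "z \<in> ball 0 1" for i j z
    using dominantD[OF domM that, of j] Mpos[of j] unfolding norm_E by (simp add: field_simps)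
  define P where "P i r \<longleftrightarrow> (\<exists>g. g holomorphic_on ball 0 1 \<and>
      (\<forall>K. compact K \<longrightarrow> K \<subseteq> ball 0 1 \<longrightarrow> uniform_limit K (\<lambda>j. E i (r j)) g sequentially))"
    for i and r :: "nat \<Rightarrow> nat"
  obtain r :: "nat \<Rightarrow> nat" where r: "strict_mono r" and Pr: "\<And>i. i \<in> I \<Longrightarrow> P i r"
  proof (rule finite_common_subsequence[OF I(1), of P])
    fix i s assume i: "i \<in> I" and s: "strict_mono (s :: nat \<Rightarrow> nat)"
    obtain g r where "g holomorphic_on ball 0 1" "strict_mono (r :: nat \<Rightarrow> nat)"
      "\<And>K. compact K \<Longrightarrow> K \<subseteq> ball 0 1 \<Longrightarrow> uniform_limit K ((\<lambda>j. E i (s j)) \<circ> r) g sequentially"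
    proof (rule Montel[of "ball 0 1" "range (E i)" "\<lambda>j. E i (s j)"])
      fix K :: "complex set" assume "K \<subseteq> ball 0 1"
      then show "\<exists>B. \<forall>h\<in>range (E i). \<forall>z\<in>K. norm (h z) \<le> B" using E_le[OF i] by blast
    qed (use holE[OF i] in auto)
    then show "\<exists>r. strict_mono r \<and> P i (s \<circ> r)" unfolding P_def by (auto simp: o_def)
  next
    fix i s r assume "P i s" and r: "strict_mono (r :: nat \<Rightarrow> nat)"
    then obtain g where g: "g holomorphic_on ball 0 1"
      "\<And>K. compact K \<Longrightarrow> K \<subseteq> ball 0 1 \<Longrightarrow> uniform_limit K (\<lambda>j. E i (s j)) g sequentially"
      unfolding P_def by blast
    have "uniform_limit K (\<lambda>j. E i ((s \<circ> r) j)) g sequentially" if "compact K" "K \<subseteq> ball 0 1" for K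
      using filterlim_compose[OF g(2)[OF that] filterlim_subseq[OF r]] by (simp add: o_def)
    then show "P i (s \<circ> r)" using g(1) unfolding P_def by blast
  qed (use that in blast)
  from Pr have "\<forall>i\<in>I. \<exists>g. g holomorphic_on ball 0 1 \<and>
      (\<forall>K. compact K \<longrightarrow> K \<subseteq> ball 0 1 \<longrightarrow> uniform_limit K (\<lambda>j. E i (r j)) g sequentially)"
    unfolding P_def by blast
  then obtain G where holG: "\<And>i. i \<in> I \<Longrightarrow> G i holomorphic_on ball 0 1"
    and G: "\<And>i K. i \<in> I \<Longrightarrow> compact K \<Longrightarrow> K \<subseteq> ball 0 1 \<Longrightarrow> uniform_limit K (\<lambda>j. E i (r j)) (G i) sequentially"
    by metis
  have lim: "(\<lambda>j. E i (r j) z) \<longlonglongrightarrow> G i z" if "i \<in> I" "z \<in> ball 0 1" for i z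
    using tendsto_uniform_limitI[OF G[OF that(1), of "{z}"]] that by auto
  have C0: "(\<lambda>j. C / M (r j)) \<longlonglongrightarrow> 0"
  proof -
    have "filterlim (\<lambda>j. M j) at_top sequentially"
      by (rule filterlim_at_top_mono[OF filterlim_real_sequentially]) (use M in \<open>auto intro!: always_eventually order_trans[OF _ M]\<close>)
    then have "(\<lambda>j. C / M j) \<longlonglongrightarrow> 0" by (intro tendsto_divide_0[OF tendsto_const] filterlim_at_top_imp_at_infinity)
    then show ?thesis using LIMSEQ_subseq_LIMSEQ[OF _ r, of "\<lambda>j. C / M j"] by (simp add: o_def)
  qed
  then have C1: "(\<lambda>j. exp (C / M (r j))) \<longlonglongrightarrow> 1" using tendsto_exp[OF C0] by simp
  have G_le: "norm (G i z) \<le> 1" if i: "i \<in> I" and z: "z \<in> ball 0 1" for i z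
  proof (rule units_with_dominating_subsets_are_bounded[OF I, of "ball 0 1" 0 G k])
    fix i assume i: "i \<in> I"
    show "G i holomorphic_on ball 0 1" by (rule holG[OF i])
    show "(\<forall>z\<in>ball 0 1. G i z = 0) \<or> (\<forall>z\<in>ball 0 1. G i z \<noteq> 0)"
    proof (cases "G i constant_on ball 0 1")
      case True
      then show ?thesis unfolding constant_on_def by metis
    next
      case False
      have "G i z \<noteq> 0" if z: "z \<in> ball 0 1" for z
        by (rule Hurwitz_no_zeros[OF _ _ holE[OF i] holG[OF i] G[OF i] False _ z])
           (auto simp: E_def)
      then show ?thesis by blast
    qed
    show "norm (G i 0) \<le> 1"
    proof (rule LIMSEQ_le[OF tendsto_norm[OF lim[OF i]] C1])
      have "norm (E i (r j) 0) \<le> exp (C / M (r j))" for j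
        using dominantD[OF domk i, of 0 "r j"] Mpos[of "r j"] unfolding norm_E
        by (simp add: divide_right_mono algebra_simps)
      then show "\<exists>N. \<forall>j\<ge>N. norm (E i (r j) 0) \<le> exp (C / M (r j))" by blast
    qed simp
  next
    fix z l J assume z: "z \<in> ball (0::complex) 1" and l: "l \<in> I" and J: "J \<subseteq> I" "card J = Suc n"
    show "\<exists>k\<in>J. norm (G l z) \<le> norm (G k z)"
    proof (rule ccontr)
      assume "\<not> ?thesis"
      then have less: "norm (G q z) < norm (G l z)" if "q \<in> J" for q using that by (auto simp: not_le)
      have "\<forall>\<^sub>F j in sequentially. norm (E q (r j) z) * exp (C / M (r j)) < norm (E l (r j) z)" if q: "q \<in> J" for q
      proof -
        have "(\<lambda>j. norm (E q (r j) z) * exp (C / M (r j))) \<longlonglongrightarrow> norm (G q z) * 1"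
          by (intro tendsto_mult tendsto_norm lim C1) (use q J z in auto)
        moreover have "(\<lambda>j. norm (E l (r j) z)) \<longlonglongrightarrow> norm (G l z)"
          by (intro tendsto_norm lim l z)
        moreover have "norm (G q z) * 1 < norm (G l z)" using less[OF q] by simp
        ultimately show ?thesis
          using order_tendstoD(1)[of "\<lambda>j. norm (E l (r j) z) - norm (E q (r j) z) * exp (C / M (r j))" _ sequentially 0]
          by (auto dest: tendsto_diff)
      qed
      moreover have "finite J" using J I finite_subset by blast
      ultimately have "\<forall>\<^sub>F j in sequentially. \<forall>q\<in>J. norm (E q (r j) z) * exp (C / M (r j)) < norm (E l (r j) z)"
        by (intro eventually_ball_finite) auto
      then obtain j where j: "\<And>q. q \<in> J \<Longrightarrow> norm (E q (r j) z) * exp (C / M (r j)) < norm (E l (r j) z)"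
        by (metis (mono_tags, lifting) eventually_happens trivial_limit_sequentially)
      obtain q where q: "q \<in> J" "Re (\<phi> (r j) l z) \<le> Re (\<phi> (r j) q z) + C"
        using bal[of "r j"] z l J unfolding balanced_def by blast
      have "norm (E l (r j) z) \<le> norm (E q (r j) z) * exp (C / M (r j))"
        unfolding norm_E exp_add[symmetric] exp_le_cancel_iff
        using q(2) Mpos[of "r j"] by (simp add: field_simps)
      then show False using j[OF q(1)] by simp
    qed
  next
    fix z :: complex assume z: "z \<in> ball 0 1"
    have "(\<lambda>j. E k (r j) z) \<longlonglongrightarrow> 1" by (simp add: E_def)
    then show "G k z = 1" using lim[OF k z] LIMSEQ_unique by blast
  qed (use k i z in auto)
  have "uniform_limit (cball 0 (1/2)) (\<lambda>j. E l (r j)) (G l) sequentially"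
    by (rule G[OF l]) auto
  moreover have "exp \<epsilon> - 1 > 0" using \<epsilon> by simp
  ultimately obtain j where j: "\<And>z. z \<in> cball 0 (1/2) \<Longrightarrow> dist (E l (r j) z) (G l z) < exp \<epsilon> - 1"
    using uniform_limitD[THEN eventually_happens] by (metis trivial_limit_sequentially)
  obtain z where z: "z \<in> ball 0 (1/2)" "Re (\<phi> (r j) l z) > Re (\<phi> (r j) k z) + \<epsilon> * M (r j)"
    using ex by blast
  have "exp \<epsilon> \<le> norm (E l (r j) z)"
    unfolding norm_E using z(2) Mpos[of "r j"] by (simp add: field_simps)
  moreover have "norm (E l (r j) z) \<le> norm (G l z) + dist (E l (r j) z) (G l z)"
    by (metis add.commute dist_norm norm_triangle_sub)
  moreover have "norm (G l z) \<le> 1" using G_le[OF l, of z] z(1) by auto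
  moreover have "dist (E l (r j) z) (G l z) < exp \<epsilon> - 1" by (rule j) (use z(1) in auto)
  ultimately show False by linarith
qed

text \<open>
  A holomorphic function with values in a half-plane becomes, after a Moebius transformation that takes
  its central value to \<open>0\<close>, a self-map of the disc; the bound is the Schwarz lemma at radius \<open>1/2\<close>.
\<close>

lemma Harnack_upper_half_ball:
  assumes f: "f holomorphic_on ball a r" and pos: "\<And>z. z \<in> ball a r \<Longrightarrow> 0 \<le> Re (f z)"
    and z: "z \<in> ball a (r/2)"
  shows "Re (f z) \<le> 3 * Re (f a)"
proof -
  have r: "0 < r" using z by (metis ball_eq_empty emptyE half_gt_zero_iff not_le)
  have "Re (f z) \<le> 3 * Re (f a) + e" if e: "0 < e" for e
  proof -
    \<comment> \<open>Adding \<open>\<delta>\<close> makes the real part positive, so that the transformation has no pole.\<close>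
    define \<delta> where "\<delta> = e / 2"
    have \<delta>: "0 < \<delta>" using e by (simp add: \<delta>_def)
    define p where "p w = f (a + of_real r * w) + of_real \<delta>" for w
    have inb: "a + of_real r * w \<in> ball a r" if "norm w < 1" for w
      using that r by (simp add: dist_norm norm_mult)
    have Rep: "\<delta> \<le> Re (p w)" if "norm w < 1" for w
      using pos[OF inb[OF that]] unfolding p_def by simp
    have holp: "p holomorphic_on ball 0 1"
      unfolding p_def using f inb
      by (auto intro!: holomorphic_intros holomorphic_on_compose_gen[of "\<lambda>w. a + of_real r * w" _ f "ball a r", unfolded o_def])
    define c where "c = p 0"
    have c: "0 < Re c" using Rep[of 0] \<delta> by (simp add: c_def)
    have less: "norm (p w - c) < norm (p w + cnj c)" if "norm w < 1" for w
    proof -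
      have "0 < Re (p w) * Re c" using c Rep[OF that] \<delta> by simp
      then have "(norm (p w - c))\<^sup>2 < (norm (p w + cnj c))\<^sup>2"
        unfolding cmod_power2 by (simp add: power2_eq_square algebra_simps)
      then show ?thesis by (rule power2_less_imp_less) simp
    qed
    have nz: "p w + cnj c \<noteq> 0" if "norm w < 1" for w using less[OF that] by auto
    define g where "g w = (p w - c) / (p w + cnj c)" for w
    have holg: "g holomorphic_on ball 0 1"
      unfolding g_def by (intro holomorphic_intros holp) (use nz in auto)
    have g1: "norm (g w) < 1" if "norm w < 1" for w
      using less[OF that] nz[OF that] unfolding g_def norm_divide by (subst divide_less_eq_1_pos) auto
    define w where "w = (z - a) / of_real r"
    have w: "norm w < 1/2" using z r by (simp add: w_def norm_divide dist_norm norm_minus_commute field_simps)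
    have zw: "a + of_real r * w = z" using r by (simp add: w_def)
    have "norm (g w) \<le> norm w"
      by (rule Schwarz_Lemma(1)[OF holg _ g1]) (use w in \<open>auto simp: g_def c_def\<close>)
    then have "norm (p w - c) \<le> norm w * norm (p w + cnj c)"
      using w nz[of w] unfolding g_def norm_divide by (simp add: field_simps)
    also have "\<dots> \<le> 1/2 * norm (p w + cnj c)" using w by (intro mult_right_mono) auto
    finally have "norm (p w - c) \<le> norm (p w + cnj c) / 2" by simp
    then have "(norm (p w - c))\<^sup>2 \<le> (norm (p w + cnj c) / 2)\<^sup>2" by (rule power_mono) simp
    then have "4 * ((Re (p w) - Re c)\<^sup>2 + (Im (p w) - Im c)\<^sup>2) \<le> (Re (p w) + Re c)\<^sup>2 + (Im (p w) - Im c)\<^sup>2"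
      unfolding power_divide cmod_power2 by simp
    moreover have "4 * (x + t) \<le> y + t \<Longrightarrow> 0 \<le> t \<Longrightarrow> 4 * x \<le> y" for x y t :: real by simp
    moreover have "(2 * x)\<^sup>2 = 4 * x\<^sup>2" for x :: real by (simp add: power_mult_distrib)
    ultimately have "(2 * (Re (p w) - Re c))\<^sup>2 \<le> (Re (p w) + Re c)\<^sup>2"
      using zero_le_power2 by metis
    then have "2 * (Re (p w) - Re c) \<le> Re (p w) + Re c"
      by (rule power2_le_imp_le) (use Rep[of w] w c \<delta> in auto)
    then have "Re (p w) \<le> 3 * Re c" by simp
    then show ?thesis unfolding p_def c_def zw \<delta>_def by simp
  qed
  then show ?thesis by (rule field_le_epsilon)
qed

lemma balanced_subset: "balanced I n C U \<phi> \<Longrightarrow> V \<subseteq> U \<Longrightarrow> balanced I n C V \<phi>"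
  unfolding balanced_def by (meson holomorphic_on_subset subsetD)

lemma balanced_affine:
  assumes "balanced I n C (ball a r) \<phi>" and s: "0 < s" "s \<le> r"
  shows "balanced I n C (ball 0 1) (\<lambda>i w. \<phi> i (a + of_real s * w))"
proof -
  have inb: "a + of_real s * w \<in> ball a r" if "w \<in> ball 0 1" for w :: complex
  proof -
    have "s * norm w < s" using that s by simp
    then have "s * norm w < r" using s by linarith
    then show ?thesis using s by (simp add: dist_norm norm_mult)
  qed
  have hol: "(\<lambda>w. \<phi> i (a + of_real s * w)) holomorphic_on ball 0 1" if "i \<in> I" for i
    using inb assms(1) that unfolding balanced_def
    by (auto intro!: holomorphic_intros holomorphic_on_compose_gen[of "\<lambda>w. a + of_real s * w" _ "\<phi> i" "ball a r", unfolded o_def])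
  show ?thesis
    unfolding balanced_def
  proof (intro conjI ballI allI impI)
    fix z l J assume "z \<in> ball (0::complex) 1" "l \<in> I" "J \<subseteq> I" "card J = Suc n"
    then show "\<exists>k\<in>J. Re (\<phi> l (a + of_real s * z)) \<le> Re (\<phi> k (a + of_real s * z)) + C"
      using assms(1) inb unfolding balanced_def by blast
  qed (rule hol)
qed

lemma dominant_affine:
  assumes "dominant I C \<phi> U k" and "\<And>w. w \<in> V \<Longrightarrow> a + of_real s * w \<in> U"
  shows "dominant I C (\<lambda>i w. \<phi> i (a + of_real s * w)) V k"
  using assms unfolding dominant_def by blast

lemma exists_dominant:
  assumes "finite I" "I \<noteq> {}" "0 \<le> C"
  obtains k where "dominant I C \<phi> {a} k"
proof -
  have "Max ((\<lambda>i. Re (\<phi> i a)) ` I) \<in> (\<lambda>i. Re (\<phi> i a)) ` I"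
    using assms by (intro Max_in) auto
  then obtain q where q: "q \<in> I" "Max ((\<lambda>i. Re (\<phi> i a)) ` I) = Re (\<phi> q a)" by auto
  have "Re (\<phi> l a) \<le> Re (\<phi> q a) + C" if "l \<in> I" for l
    using Max_ge[of "(\<lambda>i. Re (\<phi> i a)) ` I" "Re (\<phi> l a)"] that q assms by auto
  then show ?thesis using that[of q] q unfolding dominant_def by blast
qed

text \<open>
  By translation and scaling the constant for the unit disc serves for every disc, and there are only
  finitely many pairs of indices.
\<close>

lemma gap_decay:
  fixes I :: "'i set"
  assumes I: "finite I" "card I = 2 * n + 1" and \<epsilon>: "0 < \<epsilon>"
  obtains K where "\<And>\<phi> k M a r. balanced I n C (ball a r) \<phi> \<Longrightarrow> 0 < r \<Longrightarrow> dominant I C \<phi> {a} k \<Longrightarrow> K \<le> M \<Longrightarrow>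
      dominant I M \<phi> (ball a r) k \<Longrightarrow> dominant I (\<epsilon> * M) \<phi> (ball a (r/2)) k"
proof -
  let ?P = "\<lambda>k l K. \<forall>\<phi> M. balanced I n C (ball 0 1) \<phi> \<longrightarrow> dominant I C \<phi> {0} k \<longrightarrow> K \<le> M \<longrightarrow>
      dominant I M \<phi> (ball 0 1) k \<longrightarrow> (\<forall>z\<in>ball 0 (1/2). Re (\<phi> l z) \<le> Re (\<phi> k z) + \<epsilon> * M)"
  have "\<forall>k\<in>I. \<forall>l\<in>I. \<exists>K. ?P k l K" using unit_disc_gap_decay_fixed[OF I \<epsilon>] by blast
  then obtain K' where K': "\<And>k l. k \<in> I \<Longrightarrow> l \<in> I \<Longrightarrow> ?P k l (K' k l)" by metis
  define K where "K = Max ((\<lambda>(k, l). K' k l) ` (I \<times> I))"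
  have KK: "K' k l \<le> K" if "k \<in> I" "l \<in> I" for k l
    unfolding K_def using I that by (intro Max_ge) auto
  show ?thesis
  proof (rule that[of K])
    fix \<phi> :: "'i \<Rightarrow> complex \<Rightarrow> complex" and k M a r
    assume bal: "balanced I n C (ball a r) \<phi>" and r: "0 < r" and dom: "dominant I C \<phi> {a} k"
      and M: "K \<le> M" and domM: "dominant I M \<phi> (ball a r) k"
    have k: "k \<in> I" using dom unfolding dominant_def by blast
    define \<psi> where "\<psi> i w = \<phi> i (a + of_real r * w)" for i w
    have b: "balanced I n C (ball 0 1) \<psi>"
      unfolding \<psi>_def by (rule balanced_affine[OF bal r]) simp
    have d: "dominant I C \<psi> {0} k" "dominant I M \<psi> (ball 0 1) k"
      unfolding \<psi>_def using r
      by (auto intro!: dominant_affine[OF dom] dominant_affine[OF domM] simp: dist_norm norm_mult)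
    show "dominant I (\<epsilon> * M) \<phi> (ball a (r/2)) k"
      unfolding dominant_def
    proof (intro conjI ballI k)
      fix l z assume l: "l \<in> I" and z: "z \<in> ball a (r/2)"
      define w where "w = (z - a) / of_real r"
      have w: "w \<in> ball 0 (1/2)" using z r by (simp add: w_def norm_divide dist_norm norm_minus_commute field_simps)
      have zw: "a + of_real r * w = z" using r by (simp add: w_def)
      have "K' k l \<le> M" using KK[OF k l] M by linarith
      with K'[OF k l] b d w have "Re (\<psi> l w) \<le> Re (\<psi> k w) + \<epsilon> * M" by blast
      then show "Re (\<phi> l z) \<le> Re (\<phi> k z) + \<epsilon> * M" unfolding \<psi>_def zw .
    qed
  qed
qed

text \<open>
  Walking from \<open>a\<close> to \<open>z\<close> in eight steps, one changes at each step to an index \<open>q\<close> that is dominant at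
  the current point. Harnack's inequality for the positive harmonic function
  \<open>\<tau> + Re (\<phi> q) - Re (\<phi> k)\<close> shows that a step costs only a constant factor. That the final bound is
  linear in \<open>\<tau>\<close> is essential for its use below.
\<close>

lemma gap_chain:
  fixes I :: "'i set" and a :: complex
  assumes I: "finite I" and C: "0 \<le> C" "C \<le> \<tau>"
    and hol: "\<And>i. i \<in> I \<Longrightarrow> \<phi> i holomorphic_on U"
    and sub: "\<And>b. b \<in> ball a \<rho> \<Longrightarrow> ball b (\<rho>/4) \<subseteq> U"
    and loc: "\<And>b q. b \<in> ball a \<rho> \<Longrightarrow> dominant I C \<phi> {b} q \<Longrightarrow> dominant I \<tau> \<phi> (ball b (\<rho>/4)) q"
    and k: "dominant I C \<phi> {a} k"
  shows "dominant I (6 ^ 8 * \<tau>) \<phi> (ball a \<rho>) k"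
  unfolding dominant_def
proof (intro conjI ballI)
  show kI: "k \<in> I" using k unfolding dominant_def by blast
  fix l z assume l: "l \<in> I" and z: "z \<in> ball a \<rho>"
  define b where "b i = a + of_real (real i / 8) * (z - a)" for i
  have za: "norm (z - a) < \<rho>" using z by (simp add: dist_norm norm_minus_commute)
  have binb: "b i \<in> ball a \<rho>" if "i \<le> 8" for i
  proof -
    have "norm (b i - a) = real i / 8 * norm (z - a)" unfolding b_def by (simp add: norm_mult)
    also have "\<dots> \<le> 1 * norm (z - a)" using that by (intro mult_right_mono) auto
    finally show ?thesis using za by (simp add: dist_norm norm_minus_commute)
  qed
  have bstep: "b (Suc i) \<in> ball (b i) (\<rho>/4/2)" for i
  proof -
    have "b (Suc i) - b i = of_real (1/8) * (z - a)" unfolding b_def by (simp add: algebra_simps add_divide_distrib)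
    then have "norm (b (Suc i) - b i) = 1/8 * norm (z - a)" by (simp only: norm_mult norm_of_real)
    then show ?thesis using za by (simp add: dist_norm norm_minus_commute)
  qed
  have \<tau>: "0 \<le> \<tau>" using C by linarith
  have "\<forall>l\<in>I. Re (\<phi> l (b i)) \<le> Re (\<phi> k (b i)) + 6 ^ i * \<tau>" if "i \<le> 8" for i
    using that
  proof (induction i)
    case 0
    then show ?case using k C unfolding dominant_def b_def by force
  next
    case (Suc i)
    obtain q where q: "dominant I C \<phi> {b i} q" using exists_dominant[OF I _ C(1)] kI by blast
    then have qI: "q \<in> I" unfolding dominant_def by blast
    have bi: "b i \<in> ball a \<rho>" by (rule binb) (use Suc in simp)
    have "Re (of_real \<tau> + \<phi> q (b (Suc i)) - \<phi> k (b (Suc i))) \<le> 3 * Re (of_real \<tau> + \<phi> q (b i) - \<phi> k (b i))"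
    proof (rule Harnack_upper_half_ball[OF _ _ bstep])
      show "(\<lambda>z. of_real \<tau> + \<phi> q z - \<phi> k z) holomorphic_on ball (b i) (\<rho>/4)"
        by (intro holomorphic_intros holomorphic_on_subset[OF hol sub[OF bi]] qI kI)
      fix z assume "z \<in> ball (b i) (\<rho>/4)"
      then show "0 \<le> Re (of_real \<tau> + \<phi> q z - \<phi> k z)" using dominantD[OF loc[OF bi q] kI] by fastforce
    qed
    moreover have "Re (\<phi> q (b i)) \<le> Re (\<phi> k (b i)) + 6 ^ i * \<tau>" using Suc qI by simp
    ultimately have qk: "Re (\<phi> q (b (Suc i))) - Re (\<phi> k (b (Suc i))) \<le> 2 * \<tau> + 3 * (6 ^ i * \<tau>)" by simp
    have bstep': "b (Suc i) \<in> ball (b i) (\<rho>/4)"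
      using bstep[of i] zero_le_dist[of "b i" "b (Suc i)"] unfolding mem_ball by linarith
    show ?case
    proof
      fix l assume l: "l \<in> I"
      have "Re (\<phi> l (b (Suc i))) \<le> Re (\<phi> q (b (Suc i))) + \<tau>"
        by (rule dominantD[OF loc[OF bi q] l bstep'])
      moreover have "3 * \<tau> \<le> 3 * (6 ^ i * \<tau>)" using \<tau> by (simp add: mult_le_cancel_right1)
      ultimately show "Re (\<phi> l (b (Suc i))) \<le> Re (\<phi> k (b (Suc i))) + 6 ^ Suc i * \<tau>" using qk by simp
    qed
  qed
  from this[of 8] have "Re (\<phi> l (b 8)) \<le> Re (\<phi> k (b 8)) + 6 ^ 8 * \<tau>" using l by blast
  moreover have "b 8 = z" unfolding b_def by simp
  ultimately show "Re (\<phi> l z) \<le> Re (\<phi> k z) + 6 ^ 8 * \<tau>" by simp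
qed

text \<open>
  Let \<open>A\<close> be the supremum of the gaps measured from an arbitrary centre \<open>a\<close> on the disc of half the
  distance from \<open>a\<close> to the unit circle; it is finite because of the bound \<open>B\<close>. If \<open>\<rho>\<close> is the radius of
  such a disc and \<open>b\<close> one of its points, the disc of radius \<open>\<rho>/2\<close> around \<open>b\<close> has gap at most \<open>A\<close>, hence
  that of radius \<open>\<rho>/4\<close> has gap at most \<open>\<epsilon> * A\<close> by decay. Chaining gives \<open>A \<le> c * (C + \<epsilon> * A)\<close>, up to
  the threshold of the decay, and with \<open>\<epsilon> = 1 / (2 * c)\<close> this bounds \<open>A\<close> independently of \<open>B\<close>.
\<close>

lemma gap_bound_aux:
  fixes I :: "'i set"
  assumes I: "finite I" "card I = 2 * n + 1" and C: "0 \<le> C"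
  obtains K where "\<And>\<phi> k B. balanced I n C (ball 0 1) \<phi> \<Longrightarrow>
      (\<And>i z. i \<in> I \<Longrightarrow> z \<in> ball 0 1 \<Longrightarrow> \<bar>Re (\<phi> i z)\<bar> \<le> B) \<Longrightarrow> dominant I C \<phi> {0} k \<Longrightarrow>
      dominant I K \<phi> (ball 0 (1/2)) k"
proof -
  \<comment> \<open>The factor lost by chaining, and a decay rate that absorbs it.\<close>
  define c :: real where "c = 6 ^ 8"
  have c: "0 < c" by (simp add: c_def)
  define \<epsilon> where "\<epsilon> = 1 / (2 * c)"
  have \<epsilon>: "0 < \<epsilon>" using c by (simp add: \<epsilon>_def)
  obtain K0 where K0: "\<And>\<phi> k M a r. balanced I n C (ball a r) \<phi> \<Longrightarrow> 0 < r \<Longrightarrow> dominant I C \<phi> {a} k \<Longrightarrow> K0 \<le> M \<Longrightarrow>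
      dominant I M \<phi> (ball a r) k \<Longrightarrow> dominant I (\<epsilon> * M) \<phi> (ball a (r/2)) k"
    using gap_decay[OF I \<epsilon>] by blast
  show ?thesis
  proof (rule that[of "2 * c * C + \<bar>K0\<bar>"])
    fix \<phi> :: "'i \<Rightarrow> complex \<Rightarrow> complex" and k B
    assume bal: "balanced I n C (ball 0 1) \<phi>" and B: "\<And>i z. i \<in> I \<Longrightarrow> z \<in> ball 0 1 \<Longrightarrow> \<bar>Re (\<phi> i z)\<bar> \<le> B"
      and k: "dominant I C \<phi> {0} k"
    define X where "X = {x. \<exists>a k l z. x = Re (\<phi> l z) - Re (\<phi> k z) \<and> norm a < 1 \<and> dominant I C \<phi> {a} k \<and> l \<in> I \<and>
        z \<in> ball a ((1 - norm a) / 2)}"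
    have in1: "z \<in> ball 0 1" if "norm a < 1" "z \<in> ball a ((1 - norm a) / 2)" for a z :: complex
    proof -
      have "norm z \<le> norm a + norm (z - a)" by (rule norm_triangle_sub)
      then show ?thesis using that by (simp add: dist_norm norm_minus_commute)
    qed
    have bdd: "bdd_above X"
    proof (rule bdd_aboveI[of _ "2 * B"])
      fix x assume "x \<in> X"
      then obtain a k l z where x: "x = Re (\<phi> l z) - Re (\<phi> k z)" "norm a < 1" "dominant I C \<phi> {a} k" "l \<in> I"
        "z \<in> ball a ((1 - norm a) / 2)" unfolding X_def by blast
      then have "\<bar>Re (\<phi> l z)\<bar> \<le> B" "\<bar>Re (\<phi> k z)\<bar> \<le> B" using B in1 unfolding dominant_def by blast+
      then show "x \<le> 2 * B" using x by linarith
    qed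
    define A where "A = Sup X"
    have XA: "x \<le> A" if "x \<in> X" for x unfolding A_def using that bdd by (rule cSup_upper)
    have X0: "0 \<in> X" unfolding X_def using k
      by (auto intro!: exI[of _ 0] exI[of _ k] simp: dominant_def)
    \<comment> \<open>The decay is available only for gaps of at least \<open>K0\<close>.\<close>
    define M where "M = max A K0"
    have M0: "0 \<le> M" using XA[OF X0] by (simp add: M_def)
    define \<tau> where "\<tau> = C + \<epsilon> * M"
    have \<tau>: "C \<le> \<tau>" "\<epsilon> * M \<le> \<tau>" using C \<epsilon> M0 by (auto simp: \<tau>_def)
    have "A \<le> c * \<tau>"
      unfolding A_def
    proof (rule cSup_least)
      fix x assume "x \<in> X"
      then obtain a k l z where x: "x = Re (\<phi> l z) - Re (\<phi> k z)" and a: "norm a < 1" and k: "dominant I C \<phi> {a} k"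
        and l: "l \<in> I" and z: "z \<in> ball a ((1 - norm a) / 2)" unfolding X_def by blast
      define \<rho> where "\<rho> = (1 - norm a) / 2"
      have \<rho>: "0 < \<rho>" "norm a + 2 * \<rho> = 1" using a by (auto simp: \<rho>_def field_simps)
      have nb: "norm b < norm a + \<rho>" if "b \<in> ball a \<rho>" for b
        using that norm_triangle_sub[of b a] by (simp add: dist_norm norm_minus_commute)
      have bb: "ball b (\<rho>/2) \<subseteq> ball b ((1 - norm b) / 2)" if "b \<in> ball a \<rho>" for b
        using nb[OF that] \<rho> by (intro subset_ball) simp
      have sub: "ball b (\<rho>/2) \<subseteq> ball 0 1" if "b \<in> ball a \<rho>" for b
      proof
        fix z assume "z \<in> ball b (\<rho>/2)"
        then have "z \<in> ball b ((1 - norm b) / 2)" using bb[OF that] by blast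
        then show "z \<in> ball 0 1" using in1[of b z] nb[OF that] \<rho> by simp
      qed
      have "dominant I (6 ^ 8 * \<tau>) \<phi> (ball a \<rho>) k"
      proof (rule gap_chain[OF I(1) C \<tau>(1) _ _ _ k])
        show "\<phi> i holomorphic_on ball 0 1" if "i \<in> I" for i using bal that unfolding balanced_def by blast
        show "ball b (\<rho>/4) \<subseteq> ball 0 1" if "b \<in> ball a \<rho>" for b
          using sub[OF that] subset_ball[of "\<rho>/4" "\<rho>/2" b] \<rho> by auto
        fix b q assume b: "b \<in> ball a \<rho>" and q: "dominant I C \<phi> {b} q"
        have "dominant I M \<phi> (ball b (\<rho>/2)) q"
          unfolding dominant_def
        proof (intro conjI ballI)
          show "q \<in> I" using q unfolding dominant_def by blast
          fix i z assume "i \<in> I" "z \<in> ball b (\<rho>/2)"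
          then have "Re (\<phi> i z) - Re (\<phi> q z) \<in> X"
            unfolding X_def using q bb[OF b] nb[OF b] \<rho> by fastforce
          then show "Re (\<phi> i z) \<le> Re (\<phi> q z) + M" using XA unfolding M_def by fastforce
        qed
        then have "dominant I (\<epsilon> * M) \<phi> (ball b (\<rho>/2/2)) q"
          by (intro K0[OF balanced_subset[OF bal sub[OF b]] _ q]) (use \<rho> in \<open>auto simp: M_def\<close>)
        then show "dominant I \<tau> \<phi> (ball b (\<rho>/4)) q" by (rule dominant_mono[OF _ \<tau>(2)]) simp
      qed
      then show "x \<le> c * \<tau>" using dominantD[OF _ l, of "6 ^ 8 * \<tau>" \<phi> "ball a \<rho>" k z] x z by (simp add: c_def \<rho>_def)
    qed (use X0 in auto)
    also have "c * \<tau> = c * C + M / 2" using c by (simp add: \<tau>_def \<epsilon>_def field_simps)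
    finally have "A \<le> 2 * c * C + \<bar>K0\<bar>"
      using XA[OF X0] C c mult_nonneg_nonneg[of c C] unfolding M_def by linarith
    moreover have "Re (\<phi> l z) - Re (\<phi> k z) \<in> X" if "l \<in> I" "z \<in> ball 0 (1/2)" for l z
      unfolding X_def mem_Collect_eq
      by (rule exI[of _ 0], rule exI[of _ k], rule exI[of _ l], rule exI[of _ z]) (use k that in auto)
    ultimately show "dominant I (2 * c * C + \<bar>K0\<bar>) \<phi> (ball 0 (1/2)) k"
      using XA k unfolding dominant_def by fastforce
  qed
qed

text \<open>
  This is the normality theorem for \<open>2 * n + 1\<close> zero-free functions. On the disc of radius \<open>r/2\<close>, whose
  closure is compact, the functions are bounded, so \<open>gap_bound_aux\<close> applies there.
\<close>

lemma gap_bound: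
  fixes I :: "'i set"
  assumes I: "finite I" "card I = 2 * n + 1" and C: "0 \<le> C"
  obtains K where "\<And>\<phi> k a r. balanced I n C (ball a r) \<phi> \<Longrightarrow> 0 < r \<Longrightarrow> dominant I C \<phi> {a} k \<Longrightarrow>
      dominant I K \<phi> (ball a (r/4)) k"
proof -
  obtain K where K: "\<And>\<phi> k B. balanced I n C (ball 0 1) \<phi> \<Longrightarrow>
      (\<And>i z. i \<in> I \<Longrightarrow> z \<in> ball 0 1 \<Longrightarrow> \<bar>Re (\<phi> i z)\<bar> \<le> B) \<Longrightarrow> dominant I C \<phi> {0} k \<Longrightarrow>
      dominant I K \<phi> (ball 0 (1/2)) k"
    using gap_bound_aux[OF I C] by blast
  show ?thesis
  proof (rule that[of K])
    fix \<phi> :: "'i \<Rightarrow> complex \<Rightarrow> complex" and k a r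
    assume bal: "balanced I n C (ball a r) \<phi>" and r: "0 < r" and dom: "dominant I C \<phi> {a} k"
    define \<psi> where "\<psi> i w = \<phi> i (a + of_real (r/2) * w)" for i w
    have b: "balanced I n C (ball 0 1) \<psi>"
      unfolding \<psi>_def by (rule balanced_affine[OF bal]) (use r in auto)
    have d: "dominant I C \<psi> {0} k" unfolding \<psi>_def by (rule dominant_affine[OF dom]) simp
    have "bounded (Re ` \<phi> i ` cball a (r/2))" if "i \<in> I" for i
    proof -
      have "cball a (r/2) \<subseteq> ball a r" using r by auto
      then have "continuous_on (cball a (r/2)) (\<phi> i)"
        using bal that unfolding balanced_def
        by (meson continuous_on_subset holomorphic_on_imp_continuous_on)
      then show ?thesis
        unfolding image_image by (intro compact_imp_bounded compact_continuous_image continuous_intros) auto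
    qed
    then have "bounded (\<Union>i\<in>I. Re ` \<phi> i ` cball a (r/2))" using I by blast
    then obtain B where "\<forall>x\<in>(\<Union>i\<in>I. Re ` \<phi> i ` cball a (r/2)). \<bar>x\<bar> \<le> B" unfolding bounded_real by blast
    then have B: "\<bar>Re (\<phi> i x)\<bar> \<le> B" if "i \<in> I" "x \<in> cball a (r/2)" for i x using that by blast
    have *: "dominant I K \<psi> (ball 0 (1/2)) k"
    proof (rule K[OF b _ d])
      fix i and x :: complex assume i: "i \<in> I" and x: "x \<in> ball 0 1"
      have "norm (of_real (r/2) * x) \<le> r/2" using x r by (simp add: norm_mult field_simps)
      then show "\<bar>Re (\<psi> i x)\<bar> \<le> B" unfolding \<psi>_def by (intro B i) (simp add: dist_norm)
    qed
    show "dominant I K \<phi> (ball a (r/4)) k"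
      unfolding dominant_def
    proof (intro conjI ballI)
      show "k \<in> I" using dom unfolding dominant_def by blast
      fix l z assume l: "l \<in> I" and z: "z \<in> ball a (r/4)"
      define w where "w = (z - a) / of_real (r/2)"
      have w: "w \<in> ball 0 (1/2)"
        unfolding w_def mem_ball dist_norm norm_divide diff_0 norm_minus_cancel
        using z r by (simp add: dist_norm norm_minus_commute)
      have zw: "a + of_real (r/2) * w = z" using r by (simp add: w_def field_simps)
      show "Re (\<phi> l z) \<le> Re (\<phi> k z) + K" using dominantD[OF * l w] unfolding \<psi>_def zw .
    qed
  qed
qed

section \<open>Holomorphic functions of several variables\<close>

lemma linear_smult_left: "linear (\<lambda>t::complex. t *s (b :: complex^'m))"
  by (rule linearI) (simp_all add: vec_eq_iff algebra_simps)

lemma holo_on_subset: "holo_on h U \<Longrightarrow> V \<subseteq> U \<Longrightarrow> holo_on h V"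
  unfolding holo_on_def by blast

lemma holo_on_cong_open:
  assumes "holo_on f U" "open U" "\<And>z. z \<in> U \<Longrightarrow> f z = g z"
  shows "holo_on g U"
  unfolding holo_on_def
proof
  fix z assume z: "z \<in> U"
  then obtain h' where h': "(f has_derivative h') (at z)" "\<forall>c v. h' (c *s v) = c * h' v"
    using assms(1) unfolding holo_on_def by blast
  have "(g has_derivative h') (at z)"
    by (rule has_derivative_transform_within_open[OF h'(1) assms(2) z assms(3)])
  then show "\<exists>h'. (g has_derivative h') (at z) \<and> (\<forall>c v. h' (c *s v) = c * h' v)" using h' by blast
qed

lemma holo_on_const: "holo_on (\<lambda>z. c) U"
  unfolding holo_on_def by (auto intro!: exI[of _ "\<lambda>_. 0"])

lemma holo_on_add:
  assumes "holo_on f U" "holo_on g U"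
  shows "holo_on (\<lambda>z. f z + g z) U"
  unfolding holo_on_def
proof
  fix z assume "z \<in> U"
  then obtain f' g' where "(f has_derivative f') (at z)" "\<forall>c v. f' (c *s v) = c * f' v"
    "(g has_derivative g') (at z)" "\<forall>c v. g' (c *s v) = c * g' v"
    using assms unfolding holo_on_def by meson
  then show "\<exists>h'. ((\<lambda>z. f z + g z) has_derivative h') (at z) \<and> (\<forall>c v. h' (c *s v) = c * h' v)"
    by (intro exI[of _ "\<lambda>v. f' v + g' v"]) (auto intro!: derivative_intros simp: algebra_simps)
qed

lemma holo_on_mult:
  assumes "holo_on f U" "holo_on g U"
  shows "holo_on (\<lambda>z. f z * g z) U"
  unfolding holo_on_def
proof
  fix z assume "z \<in> U"
  then obtain f' g' where "(f has_derivative f') (at z)" "\<forall>c v. f' (c *s v) = c * f' v"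
    "(g has_derivative g') (at z)" "\<forall>c v. g' (c *s v) = c * g' v"
    using assms unfolding holo_on_def by meson
  then show "\<exists>h'. ((\<lambda>z. f z * g z) has_derivative h') (at z) \<and> (\<forall>c v. h' (c *s v) = c * h' v)"
    by (intro exI[of _ "\<lambda>v. f z * g' v + f' v * g z"]) (auto intro!: derivative_intros simp: algebra_simps)
qed

lemma holo_on_inverse:
  assumes "holo_on f U" "\<And>z. z \<in> U \<Longrightarrow> f z \<noteq> 0"
  shows "holo_on (\<lambda>z. inverse (f z)) U"
  unfolding holo_on_def
proof
  fix z assume "z \<in> U"
  moreover then obtain f' where "(f has_derivative f') (at z)" "\<forall>c v. f' (c *s v) = c * f' v"
    using assms unfolding holo_on_def by meson
  ultimately show "\<exists>h'. ((\<lambda>z. inverse (f z)) has_derivative h') (at z) \<and> (\<forall>c v. h' (c *s v) = c * h' v)"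
    using Deriv.has_derivative_inverse[of f z f' UNIV] assms(2)
    by (intro exI[of _ "\<lambda>v. - (inverse (f z) * f' v * inverse (f z))"]) (simp add: algebra_simps)
qed

lemma holo_on_sum:
  assumes "finite A" "\<And>i. i \<in> A \<Longrightarrow> holo_on (f i) U"
  shows "holo_on (\<lambda>z. \<Sum>i\<in>A. f i z) U"
  using assms by (induction A rule: finite_induct) (auto intro: holo_on_const holo_on_add)

lemma holo_on_compose_affine:
  assumes h: "holo_on h U" and L: "linear L" "\<And>c v. L (c *s v) = c *s L v"
    and sub: "\<And>z. z \<in> V \<Longrightarrow> p + L z \<in> U"
  shows "holo_on (\<lambda>z. h (p + L z)) V"
  unfolding holo_on_def
proof
  fix z assume "z \<in> V"
  then obtain h' where h': "(h has_derivative h') (at (p + L z))" "\<forall>c v. h' (c *s v) = c * h' v"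
    using h sub unfolding holo_on_def by blast
  have "((\<lambda>z. p + L z) has_derivative L) (at z)"
    using linear_imp_has_derivative[OF L(1)] by (auto intro!: derivative_eq_intros)
  then have "((\<lambda>z. h (p + L z)) has_derivative (\<lambda>v. h' (L v))) (at z)"
    by (rule has_derivative_compose[of "\<lambda>z. p + L z" L z UNIV h h', OF _ h'(1)])
  then show "\<exists>h'. ((\<lambda>z. h (p + L z)) has_derivative h') (at z) \<and> (\<forall>c v. h' (c *s v) = c * h' v)"
    using h'(2) L(2) by (intro exI[of _ "\<lambda>v. h' (L v)"]) auto
qed

lemma holo_on_imp_continuous_on: "holo_on h U \<Longrightarrow> continuous_on U h"
  unfolding holo_on_def
  by (meson continuous_at_imp_continuous_on has_derivative_continuous)

text \<open>
  Complex linearity of the derivative makes the restriction to a complex line holomorphic; in this way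
  the facts from one variable carry over to several.
\<close>

lemma line_has_field_derivative:
  fixes h :: "complex^'m \<Rightarrow> complex"
  assumes "(h has_derivative h') (at (a + t *s b))" "\<forall>c v. h' (c *s v) = c * h' v"
  shows "((\<lambda>t. h (a + t *s b)) has_field_derivative h' b) (at t)"
proof -
  have "((\<lambda>t. a + t *s b) has_derivative (\<lambda>t. t *s b)) (at t)"
    using linear_imp_has_derivative[OF linear_smult_left[of b]] by (auto intro!: derivative_eq_intros)
  then have "((\<lambda>t. h (a + t *s b)) has_derivative (\<lambda>t. h' (t *s b))) (at t)"
    by (rule has_derivative_compose[of "\<lambda>t. a + t *s b" _ t UNIV h h', OF _ assms(1)])
  moreover have "(\<lambda>t. h' (t *s b)) = (*) (h' b)" using assms(2) by (auto simp: mult.commute)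
  ultimately show ?thesis unfolding has_field_derivative_def by simp
qed

lemma holo_on_line:
  assumes "holo_on h U" and "\<And>t. t \<in> T \<Longrightarrow> a + t *s b \<in> U"
  shows "(\<lambda>t. h (a + t *s b)) holomorphic_on T"
  unfolding holomorphic_on_def
proof
  fix t assume "t \<in> T"
  then obtain h' where "(h has_derivative h') (at (a + t *s b))" "\<forall>c v. h' (c *s v) = c * h' v"
    using assms unfolding holo_on_def by blast
  from line_has_field_derivative[OF this] show "(\<lambda>t. h (a + t *s b)) field_differentiable at t within T"
    using field_differentiable_at_within field_differentiable_def by blast
qed

lemma holo_on_center_le_circle:
  assumes h: "holo_on h U" and \<rho>: "0 < \<rho>" and sub: "\<And>t. norm t \<le> \<rho> \<Longrightarrow> a + t *s b \<in> U"
    and le: "\<And>t. norm t = \<rho> \<Longrightarrow> norm (h (a + t *s b)) \<le> B"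
  shows "norm (h a) \<le> B"
proof -
  let ?f = "\<lambda>t. h (a + t *s b)"
  have hol: "?f holomorphic_on cball 0 \<rho>" by (rule holo_on_line[OF h]) (use sub in auto)
  have "norm ((deriv ^^ 0) ?f 0) \<le> fact 0 * B / \<rho> ^ 0"
    by (rule Cauchy_inequality)
       (use \<rho> le hol in \<open>auto intro: holomorphic_on_subset holomorphic_on_imp_continuous_on\<close>)
  then show ?thesis by simp
qed

text \<open>
  Cauchy's estimate on the disc of radius \<open>r / (2 * norm v)\<close> in the complex line through \<open>z\<close> in the
  direction \<open>v\<close>.
\<close>

lemma holo_on_derivative_bound:
  assumes h: "holo_on h (ball z r)" and r: "0 < r" and B: "\<And>w. w \<in> ball z r \<Longrightarrow> norm (h w) \<le> B"
    and h': "(h has_derivative h') (at z)" "\<forall>c v. h' (c *s v) = c * h' v"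
  shows "norm (h' v) \<le> 2 * B / r * norm v"
proof (cases "v = 0")
  case True
  then have "h' v = 0" using h'(2)[rule_format, of 0 v] by simp
  then show ?thesis using True by simp
next
  case False
  \<comment> \<open>Half the radius of the disc on which \<open>t *s v\<close> stays in the ball.\<close>
  define s where "s = r / (2 * norm v)"
  have s: "0 < s" using r False by (simp add: s_def)
  have inb: "z + t *s v \<in> ball z r" if "norm t \<le> s" for t
  proof -
    have "norm t * norm v \<le> s * norm v" using that by (rule mult_right_mono) simp
    also have "\<dots> < r" using False r by (simp add: s_def)
    finally show ?thesis by (simp add: dist_norm norm_vector_smult)
  qed
  let ?f = "\<lambda>t. h (z + t *s v)"
  have hol: "?f holomorphic_on cball 0 s" by (rule holo_on_line[OF h]) (use inb in auto)
  have "norm ((deriv ^^ 1) ?f 0) \<le> fact 1 * B / s ^ 1"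
    by (rule Cauchy_inequality)
       (use s hol B inb in \<open>auto intro: holomorphic_on_subset holomorphic_on_imp_continuous_on\<close>)
  moreover have "deriv ?f 0 = h' v"
    by (rule DERIV_imp_deriv, rule line_has_field_derivative) (use h' in auto)
  ultimately show ?thesis by (simp add: s_def mult_ac)
qed

lemma holo_on_Lipschitz:
  assumes h: "holo_on h (ball a r)" and B: "\<And>w. w \<in> ball a r \<Longrightarrow> norm (h w) \<le> B"
    and x: "x \<in> cball a (r/2)" and y: "y \<in> cball a (r/2)"
  shows "norm (h x - h y) \<le> 4 * B / r * norm (x - y)"
proof (cases "r > 0")
  case True
  have "\<forall>z\<in>ball a r. \<exists>h'. (h has_derivative h') (at z) \<and> (\<forall>c v. h' (c *s v) = c * h' v)"
    using h unfolding holo_on_def .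
  then obtain h' where h': "\<And>z. z \<in> ball a r \<Longrightarrow> (h has_derivative h' z) (at z)"
    "\<And>z. z \<in> ball a r \<Longrightarrow> \<forall>c v. h' z (c *s v) = c * h' z v" by metis
  have cb: "cball a (r/2) \<subseteq> ball a r" using True by auto
  show ?thesis
  proof (rule differentiable_bound[OF convex_cball _ _ x y])
    fix z assume z: "z \<in> cball a (r/2)"
    show "(h has_derivative h' z) (at z within cball a (r/2))"
      using h'(1) z cb has_derivative_at_withinI by blast
    have sub: "ball z (r/2) \<subseteq> ball a r"
    proof
      fix w assume "w \<in> ball z (r/2)"
      then show "w \<in> ball a r" using z dist_triangle[of a w z] by simp
    qed
    show "onorm (h' z) \<le> 4 * B / r"
    proof (rule onorm_bound)
      have "0 \<le> B" using B[of a] True norm_ge_zero[of "h a"] by (metis centre_in_ball order_trans)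
      then show "0 \<le> 4 * B / r" using True by simp
      fix v
      have "norm (h' z v) \<le> 2 * B / (r/2) * norm v"
        by (rule holo_on_derivative_bound[OF holo_on_subset[OF h sub]]) (use True B sub h' z cb in auto)
      then show "norm (h' z v) \<le> 4 * B / r * norm v" by simp
    qed
  qed
next
  case False
  then show ?thesis using x y by (cases "r = 0") auto
qed

text \<open>
  By Cauchy's estimate the derivatives converge uniformly as linear maps near every point, and their
  limits are again linear over the complex numbers.
\<close>

lemma holo_on_uniform_limit:
  fixes f :: "nat \<Rightarrow> complex^'m \<Rightarrow> complex"
  assumes U: "open U" and f: "\<And>n. holo_on (f n) U" and lim: "uniform_limit U f g sequentially"
  shows "holo_on g U"
  unfolding holo_on_def
proof
  fix z assume "z \<in> U"
  then obtain r where r: "r > 0" "ball z r \<subseteq> U" using U open_contains_ball by blast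
  have "\<forall>n. \<forall>z\<in>U. \<exists>h'. (f n has_derivative h') (at z) \<and> (\<forall>c v. h' (c *s v) = c * h' v)"
    using f unfolding holo_on_def by blast
  then obtain f' where f': "\<And>n z. z \<in> U \<Longrightarrow> (f n has_derivative f' n z) (at z)"
    "\<And>n z. z \<in> U \<Longrightarrow> \<forall>c v. f' n z (c *s v) = c * f' n z v" by metis
  define S where "S = ball z (r/2)"
  have subS: "ball x (r/2) \<subseteq> U" if "x \<in> S" for x
  proof
    fix w assume "w \<in> ball x (r/2)"
    then have "w \<in> ball z r" using that dist_triangle[of z w x] unfolding S_def by simp
    then show "w \<in> U" using r by blast
  qed
  have SU: "S \<subseteq> U" unfolding S_def using r subset_ball[of "r/2" r z] by auto
  have diff: "norm (f' n x v - f' m x v) \<le> 4 * e / r * norm v"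
    if x: "x \<in> S" and e: "\<And>w. w \<in> U \<Longrightarrow> norm (f n w - f m w) \<le> e" for n m x v e
  proof -
    have xU: "x \<in> U" using x SU by blast
    have "norm (f' n x v - f' m x v) \<le> 2 * e / (r/2) * norm v"
    proof (rule holo_on_derivative_bound[where h = "\<lambda>w. f n w - f m w"])
      show "holo_on (\<lambda>w. f n w - f m w) (ball x (r/2))"
        using holo_on_add[OF f[of n] holo_on_mult[OF holo_on_const[of "-1"] f[of m]]] subS[OF x]
        by (auto intro: holo_on_subset)
      show "((\<lambda>w. f n w - f m w) has_derivative (\<lambda>v. f' n x v - f' m x v)) (at x)"
        by (intro has_derivative_diff f' xU)
    qed (use r e subS[OF x] f'(2)[OF xU] in \<open>auto simp: algebra_simps\<close>)
    then show ?thesis by simp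
  qed
  have uc: "\<exists>N. \<forall>n\<ge>N. \<forall>m\<ge>N. \<forall>w\<in>U. norm (f n w - f m w) \<le> e" if e: "e > 0" for e
  proof -
    obtain N where N: "\<And>n w. n \<ge> N \<Longrightarrow> w \<in> U \<Longrightarrow> dist (f n w) (g w) < e / 2"
      using uniform_limitD[OF lim half_gt_zero[OF e]] unfolding eventually_sequentially by blast
    have "norm (f n w - f m w) \<le> e" if "n \<ge> N" "m \<ge> N" "w \<in> U" for n m w
      using N[OF that(1,3)] N[OF that(2,3)] dist_triangle2[of "f n w" "f m w" "g w"]
      by (simp add: dist_norm)
    then show ?thesis by blast
  qed
  have uc': "\<exists>N. \<forall>n\<ge>N. \<forall>m\<ge>N. \<forall>x\<in>S. \<forall>v. norm (f' n x v - f' m x v) \<le> e * norm v" if e: "e > 0" for e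
  proof -
    have "0 < e * r / 4" using e r by simp
    from uc[OF this] obtain N where N: "\<forall>n\<ge>N. \<forall>m\<ge>N. \<forall>w\<in>U. norm (f n w - f m w) \<le> e * r / 4" by blast
    have "norm (f' n x v - f' m x v) \<le> e * norm v" if "n \<ge> N" "m \<ge> N" "x \<in> S" for n m x v
      using diff[OF that(3), of n m "e * r / 4" v] N that r by simp
    then show ?thesis by blast
  qed
  have conv: "\<exists>l. (\<lambda>n. f' n x v) \<longlonglongrightarrow> l" if x: "x \<in> S" for x v
    unfolding convergent_eq_Cauchy
  proof (rule metric_CauchyI)
    fix e :: real assume e: "e > 0"
    obtain N where N: "\<forall>n\<ge>N. \<forall>m\<ge>N. \<forall>x\<in>S. \<forall>v'. norm (f' n x v' - f' m x v') \<le> e / (norm v + 1) * norm v'"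
      using uc'[of "e / (norm v + 1)"] e by (auto simp: add_nonneg_pos)
    have "e * norm v / (norm v + 1) < e"
      using e norm_ge_zero[of v] by (simp add: pos_divide_less_eq add_nonneg_pos distrib_left)
    then have "dist (f' m x v) (f' n x v) < e" if "m \<ge> N" "n \<ge> N" for m n
      using N[rule_format, OF that x, of v] by (simp add: dist_norm)
    then show "\<exists>M. \<forall>m\<ge>M. \<forall>n\<ge>M. dist (f' m x v) (f' n x v) < e" by blast
  qed
  define g' where "g' x v = lim (\<lambda>n. f' n x v)" for x v
  have g': "(\<lambda>n. f' n x v) \<longlonglongrightarrow> g' x v" if "x \<in> S" for x v
    using conv[OF that, of v] unfolding g'_def by (metis limI)
  have "\<exists>G. \<forall>x\<in>S. (\<lambda>n. f n x) \<longlonglongrightarrow> G x \<and> (G has_derivative g' x) (at x within S)"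
  proof (rule has_derivative_sequence)
    show "convex S" unfolding S_def by simp
    show "(f n has_derivative f' n x) (at x within S)" if "x \<in> S" for n x
      using f'(1) that SU has_derivative_at_withinI by blast
    show zS: "z \<in> S" unfolding S_def using r by simp
    show "(\<lambda>n. f n z) \<longlonglongrightarrow> g z" by (rule tendsto_uniform_limitI[OF lim]) (use zS SU in blast)
    fix e :: real assume e: "e > 0"
    obtain N where N: "\<forall>n\<ge>N. \<forall>m\<ge>N. \<forall>x\<in>S. \<forall>v. norm (f' n x v - f' m x v) \<le> e * norm v"
      using uc'[OF e] by blast
    have "norm (f' n x v - g' x v) \<le> e * norm v" if "n \<ge> N" "x \<in> S" for n x v
    proof (rule tendsto_upperbound)
      show "(\<lambda>m. norm (f' n x v - f' m x v)) \<longlonglongrightarrow> norm (f' n x v - g' x v)"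
        by (intro tendsto_intros g' that)
      show "\<forall>\<^sub>F m in sequentially. norm (f' n x v - f' m x v) \<le> e * norm v"
        unfolding eventually_sequentially using N that by blast
    qed simp
    then show "\<forall>\<^sub>F n in sequentially. \<forall>x\<in>S. \<forall>v. norm (f' n x v - g' x v) \<le> e * norm v"
      unfolding eventually_sequentially by blast
  qed
  then obtain G where G: "\<And>x. x \<in> S \<Longrightarrow> (\<lambda>n. f n x) \<longlonglongrightarrow> G x"
    "\<And>x. x \<in> S \<Longrightarrow> (G has_derivative g' x) (at x within S)" by blast
  have zS: "z \<in> S" and oS: "open S" unfolding S_def using r by auto
  have "(G has_derivative g' z) (at z)" using G(2)[OF zS] at_within_open[OF zS oS] by simp
  then have "(g has_derivative g' z) (at z)"
  proof (rule has_derivative_transform_within_open[OF _ oS zS])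
    fix x assume x: "x \<in> S"
    have "(\<lambda>n. f n x) \<longlonglongrightarrow> g x" by (rule tendsto_uniform_limitI[OF lim]) (use x SU in blast)
    then show "G x = g x" using G(1)[OF x] LIMSEQ_unique by blast
  qed
  moreover have "g' z (c *s v) = c * g' z v" for c v
  proof (rule LIMSEQ_unique[OF g'[OF zS]])
    have "(\<lambda>n. c * f' n z v) \<longlonglongrightarrow> c * g' z v" by (intro tendsto_intros g' zS)
    then show "(\<lambda>n. f' n z (c *s v)) \<longlonglongrightarrow> c * g' z v" using f'(2) zS SU by auto
  qed
  ultimately show "\<exists>h'. (g has_derivative h') (at z) \<and> (\<forall>c v. h' (c *s v) = c * h' v)" by blast
qed

lemma norm_vec_le_sum: "norm (x :: complex^'k) \<le> (\<Sum>i\<in>UNIV. norm (x $ i))"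
  unfolding norm_vec_def by (rule L2_set_le_sum) simp

lemma norm_component_le: "norm ((x :: complex^'k) $ i) \<le> norm x"
  by (rule Finite_Cartesian_Product.norm_nth_le)

lemma holo_vec_on_subset: "holo_vec_on F U \<Longrightarrow> V \<subseteq> U \<Longrightarrow> holo_vec_on F V"
  unfolding holo_vec_on_def using holo_on_subset by blast

lemma uniform_limit_component:
  fixes F :: "nat \<Rightarrow> 'a \<Rightarrow> complex^'k::finite"
  assumes "uniform_limit S F G sequentially"
  shows "uniform_limit S (\<lambda>n z. F n z $ l) (\<lambda>z. G z $ l) sequentially"
  unfolding uniform_limit_iff
proof (intro allI impI)
  fix e :: real assume "0 < e"
  then have "\<forall>\<^sub>F n in sequentially. \<forall>x\<in>S. dist (F n x) (G x) < e"
    using assms unfolding uniform_limit_iff by blast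
  then show "\<forall>\<^sub>F n in sequentially. \<forall>x\<in>S. dist (F n x $ l) (G x $ l) < e"
    by (rule eventually_mono) (meson dist_vec_nth_le order_le_less_trans)
qed

text \<open>
  Cauchy's estimate makes a bounded sequence equi-Lipschitz on the ball of half the radius, so the
  Arzela-Ascoli theorem applies.
\<close>

lemma holo_vec_Montel:
  fixes F :: "nat \<Rightarrow> complex^'m \<Rightarrow> complex^'k::finite"
  assumes r: "0 < r" and F: "\<And>n. holo_vec_on (F n) (ball a r)"
    and B: "\<And>n w. w \<in> ball a r \<Longrightarrow> norm (F n w) \<le> B"
  obtains G s where "strict_mono (s :: nat \<Rightarrow> nat)"
    "uniform_limit (cball a (r/2)) (\<lambda>n. F (s n)) G sequentially" "holo_vec_on G (ball a (r/2))"
proof -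
  define L where "L = (\<Sum>i\<in>(UNIV::'k set). 4 * B / r)"
  have B0: "0 \<le> B" using B[of a 0] r norm_ge_zero[of "F 0 a"] by (metis centre_in_ball order_trans)
  have L0: "0 \<le> L" unfolding L_def using B0 r by (intro sum_nonneg) auto
  have Lip: "norm (F n x - F n y) \<le> L * norm (x - y)" if "x \<in> cball a (r/2)" "y \<in> cball a (r/2)" for n x y
  proof -
    have "norm (F n x - F n y) \<le> (\<Sum>i\<in>UNIV. norm ((F n x - F n y) $ i))" by (rule norm_vec_le_sum)
    also have "\<dots> \<le> (\<Sum>i\<in>(UNIV::'k set). 4 * B / r * norm (x - y))"
    proof (rule sum_mono)
      fix i :: 'k
      have "norm (F n x $ i - F n y $ i) \<le> 4 * B / r * norm (x - y)"
        by (rule holo_on_Lipschitz[OF _ _ that])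
           (use F[of n] B norm_component_le order_trans in \<open>unfold holo_vec_on_def, blast+\<close>)
      then show "norm ((F n x - F n y) $ i) \<le> 4 * B / r * norm (x - y)" by simp
    qed
    also have "\<dots> = L * norm (x - y)" unfolding L_def by (simp add: sum_distrib_right)
    finally show ?thesis .
  qed
  obtain G s where s: "strict_mono (s :: nat \<Rightarrow> nat)"
    and lim: "\<And>e. 0 < e \<Longrightarrow> \<exists>N. \<forall>n x. n \<ge> N \<and> x \<in> cball a (r/2) \<longrightarrow> norm (F (s n) x - G x) < e"
  proof (rule Arzela_Ascoli[of "cball a (r/2)" F B])
    show "norm (F n x) \<le> B" if "x \<in> cball a (r/2)" for n x using B[of x n] that r by auto
    fix x and e :: real assume x: "x \<in> cball a (r/2)" and e: "0 < e"
    have "norm (F n x - F n y) < e" if "y \<in> cball a (r/2)" "norm (x - y) < e / (L + 1)" for n y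
    proof -
      have "norm (F n x - F n y) \<le> L * norm (x - y)" by (rule Lip[OF x that(1)])
      also have "\<dots> \<le> (L + 1) * norm (x - y)" by (simp add: mult_right_mono)
      also have "\<dots> < e" using that(2) L0 by (simp add: field_simps)
      finally show ?thesis .
    qed
    then show "\<exists>d>0. \<forall>n y. y \<in> cball a (r/2) \<and> norm (x - y) < d \<longrightarrow> norm (F n x - F n y) < e"
      using e L0 by (intro exI[of _ "e / (L + 1)"]) auto
  qed (rule compact_cball, use that in blast)
  have ul: "uniform_limit (cball a (r/2)) (\<lambda>n. F (s n)) G sequentially"
    unfolding uniform_limit_iff eventually_sequentially dist_norm using lim by blast
  have "holo_on (\<lambda>z. G z $ l) (ball a (r/2))" for l
  proof (rule holo_on_uniform_limit)
    show "holo_on (\<lambda>z. F (s n) z $ l) (ball a (r/2))" for n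
      using F[of "s n"] r unfolding holo_vec_on_def by (auto intro: holo_on_subset)
    have "uniform_limit (ball a (r/2)) (\<lambda>n. F (s n)) G sequentially"
      using ul ball_subset_cball uniform_limit_on_subset by blast
    then show "uniform_limit (ball a (r/2)) (\<lambda>n z. F (s n) z $ l) (\<lambda>z. G z $ l) sequentially"
      by (rule uniform_limit_component)
  qed simp
  then show ?thesis using that[OF s ul] unfolding holo_vec_on_def by blast
qed

lemma holo_on_Montel:
  fixes f :: "nat \<Rightarrow> complex^'m \<Rightarrow> complex"
  assumes r: "0 < r" and f: "\<And>n. holo_on (f n) (ball a r)"
    and B: "\<And>n w. w \<in> ball a r \<Longrightarrow> norm (f n w) \<le> B"
  obtains g s where "strict_mono (s :: nat \<Rightarrow> nat)"
    "uniform_limit (cball a (r/2)) (\<lambda>n. f (s n)) g sequentially" "holo_on g (ball a (r/2))"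
proof -
  define F where "F n z = (\<chi> i::1. f n z)" for n z
  have nF: "norm (F n z) \<le> norm (f n z)" for n z
    using norm_vec_le_sum[of "F n z"] unfolding F_def by simp
  obtain G s where s: "strict_mono (s :: nat \<Rightarrow> nat)"
    "uniform_limit (cball a (r/2)) (\<lambda>n. F (s n)) G sequentially" "holo_vec_on G (ball a (r/2))"
  proof (rule holo_vec_Montel[OF r, of F a B])
    show "holo_vec_on (F n) (ball a r)" for n unfolding holo_vec_on_def F_def using f by simp
    show "norm (F n w) \<le> B" if "w \<in> ball a r" for n w using nF B[OF that] order_trans by blast
  qed (use that in blast)
  have "uniform_limit (cball a (r/2)) (\<lambda>n z. F (s n) z $ 1) (\<lambda>z. G z $ 1) sequentially"
    by (rule uniform_limit_component[OF s(2)])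
  then have "uniform_limit (cball a (r/2)) (\<lambda>n. f (s n)) (\<lambda>z. G z $ 1) sequentially"
    unfolding F_def by simp
  then show ?thesis using that s unfolding holo_vec_on_def by blast
qed

text \<open>
  Join \<open>z\<close> to a point of \<open>V\<close> by a complex line: its part in \<open>U\<close> is convex, and the restriction of \<open>h\<close>
  vanishes on the open part in \<open>V\<close>.
\<close>

lemma holo_on_identity_convex:
  fixes h :: "complex^'m \<Rightarrow> complex"
  assumes h: "holo_on h U" and U: "open U" "convex U" and V: "open V" "V \<noteq> {}" "V \<subseteq> U"
    and zero: "\<And>z. z \<in> V \<Longrightarrow> h z = 0" and z: "z \<in> U"
  shows "h z = 0"
proof -
  obtain p where p: "p \<in> V" using V by blast
  define l where "l t = p + t *s (z - p)" for t
  have contl: "continuous_on UNIV l"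
    unfolding l_def by (intro continuous_intros linear_continuous_on linear_smult_left[THEN linear_conv_bounded_linear[THEN iffD1]])
  define f where "f t = h (l t)" for t
  have "f 1 = 0"
  proof (rule analytic_continuation_open[of "l -` V" "l -` U" f "\<lambda>_. 0" 1])
    show "open (l -` V)" "open (l -` U)"
      using open_vimage[OF _ contl] V U by auto
    have "l 0 = p" by (simp add: l_def)
    then show "l -` V \<noteq> {}" using p by (metis empty_iff vimage_eq)
    have "convex (l -` U)"
    proof -
      have "l -` U = (\<lambda>t. t *s (z - p)) -` ((\<lambda>x. p + x) -` U)" unfolding l_def by auto
      moreover have "(\<lambda>x. p + x) -` U = (\<lambda>x. - p + x) ` U"
        by (auto simp: image_iff) (metis add_diff_cancel_left')
      ultimately show ?thesis
        using convex_linear_vimage[OF linear_smult_left[of "z - p"] convex_translation[OF U(2), of "- p"]]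
        by (simp only:)
    qed
    then show "connected (l -` U)" by (rule convex_connected)
    show "f holomorphic_on l -` U"
      unfolding f_def l_def by (rule holo_on_line[OF h]) simp
    show "1 \<in> l -` U" using z by (simp add: l_def)
  qed (use V zero in \<open>auto simp: f_def\<close>)
  then show ?thesis by (simp add: f_def l_def)
qed

definition partial :: "'m \<Rightarrow> (complex^'m \<Rightarrow> complex) \<Rightarrow> complex^'m \<Rightarrow> complex" where
  "partial i h z = deriv (\<lambda>t. h (z + t *s axis i 1)) 0"

text \<open>
  The difference quotients are holomorphic and, by the Lipschitz estimate, bounded; by Montel's theorem
  a subsequence converges locally uniformly, and the limit must be the partial derivative.
\<close>

lemma holo_on_partial:
  assumes h: "holo_on h U" and U: "open U"
  shows "holo_on (partial i h) U"
  unfolding holo_on_def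
proof
  fix a assume a: "a \<in> U"
  then obtain r where r: "0 < r" "cball a r \<subseteq> U" using U open_contains_cball by blast
  have hb: "holo_on h (ball a r)" using holo_on_subset[OF h] r(2) ball_subset_cball by blast
  have "compact (h ` cball a r)"
    using holo_on_imp_continuous_on[OF h] r(2) by (intro compact_continuous_image) (auto intro: continuous_on_subset)
  then obtain B where B: "\<And>z. z \<in> cball a r \<Longrightarrow> norm (h z) \<le> B"
    using compact_imp_bounded bounded_iff by (metis image_eqI)
  define \<epsilon> where "\<epsilon> n = r / (4 * real (Suc n))" for n
  have \<epsilon>: "0 < \<epsilon> n" "\<epsilon> n \<le> r/4" for n unfolding \<epsilon>_def using r by (auto simp: field_simps)
  have \<epsilon>0: "\<epsilon> \<longlonglongrightarrow> 0"
  proof -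
    have "(\<lambda>n. r / 4 * inverse (real (Suc n))) \<longlonglongrightarrow> r / 4 * 0" by (intro tendsto_intros LIMSEQ_inverse_real_of_nat)
    then show ?thesis unfolding \<epsilon>_def by (simp add: field_simps)
  qed
  \<comment> \<open>The difference quotients, defined near \<open>a\<close> since \<open>\<epsilon> n \<le> r / 4\<close>.\<close>
  define f where "f n z = (h (of_real (\<epsilon> n) *s axis i 1 + z) - h z) * of_real (inverse (\<epsilon> n))" for n z
  have nax: "norm (of_real (\<epsilon> n) *s axis i (1::complex)) = \<epsilon> n" for n
    using \<epsilon>(1)[of n] by (simp add: norm_vector_smult norm_axis_1)
  have shift: "of_real (\<epsilon> n) *s axis i 1 + z \<in> cball a (r/2)" if "z \<in> ball a (r/4)" for n z
  proof -
    have "norm (of_real (\<epsilon> n) *s axis i 1 + z - a) \<le> \<epsilon> n + norm (z - a)"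
      using norm_triangle_ineq[of "of_real (\<epsilon> n) *s axis i (1::complex)" "z - a"] nax[of n] by (simp add: add_diff_eq)
    then show ?thesis using that \<epsilon>(2)[of n] by (simp add: dist_norm norm_minus_commute)
  qed
  obtain g s where s: "strict_mono (s :: nat \<Rightarrow> nat)"
    "uniform_limit (cball a (r/4/2)) (\<lambda>n. f (s n)) g sequentially" "holo_on g (ball a (r/4/2))"
  proof (rule holo_on_Montel[of "r/4" f a "4 * B / r"])
    fix n
    have "holo_on (\<lambda>z. h (of_real (\<epsilon> n) *s axis i 1 + z)) (ball a (r/4))"
    proof (rule holo_on_compose_affine[OF h, of "\<lambda>z. z"])
      fix z assume "z \<in> ball a (r/4)"
      then show "of_real (\<epsilon> n) *s axis i 1 + z \<in> U" using shift[of z n] r by auto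
    qed (auto intro: linearI)
    moreover have "holo_on (\<lambda>z. (-1) * h z) (ball a (r/4))"
      using r by (intro holo_on_mult holo_on_const holo_on_subset[OF h]) auto
    ultimately have "holo_on (\<lambda>z. (h (of_real (\<epsilon> n) *s axis i 1 + z) + (-1) * h z) * of_real (inverse (\<epsilon> n))) (ball a (r/4))"
      by (rule holo_on_mult[OF holo_on_add holo_on_const])
    then show "holo_on (f n) (ball a (r/4))"
      by (rule holo_on_cong_open) (simp_all add: f_def)
    fix w assume w: "w \<in> ball a (r/4)"
    have "norm (h (of_real (\<epsilon> n) *s axis i 1 + w) - h w) \<le> 4 * B / r * norm (of_real (\<epsilon> n) *s axis i 1 + w - w)"
    proof (rule holo_on_Lipschitz[OF hb _ shift[OF w]])
      show "w \<in> cball a (r/2)" using w zero_le_dist[of a w] unfolding mem_ball mem_cball by linarith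
    qed (use B in auto)
    also have "\<dots> = 4 * B / r * \<epsilon> n" using nax[of n] by simp
    finally have "norm (h (of_real (\<epsilon> n) *s axis i 1 + w) - h w) * inverse (\<epsilon> n) \<le> 4 * B / r"
      using \<epsilon>(1)[of n] by (simp add: field_simps)
    then show "norm (f n w) \<le> 4 * B / r"
      unfolding f_def norm_mult norm_of_real using \<epsilon>(1)[of n] by simp
  qed (use r that in \<open>auto; blast\<close>)
  have eq: "g z = partial i h z" if z: "z \<in> ball a (r/4/2)" for z
  proof (rule LIMSEQ_unique)
    show "(\<lambda>n. f (s n) z) \<longlonglongrightarrow> g z"
      by (rule tendsto_uniform_limitI[OF s(2)]) (use z in auto)
    have "z \<in> U" using z r by auto
    then obtain h' where h': "(h has_derivative h') (at z)" "\<forall>c v. h' (c *s v) = c * h' v"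
      using h unfolding holo_on_def by blast
    have D: "((\<lambda>t. h (z + t *s axis i 1)) has_field_derivative h' (axis i 1)) (at 0)"
      by (rule line_has_field_derivative) (use h' in auto)
    then have p: "partial i h z = h' (axis i 1)" unfolding partial_def by (rule DERIV_imp_deriv)
    have "(\<lambda>n. of_real (\<epsilon> n) :: complex) \<longlonglongrightarrow> of_real 0" by (intro tendsto_of_real \<epsilon>0)
    then have "filterlim (\<lambda>n. of_real (\<epsilon> n) :: complex) (at 0) sequentially"
      using \<epsilon>(1) by (intro filterlim_atI) (auto simp: less_imp_neq[THEN not_sym] intro!: always_eventually)
    then have "(\<lambda>n. (h (z + (0 + of_real (\<epsilon> n)) *s axis i 1) - h (z + 0 *s axis i 1)) / of_real (\<epsilon> n)) \<longlonglongrightarrow> h' (axis i 1)"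
      by (rule filterlim_compose[OF D[unfolded DERIV_def]])
    then have "(\<lambda>n. f n z) \<longlonglongrightarrow> partial i h z"
      unfolding p f_def by (simp add: divide_inverse add.commute)
    then show "(\<lambda>n. f (s n) z) \<longlonglongrightarrow> partial i h z"
      using LIMSEQ_subseq_LIMSEQ[OF _ s(1), of "\<lambda>n. f n z"] by (simp add: o_def)
  qed
  have "holo_on (partial i h) (ball a (r/4/2))" by (rule holo_on_cong_open[OF s(3) open_ball eq])
  then show "\<exists>h'. (partial i h has_derivative h') (at a) \<and> (\<forall>c v. h' (c *s v) = c * h' v)"
    unfolding holo_on_def using r by auto
qed

section \<open>Power series and the order of vanishing\<close>

definition upd_coord :: "'m \<Rightarrow> complex \<Rightarrow> complex^'m \<Rightarrow> complex^'m" where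
  "upd_coord i t z = (\<chi> j. if j = i then t else z $ j)"

lemma upd_coord_nth: "upd_coord i t z $ j = (if j = i then t else z $ j)"
  by (simp add: upd_coord_def)

lemma upd_coord_eq: "upd_coord i t z = upd_coord i 0 z + t *s axis i 1"
  by (simp add: vec_eq_iff upd_coord_def axis_def)

text \<open>
  The Taylor coefficients in the coordinate \<open>i\<close> are values of iterated partial derivatives, and hence
  holomorphic in the remaining coordinates.
\<close>

lemma iterated_partial_upd_coord:
  "(deriv ^^ d) (\<lambda>t. h (upd_coord i t z)) = (\<lambda>t. (partial i ^^ d) h (upd_coord i t z))"
proof (induction d)
  case (Suc d)
  let ?H = "(partial i ^^ d) h"
  have "deriv (\<lambda>t. ?H (upd_coord i t z)) t = partial i ?H (upd_coord i t z)" for t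
  proof -
    have "upd_coord i (t + s) z = upd_coord i t z + s *s axis i 1" for s
      by (simp add: vec_eq_iff upd_coord_def axis_def)
    then have "partial i ?H (upd_coord i t z) = deriv ((\<lambda>t. ?H (upd_coord i t z)) \<circ> (\<lambda>s. t + s)) 0"
      unfolding partial_def o_def by simp
    then show ?thesis using deriv_shift_0 by metis
  qed
  then show ?case using Suc by simp
qed simp

definition polydisc :: "real \<Rightarrow> (complex^'m) set" where
  "polydisc r = {z. \<forall>i. norm (z $ i) < r}"

lemma open_polydisc: "open (polydisc r :: (complex^'m::finite) set)"
proof -
  have "polydisc r = (\<Inter>i. {z :: complex^'m. norm (z $ i) < r})" unfolding polydisc_def by auto
  also have "open \<dots>" by (intro open_INT ballI open_Collect_less continuous_intros) auto
  finally show ?thesis .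
qed

lemma summable_multi_geometric:
  fixes q :: "'m::finite \<Rightarrow> real"
  assumes "\<And>i. 0 \<le> q i" "\<And>i. q i < 1"
  shows "(\<lambda>\<mu>. \<Prod>i\<in>UNIV. q i ^ \<mu> i) summable_on UNIV"
proof -
  have "Infinite_Set_Sum.abs_summable_on (\<lambda>\<mu>. \<Prod>i\<in>UNIV. q i ^ \<mu> i) (PiE UNIV (\<lambda>_. UNIV))"
  proof (rule abs_summable_on_prod_PiE)
    fix i
    show "Infinite_Set_Sum.abs_summable_on (\<lambda>k. q i ^ k) UNIV"
      unfolding abs_summable_on_nat_iff' using assms by (simp add: power_abs summable_geometric)
  qed auto
  then have "Infinite_Sum.abs_summable_on (\<lambda>\<mu>. \<Prod>i\<in>UNIV. q i ^ \<mu> i) UNIV"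
    unfolding abs_summable_equivalent by simp
  then show ?thesis by (rule abs_summable_summable)
qed

text \<open>
  The claim for \<open>insert i J\<close> follows by expanding in the coordinate \<open>i\<close> and applying the induction
  hypothesis to the coefficients, which are holomorphic functions bounded by \<open>B / \<rho> ^ d\<close>. The bound on
  the coefficients gives absolute convergence, so the iterated sum is a sum over all multi-indices.
\<close>

lemma power_series_on_coordinates:
  fixes h :: "complex^'m \<Rightarrow> complex" and J :: "'m set"
  assumes "finite J" and \<rho>: "0 < \<rho>" "\<rho> < r"
    and "holo_on h (polydisc r)" and "\<And>z. z \<in> polydisc r \<Longrightarrow> norm (h z) \<le> B"
  shows "\<exists>c. (\<forall>\<mu>. norm (c \<mu>) \<le> B / (\<Prod>i\<in>UNIV. \<rho> ^ \<mu> i)) \<and> (\<forall>\<mu>. (\<exists>i. i \<notin> J \<and> \<mu> i \<noteq> 0) \<longrightarrow> c \<mu> = 0) \<and>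
    (\<forall>z\<in>polydisc \<rho>. (\<forall>i. i \<notin> J \<longrightarrow> z $ i = 0) \<longrightarrow>
       ((\<lambda>\<mu>. c \<mu> * (\<Prod>i\<in>UNIV. (z $ i) ^ \<mu> i)) has_sum h z) UNIV)"
  using assms(1,4,5)
proof (induction J arbitrary: h B rule: finite_induct)
  case empty
  have z0: "0 \<in> polydisc r" using \<rho> by (simp add: polydisc_def)
  have B: "0 \<le> B" using empty(2)[OF z0] norm_ge_zero order_trans by blast
  let ?c = "\<lambda>\<mu> :: 'm \<Rightarrow> nat. if \<mu> = (\<lambda>_. 0) then h 0 else 0"
  have "((\<lambda>\<mu>. ?c \<mu> * (\<Prod>i\<in>UNIV. (z $ i) ^ \<mu> i)) has_sum h z) UNIV" if "\<forall>i. z $ i = 0" for z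
  proof -
    have "z = 0" using that by (simp add: vec_eq_iff)
    have "((\<lambda>\<mu>. ?c \<mu> * (\<Prod>i\<in>UNIV. (z $ i) ^ \<mu> i)) has_sum h z) {\<lambda>_. 0}"
      using \<open>z = 0\<close> by (intro has_sum_finiteI) auto
    then show ?thesis by (rule has_sum_cong_neutral[THEN iffD1, rotated 3]) auto
  qed
  moreover have "norm (?c \<mu>) \<le> B / (\<Prod>i\<in>UNIV. \<rho> ^ \<mu> i)" for \<mu>
    using empty(2)[OF z0] B \<rho> by (auto intro!: divide_nonneg_nonneg prod_nonneg)
  ultimately show ?case by (intro exI[of _ ?c]) auto
next
  case (insert i J)
  define D where "D d y = (partial i ^^ d) h (upd_coord i 0 y) / fact d" for d y
  have iter: "holo_on ((partial i ^^ d) h) (polydisc r)" for d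
    by (induction d) (auto intro: insert.prems holo_on_partial open_polydisc)
  have upd: "upd_coord i t y \<in> polydisc s" if "y \<in> polydisc s" "norm t < s" for t y s
    using that unfolding polydisc_def by (simp add: upd_coord_nth)
  have holf: "(\<lambda>t. h (upd_coord i t y)) holomorphic_on ball 0 r" if "y \<in> polydisc r" for y
  proof -
    have "(\<lambda>t. h (upd_coord i 0 y + t *s axis i 1)) holomorphic_on ball 0 r"
      by (rule holo_on_line[OF insert.prems(1)])
         (use upd[OF that] in \<open>auto simp: upd_coord_eq[symmetric]\<close>)
    then show ?thesis by (simp add: upd_coord_eq[symmetric])
  qed
  have D_eq: "D d y = (deriv ^^ d) (\<lambda>t. h (upd_coord i t y)) 0 / fact d" for d y
    unfolding D_def iterated_partial_upd_coord ..
  have holD: "holo_on (D d) (polydisc r)" for d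
  proof -
    have "holo_on (\<lambda>y. (partial i ^^ d) h (0 + upd_coord i 0 y) * inverse (fact d)) (polydisc r)"
    proof (intro holo_on_mult holo_on_const holo_on_compose_affine[OF iter])
      show "linear (upd_coord i 0 :: complex^'m \<Rightarrow> complex^'m)"
        by (rule linearI) (simp_all add: vec_eq_iff upd_coord_def)
    qed (use upd \<rho> in \<open>auto simp: vec_eq_iff upd_coord_def\<close>)
    then show ?thesis by (simp add: D_def[abs_def] divide_inverse)
  qed
  have boundD: "norm (D d y) \<le> B / \<rho> ^ d" if y: "y \<in> polydisc r" for d y
  proof -
    have "norm ((deriv ^^ d) (\<lambda>t. h (upd_coord i t y)) 0) \<le> fact d * B / \<rho> ^ d"
    proof (rule Cauchy_inequality)
      have "cball 0 \<rho> \<subseteq> ball (0::complex) r" using \<rho> by auto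
      then show "continuous_on (cball 0 \<rho>) (\<lambda>t. h (upd_coord i t y))"
        using holomorphic_on_imp_continuous_on[OF holf[OF y]] continuous_on_subset by blast
      show "(\<lambda>t. h (upd_coord i t y)) holomorphic_on ball 0 \<rho>"
        using holf[OF y] \<rho> by (auto intro: holomorphic_on_subset)
    qed (use \<rho> upd[OF y] insert.prems(2) in auto)
    then show ?thesis unfolding D_eq norm_divide by (simp add: field_simps)
  qed
  have "\<forall>d. \<exists>c. (\<forall>\<mu>. norm (c \<mu>) \<le> (B / \<rho> ^ d) / (\<Prod>i\<in>UNIV. \<rho> ^ \<mu> i)) \<and> (\<forall>\<mu>. (\<exists>i. i \<notin> J \<and> \<mu> i \<noteq> 0) \<longrightarrow> c \<mu> = 0) \<and>
    (\<forall>z\<in>polydisc \<rho>. (\<forall>i. i \<notin> J \<longrightarrow> z $ i = 0) \<longrightarrow>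
       ((\<lambda>\<mu>. c \<mu> * (\<Prod>i\<in>UNIV. (z $ i) ^ \<mu> i)) has_sum D d z) UNIV)"
    using insert.IH[OF holD boundD] by blast
  from choice[OF this] obtain c where
    call: "\<forall>d. (\<forall>\<mu>. norm (c d \<mu>) \<le> (B / \<rho> ^ d) / (\<Prod>i\<in>UNIV. \<rho> ^ \<mu> i)) \<and> (\<forall>\<mu>. (\<exists>i. i \<notin> J \<and> \<mu> i \<noteq> 0) \<longrightarrow> c d \<mu> = 0) \<and>
    (\<forall>z\<in>polydisc \<rho>. (\<forall>i. i \<notin> J \<longrightarrow> z $ i = 0) \<longrightarrow>
       ((\<lambda>\<mu>. c d \<mu> * (\<Prod>i\<in>UNIV. (z $ i) ^ \<mu> i)) has_sum D d z) UNIV)" ..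
  have c: "\<And>d \<mu>. norm (c d \<mu>) \<le> (B / \<rho> ^ d) / (\<Prod>i\<in>UNIV. \<rho> ^ \<mu> i)"
    "\<And>d \<mu> i. i \<notin> J \<Longrightarrow> \<mu> i \<noteq> 0 \<Longrightarrow> c d \<mu> = 0"
    "\<And>d z. z \<in> polydisc \<rho> \<Longrightarrow> (\<And>i. i \<notin> J \<Longrightarrow> z $ i = 0) \<Longrightarrow>
       ((\<lambda>\<mu>. c d \<mu> * (\<Prod>i\<in>UNIV. (z $ i) ^ \<mu> i)) has_sum D d z) UNIV"
    using call by blast+
  \<comment> \<open>A multi-index is split into its entry at \<open>i\<close> and the rest.\<close>
  define C where "C \<mu> = c (\<mu> i) (\<mu>(i := 0))" for \<mu>
  have split: "(\<Prod>j\<in>UNIV. f j (\<mu> j)) = f i (\<mu> i) * (\<Prod>j\<in>UNIV - {i}. f j (\<mu> j))"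
    for f :: "'m \<Rightarrow> nat \<Rightarrow> 'b::comm_monoid_mult" and \<mu>
    by (simp add: prod.remove[of UNIV i])
  have split0: "(\<Prod>j\<in>UNIV. f j ((\<mu>(i := 0)) j)) = f i 0 * (\<Prod>j\<in>UNIV - {i}. f j (\<mu> j))"
    for f :: "'m \<Rightarrow> nat \<Rightarrow> 'b::comm_monoid_mult" and \<mu>
  proof -
    have "(\<Prod>j\<in>UNIV - {i}. f j ((\<mu>(i := 0)) j)) = (\<Prod>j\<in>UNIV - {i}. f j (\<mu> j))"
      by (rule prod.cong) auto
    then show ?thesis unfolding split[of f "\<mu>(i := 0)"] by simp
  qed
  have C_bound: "norm (C \<mu>) \<le> B / (\<Prod>j\<in>UNIV. \<rho> ^ \<mu> j)" for \<mu>
    using c(1)[of "\<mu> i" "\<mu>(i := 0)"] unfolding C_def split[of "\<lambda>_ k. \<rho> ^ k"] split0[of "\<lambda>_ k. \<rho> ^ k"]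
    by (simp add: field_simps)
  have C_supp: "C \<mu> = 0" if "j \<notin> insert i J" "\<mu> j \<noteq> 0" for \<mu> j
    unfolding C_def by (rule c(2)[of j]) (use that in auto)
  have C_sum: "((\<lambda>\<mu>. C \<mu> * (\<Prod>j\<in>UNIV. (z $ j) ^ \<mu> j)) has_sum h z) UNIV"
    if z: "z \<in> polydisc \<rho>" and supp: "\<And>j. j \<notin> insert i J \<Longrightarrow> z $ j = 0" for z
  proof -
    have "(0::complex^'m) \<in> polydisc r" using \<rho> by (simp add: polydisc_def)
    from insert.prems(2)[OF this] have B: "0 \<le> B" using norm_ge_zero order_trans by blast
    have zi: "norm (z $ j) < \<rho>" for j using z by (simp add: polydisc_def)
    define w where "w = upd_coord i 0 z"
    have w: "w \<in> polydisc \<rho>" "\<And>j. j \<notin> J \<Longrightarrow> w $ j = 0"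
      using upd[OF z, of 0] \<rho> supp by (auto simp: w_def upd_coord_nth)
    have "upd_coord i 0 w = w" by (simp add: w_def vec_eq_iff upd_coord_nth)
    then have Dw: "D d z = D d w" for d unfolding D_def w_def[symmetric] by (simp only:)
    have zr: "z \<in> polydisc r" using less_trans[OF zi \<rho>(2)] by (simp add: polydisc_def)
    define N where "N = {\<nu> :: 'm \<Rightarrow> nat. \<nu> i = 0}"
    define F where "F = (\<lambda>(d, \<nu>). c d \<nu> * (\<Prod>j\<in>UNIV. (z $ j) ^ \<nu> j) * (z $ i) ^ d)"
    have inner: "((\<lambda>\<nu>. F (d, \<nu>)) has_sum (D d z * (z $ i) ^ d)) N" for d
    proof -
      have "((\<lambda>\<mu>. c d \<mu> * (\<Prod>i\<in>UNIV. (w $ i) ^ \<mu> i)) has_sum D d w) UNIV" by (rule c(3)[OF w])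
      then have "((\<lambda>\<nu>. c d \<nu> * (\<Prod>j\<in>UNIV. (z $ j) ^ \<nu> j)) has_sum D d z) N"
        unfolding Dw
      proof (rule has_sum_cong_neutral[THEN iffD1, rotated 3])
        fix \<nu> assume "\<nu> \<in> UNIV \<inter> N"
        then show "c d \<nu> * (\<Prod>i\<in>UNIV. (w $ i) ^ \<nu> i) = c d \<nu> * (\<Prod>j\<in>UNIV. (z $ j) ^ \<nu> j)"
          unfolding N_def w_def by (auto intro!: prod.cong simp: upd_coord_nth)
      next
        fix \<nu> assume "\<nu> \<in> UNIV - N"
        then show "c d \<nu> * (\<Prod>i\<in>UNIV. (w $ i) ^ \<nu> i) = 0"
          using c(2)[of i \<nu> d] insert.hyps unfolding N_def by auto
      qed auto
      then show ?thesis unfolding F_def by (simp add: has_sum_cmult_left)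
    qed
    have outer: "((\<lambda>d. D d z * (z $ i) ^ d) has_sum h z) UNIV"
    proof (rule norm_summable_imp_has_sum)
      have q: "norm (z $ i) / \<rho> < 1" using zi[of i] \<rho> by simp
      show "summable (\<lambda>d. norm (D d z * (z $ i) ^ d))"
      proof (rule summable_comparison_test')
        show "summable (\<lambda>d. B * (norm (z $ i) / \<rho>) ^ d)"
          using q \<rho> by (intro summable_mult summable_geometric) simp
        fix d show "norm (norm (D d z * (z $ i) ^ d)) \<le> B * (norm (z $ i) / \<rho>) ^ d"
          using mult_right_mono[OF boundD[OF zr, of d], of "norm (z $ i) ^ d"]
          by (simp add: norm_mult norm_power power_divide)
      qed
      have "upd_coord i (z $ i) z = z" by (simp add: vec_eq_iff upd_coord_nth)
      then show "(\<lambda>d. D d z * (z $ i) ^ d) sums h z"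
        using holomorphic_power_series[OF holf[OF zr], of "z $ i"] zi[of i] \<rho> unfolding D_eq by simp
    qed
    have bij: "bij_betw (\<lambda>(d, \<nu>). \<nu>(i := d)) (Sigma UNIV (\<lambda>_. N)) UNIV"
      by (rule bij_betw_byWitness[of _ "\<lambda>\<mu>. (\<mu> i, \<mu>(i := 0))"]) (auto simp: N_def)
    define T where "T \<mu> = C \<mu> * (\<Prod>j\<in>UNIV. (z $ j) ^ \<mu> j)" for \<mu>
    have FC: "F p = T ((\<lambda>(d, \<nu>). \<nu>(i := d)) p)" if pN: "p \<in> Sigma UNIV (\<lambda>_. N)" for p
    proof -
      obtain d \<nu> where p: "p = (d, \<nu>)" "\<nu> i = 0" using pN unfolding N_def by blast
      have "(\<nu>(i := d))(i := 0) = \<nu>" using p by auto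
      then have "C (\<nu>(i := d)) = c d \<nu>" by (simp add: C_def)
      moreover have "(\<Prod>j\<in>UNIV. (z $ j) ^ (\<nu>(i := d)) j) = (\<Prod>j\<in>UNIV. (z $ j) ^ \<nu> j) * (z $ i) ^ d"
        unfolding split[of "\<lambda>j k. (z $ j) ^ k"] using p(2) by (auto intro!: prod.cong simp: mult.commute)
      ultimately show ?thesis unfolding p F_def T_def by simp
    qed
    have "T summable_on UNIV"
    proof (rule abs_summable_summable, rule Infinite_Sum.abs_summable_on_comparison_test')
      show "(\<lambda>\<mu>. B * (\<Prod>j\<in>UNIV. (norm (z $ j) / \<rho>) ^ \<mu> j)) summable_on UNIV"
        using zi \<rho> by (intro summable_on_cmult_right summable_multi_geometric) auto
      fix \<mu>
      show "norm (T \<mu>) \<le> B * (\<Prod>j\<in>UNIV. (norm (z $ j) / \<rho>) ^ \<mu> j)"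
        using mult_right_mono[OF C_bound[of \<mu>], of "\<Prod>j\<in>UNIV. norm (z $ j) ^ \<mu> j"]
        by (simp add: T_def norm_mult prod_norm[symmetric] norm_power power_divide prod_dividef prod_nonneg)
    qed
    then have "(\<lambda>p. T ((\<lambda>(d, \<nu>). \<nu>(i := d)) p)) summable_on (Sigma UNIV (\<lambda>_. N))"
      unfolding summable_on_reindex_bij_betw[OF bij] .
    then have "F summable_on (Sigma UNIV (\<lambda>_. N))"
      by (rule summable_on_cong[THEN iffD1, rotated]) (rule FC[symmetric])
    then have "(F has_sum h z) (Sigma UNIV (\<lambda>_. N))"
      by (rule has_sum_SigmaI[OF inner outer])
    then have "((\<lambda>p. T ((\<lambda>(d, \<nu>). \<nu>(i := d)) p)) has_sum h z) (Sigma UNIV (\<lambda>_. N))"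
      by (rule has_sum_cong[THEN iffD1, rotated]) (rule FC)
    then have "(T has_sum h z) UNIV" unfolding has_sum_reindex_bij_betw[OF bij] .
    then show ?thesis unfolding T_def .
  qed
  show ?case
  proof (intro exI[of _ C] conjI allI ballI impI)
    show "norm (C \<mu>) \<le> B / (\<Prod>i\<in>UNIV. \<rho> ^ \<mu> i)" for \<mu> by (rule C_bound)
    show "C \<mu> = 0" if "\<exists>j. j \<notin> insert i J \<and> \<mu> j \<noteq> 0" for \<mu> using that C_supp by blast
    show "((\<lambda>\<mu>. C \<mu> * (\<Prod>i\<in>UNIV. (z $ i) ^ \<mu> i)) has_sum h z) UNIV"
      if "z \<in> polydisc \<rho>" "\<forall>j. j \<notin> insert i J \<longrightarrow> z $ j = 0" for z
      by (rule C_sum) (use that in auto)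
  qed
qed

lemma holo_on_has_power_series_at:
  fixes h :: "complex^'m::finite \<Rightarrow> complex"
  assumes h: "holo_on h U" and U: "open U" and a: "a \<in> U"
  obtains c where "has_power_series_at h c a"
proof -
  obtain R where R: "0 < R" "cball a R \<subseteq> U" using U a open_contains_cball by blast
  define r where "r = R / (real CARD('m) + 1)"
  have r: "0 < r" using R by (simp add: r_def)
  have pd: "a + z \<in> cball a R" if "z \<in> polydisc r" for z :: "complex^'m"
  proof -
    have "norm z \<le> (\<Sum>i\<in>UNIV. norm (z $ i))" by (rule norm_vec_le_sum)
    also have "\<dots> \<le> (\<Sum>i\<in>(UNIV::'m set). r)" by (rule sum_mono) (use that in \<open>auto simp: polydisc_def less_imp_le\<close>)
    also have "\<dots> \<le> R" using R by (simp add: r_def field_simps)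
    finally show ?thesis by (simp add: dist_norm)
  qed
  have "compact (h ` cball a R)"
    using holo_on_imp_continuous_on[OF h] R(2) by (intro compact_continuous_image) (auto intro: continuous_on_subset)
  then obtain B where B: "\<And>z. z \<in> cball a R \<Longrightarrow> norm (h z) \<le> B"
    using compact_imp_bounded bounded_iff by (metis image_eqI)
  have "holo_on (\<lambda>z. h (a + z)) (polydisc r)"
    by (rule holo_on_compose_affine[OF h, of "\<lambda>z. z"]) (use pd R in \<open>auto intro: linearI\<close>)
  then have "\<exists>c. \<forall>z\<in>polydisc (r/2). ((\<lambda>\<mu>. c \<mu> * (\<Prod>i\<in>UNIV. (z $ i) ^ \<mu> i)) has_sum h (a + z)) UNIV"
    using power_series_on_coordinates[of UNIV "r/2" r "\<lambda>z. h (a + z)" B] r B pd by auto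
  then obtain c where c: "\<And>z. z \<in> polydisc (r/2) \<Longrightarrow>
       ((\<lambda>\<mu>. c \<mu> * (\<Prod>i\<in>UNIV. (z $ i) ^ \<mu> i)) has_sum h (a + z)) UNIV" by blast
  have "((\<lambda>\<mu>. c \<mu> * (\<Prod>i\<in>UNIV. (z $ i - a $ i) ^ \<mu> i)) has_sum h z) UNIV" if "z \<in> ball a (r/2)" for z
  proof -
    have "norm ((z - a) $ i) < r / 2" for i
      using that norm_component_le[of "z - a" i] by (simp add: dist_norm norm_minus_commute)
    then have "z - a \<in> polydisc (r/2)" unfolding polydisc_def by blast
    from c[OF this] show ?thesis by simp
  qed
  then have "has_power_series_at h c a" unfolding has_power_series_at_def using r half_gt_zero by blast
  then show ?thesis by (rule that)
qed

text \<open>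
  A power series at \<open>a\<close> exists, and it has a nonzero coefficient because \<open>h\<close> does not vanish
  identically near \<open>a\<close>. So the least degree is attained, and degree \<open>0\<close> would mean \<open>h a \<noteq> 0\<close>.
\<close>

lemma vanishing_order_nonzero:
  assumes h: "holo_on h U" and U: "open U" "a \<in> U" and zero: "h a = 0"
    and nz: "\<And>V. open V \<Longrightarrow> a \<in> V \<Longrightarrow> \<exists>z\<in>V. h z \<noteq> 0"
  shows "vanishing_order h a \<noteq> 0"
proof
  assume 0: "vanishing_order h a = 0"
  let ?P = "\<lambda>d. \<exists>c \<mu>. has_power_series_at h c a \<and> c \<mu> \<noteq> 0 \<and> (\<Sum>i\<in>UNIV. \<mu> i) = d"
  obtain c where c: "has_power_series_at h c a" using holo_on_has_power_series_at[OF h U] .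
  have "\<exists>\<mu>. c \<mu> \<noteq> 0"
  proof (rule ccontr)
    assume "\<not> ?thesis"
    then obtain r where r: "0 < r" "\<forall>z\<in>ball a r. ((\<lambda>\<mu>::'a \<Rightarrow> nat. 0) has_sum h z) UNIV"
      using c unfolding has_power_series_at_def by auto
    then have "h z = 0" if "z \<in> ball a r" for z
      using has_sum_unique[OF r(2)[rule_format, OF that]] by simp
    then show False using nz[of "ball a r"] r by auto
  qed
  then have "\<exists>d. ?P d" using c by blast
  then have "?P (LEAST d. ?P d)" by (rule LeastI_ex)
  then have "?P 0" using 0 unfolding vanishing_order_def by simp
  then obtain c \<mu> where c: "has_power_series_at h c a" "c \<mu> \<noteq> 0" "(\<Sum>i\<in>UNIV. \<mu> i) = 0" by blast
  have \<mu>: "\<mu> = (\<lambda>_. 0)" using c(3) by (auto simp: sum_eq_0_iff)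
  obtain r where r: "0 < r" "\<forall>z\<in>ball a r. ((\<lambda>\<mu>. c \<mu> * (\<Prod>i\<in>UNIV. (z $ i - a $ i) ^ \<mu> i)) has_sum h z) UNIV"
    using c(1) unfolding has_power_series_at_def by blast
  have "((\<lambda>\<mu>. c \<mu> * (\<Prod>i\<in>UNIV. (a $ i - a $ i) ^ \<mu> i)) has_sum h a) UNIV"
    by (rule r(2)[rule_format]) (use r(1) in simp)
  moreover have "((\<lambda>\<mu>. c \<mu> * (\<Prod>i\<in>UNIV. (a $ i - a $ i) ^ \<mu> i)) has_sum c \<mu>) UNIV"
  proof -
    have "((\<lambda>\<mu>. c \<mu> * (\<Prod>i\<in>UNIV. (a $ i - a $ i) ^ \<mu> i)) has_sum c \<mu>) {\<lambda>_. 0}"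
      by (intro has_sum_finiteI) (auto simp: \<mu>)
    then show ?thesis
    proof (rule has_sum_cong_neutral[THEN iffD1, rotated 3])
      fix \<nu> assume "\<nu> \<in> (UNIV :: ('a \<Rightarrow> nat) set) - {\<lambda>_. 0}"
      then obtain j where "\<nu> j \<noteq> 0" by auto
      then show "c \<nu> * (\<Prod>i\<in>UNIV. (a $ i - a $ i) ^ \<nu> i) = 0" by (auto simp: prod_zero_iff)
    qed auto
  qed
  ultimately have "h a = c \<mu>" by (rule has_sum_unique)
  then show False using zero c by simp
qed

section \<open>Hyperplanes in general position\<close>

text \<open>
  The bilinear, not the Hermitian, form: its zeros in the second argument make up a hyperplane.
\<close>

definition pairing :: "complex^'k \<Rightarrow> complex^'k \<Rightarrow> complex" where
  "pairing \<alpha> v = (\<Sum>l\<in>UNIV. \<alpha> $ l * v $ l)"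

lemma pairing_smult_right: "pairing \<alpha> (c *s v) = c * pairing \<alpha> v"
  by (simp add: pairing_def sum_distrib_left algebra_simps)

lemma pairing_diff_left: "pairing (\<alpha> - \<beta>) v = pairing \<alpha> v - pairing \<beta> v"
  by (simp add: pairing_def left_diff_distrib sum_subtractf)

lemma pairing_zero_right [simp]: "pairing \<alpha> 0 = 0"
  by (simp add: pairing_def)

lemma norm_pairing_le:
  fixes \<alpha> v :: "complex^'k::finite"
  shows "norm (pairing \<alpha> v) \<le> real CARD('k) * norm \<alpha> * norm v"
proof -
  have "norm (pairing \<alpha> v) \<le> (\<Sum>l\<in>UNIV. norm (\<alpha> $ l * v $ l))"
    unfolding pairing_def by (rule norm_sum)
  also have "\<dots> \<le> (\<Sum>l\<in>(UNIV::'k set). norm \<alpha> * norm v)"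
    unfolding norm_mult by (intro sum_mono mult_mono norm_component_le) auto
  finally show ?thesis by simp
qed

lemma tendsto_pairing:
  assumes "(\<alpha> \<longlongrightarrow> \<beta>) F" "(v \<longlongrightarrow> w) F"
  shows "((\<lambda>j. pairing (\<alpha> j) (v j)) \<longlongrightarrow> pairing \<beta> w) F"
  unfolding pairing_def using assms by (intro tendsto_intros)

lemma continuous_on_pairing:
  assumes "continuous_on S f"
  shows "continuous_on S (\<lambda>z. pairing \<alpha> (f z))"
  unfolding pairing_def using assms by (intro continuous_intros)

lemma holo_on_pairing:
  assumes "holo_vec_on F U"
  shows "holo_on (\<lambda>z. pairing \<alpha> (F z)) U"
  unfolding pairing_def
  by (intro holo_on_sum holo_on_mult holo_on_const) (use assms in \<open>auto simp: holo_vec_on_def\<close>)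

lemma holo_vec_on_imp_continuous_on:
  assumes "holo_vec_on F U"
  shows "continuous_on U F"
proof -
  have "continuous_on U (\<lambda>z. \<chi> l. F z $ l)"
    by (rule continuous_on_vec_lambda) (use assms holo_on_imp_continuous_on in \<open>auto simp: holo_vec_on_def\<close>)
  then show ?thesis by simp
qed

lemma proj_in_hyperplane_pairing: "w \<noteq> 0 \<Longrightarrow> proj w \<in> hyperplane \<alpha> \<longleftrightarrow> pairing \<alpha> w = 0"
  unfolding pairing_def by (rule proj_in_hyperplane_iff)

lemma det_nonzero_imp_pairing_nonzero:
  fixes \<beta> :: "'k::finite \<Rightarrow> complex^'k"
  assumes det: "det (\<chi> i. \<beta> i) \<noteq> 0" and v: "v \<noteq> 0"
  shows "\<exists>i. pairing (\<beta> i) v \<noteq> 0"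
proof (rule ccontr)
  assume "\<not> ?thesis"
  then have "(\<chi> i. \<beta> i) *v v = 0"
    by (simp add: vec_eq_iff matrix_vector_mult_def pairing_def)
  moreover have "invertible (\<chi> i. \<beta> i)" using det invertible_det_nz by blast
  ultimately show False
    using v matrix_left_invertible_ker unfolding invertible_def by blast
qed

text \<open>
  General position is expressed through common zeros of linear forms, since this is what applies to the
  representations of mappings; \<open>det_nonzero_imp_pairing_nonzero\<close> links it to the determinants.
\<close>

definition general_position :: "nat set \<Rightarrow> (nat \<Rightarrow> complex^'k::finite) \<Rightarrow> bool" where
  "general_position I \<beta> \<longleftrightarrow>
     (\<forall>J\<subseteq>I. card J = CARD('k) \<longrightarrow> (\<forall>v. v \<noteq> 0 \<longrightarrow> (\<exists>k\<in>J. pairing (\<beta> k) v \<noteq> 0)))"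

text \<open>
  The uniform version of general position. The bound on the linear forms makes zero-free ones a unit
  system; the bound on the vector turns bounds on the forms into bounds on a representation.
\<close>

definition quantitative_general_position :: "nat set \<Rightarrow> real \<Rightarrow> (nat \<Rightarrow> complex^'k::finite) \<Rightarrow> bool" where
  "quantitative_general_position I C \<alpha> \<longleftrightarrow>
     (\<forall>J\<subseteq>I. card J = CARD('k) \<longrightarrow> (\<forall>v. \<exists>k\<in>J. norm v \<le> C * norm (pairing (\<alpha> k) v) \<and>
        (\<forall>l\<in>I. norm (pairing (\<alpha> l) v) \<le> C * norm (pairing (\<alpha> k) v))))"

lemma general_position_lower_bound:
  fixes \<beta> :: "nat \<Rightarrow> complex^'k::finite"
  assumes gp: "\<And>v. v \<noteq> 0 \<Longrightarrow> \<exists>k\<in>J. pairing (\<beta> k) v \<noteq> 0" and J: "finite J" "J \<noteq> {}"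
  shows "\<exists>c>0. \<forall>v. \<exists>k\<in>J. c * norm v \<le> norm (pairing (\<beta> k) v)"
proof -
  let ?f = "\<lambda>v. \<Sum>k\<in>J. norm (pairing (\<beta> k) v)"
  have cont: "continuous_on (sphere 0 1) ?f"
    by (intro continuous_intros continuous_on_pairing)
  have "axis undefined 1 \<in> (sphere 0 1 :: (complex^'k) set)" by (simp add: norm_axis_1)
  then have "sphere 0 1 \<noteq> ({} :: (complex^'k) set)" by blast
  then obtain w where w: "w \<in> sphere 0 1" "\<And>v. v \<in> sphere 0 1 \<Longrightarrow> ?f w \<le> ?f v"
    using continuous_attains_inf[OF compact_sphere _ cont] by blast
  have "w \<noteq> 0" using w by auto
  then obtain k where "k \<in> J" "pairing (\<beta> k) w \<noteq> 0" using gp by blast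
  then have m: "0 < ?f w" using J by (intro sum_pos2[of _ k]) auto
  define c where "c = ?f w / real (card J)"
  have cJ: "0 < real (card J)" using J by (simp add: card_gt_0_iff)
  have c: "0 < c" unfolding c_def using m cJ by simp
  have "\<exists>k\<in>J. c * norm v \<le> norm (pairing (\<beta> k) v)" for v
  proof (rule ccontr)
    assume "\<not> ?thesis"
    then have less: "norm (pairing (\<beta> k) v) < c * norm v" if "k \<in> J" for k using that by (auto simp: not_le)
    then have "v \<noteq> 0" using J by force
    then have v: "0 < norm v" by simp
    define u where "u = of_real (inverse (norm v)) *s v"
    have "norm u = 1" unfolding u_def norm_vector_smult norm_of_real using v by simp
    then have "?f w \<le> ?f u" using w(2) by simp
    also have "?f u = inverse (norm v) * ?f v"
      unfolding u_def pairing_smult_right norm_mult norm_of_real using v by (simp add: sum_distrib_left)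
    also have "?f v < (\<Sum>k\<in>J. c * norm v)" by (rule sum_strict_mono) (use J less in auto)
    also have "\<dots> = ?f w * norm v" unfolding c_def using cJ by simp
    finally show False using v by (simp add: field_simps)
  qed
  then show ?thesis using c by blast
qed

text \<open>
  For fixed hyperplanes compactness of the unit sphere gives a lower bound \<open>c0\<close> for the largest of
  any \<open>CARD('k)\<close> linear forms; moving the normals by less than \<open>c0 / (2 * N)\<close> costs at most half of it.
\<close>

lemma general_position_perturbed:
  fixes \<beta> :: "nat \<Rightarrow> complex^'k::finite"
  assumes I: "finite I" and gp: "general_position I \<beta>"
  obtains C \<epsilon> where "1 \<le> C" "0 < \<epsilon>"
    "\<And>\<alpha>. \<forall>k\<in>I. norm (\<alpha> k) = 1 \<and> norm (\<alpha> k - \<beta> k) < \<epsilon> \<Longrightarrow> quantitative_general_position I C \<alpha>"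
proof -
  define N where "N = real CARD('k)"
  have N: "1 \<le> N" unfolding N_def by (simp add: Suc_leI)
  define \<J> where "\<J> = {J. J \<subseteq> I \<and> card J = CARD('k)}"
  have fin: "finite \<J>" unfolding \<J>_def using I by simp
  have "\<forall>J\<in>\<J>. \<exists>c>0. \<forall>v. \<exists>k\<in>J. c * norm v \<le> norm (pairing (\<beta> k) v)"
  proof
    fix J assume J: "J \<in> \<J>"
    then have "J \<noteq> {}" "finite J" unfolding \<J>_def using I finite_subset by auto
    then show "\<exists>c>0. \<forall>v. \<exists>k\<in>J. c * norm v \<le> norm (pairing (\<beta> k) v)"
      using gp J unfolding \<J>_def general_position_def by (intro general_position_lower_bound) auto
  qed
  then obtain c where c: "\<And>J. J \<in> \<J> \<Longrightarrow> 0 < c J" "\<And>J v. J \<in> \<J> \<Longrightarrow> \<exists>k\<in>J. c J * norm v \<le> norm (pairing (\<beta> k) v)"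
    by metis
  define c0 where "c0 = Min (insert 1 (c ` \<J>))"
  have c0: "0 < c0" "c0 \<le> 1" "\<And>J. J \<in> \<J> \<Longrightarrow> c0 \<le> c J"
    unfolding c0_def using fin c(1) by (auto simp: Min_gr_iff)
  show ?thesis
  proof (rule that[of "2 * N / c0" "c0 / (2 * N)"])
    show "1 \<le> 2 * N / c0" using N c0 by (simp add: field_simps)
    show "0 < c0 / (2 * N)" using N c0 by simp
    fix \<alpha> :: "nat \<Rightarrow> complex^'k"
    assume "\<forall>k\<in>I. norm (\<alpha> k) = 1 \<and> norm (\<alpha> k - \<beta> k) < c0 / (2 * N)"
    then have \<alpha>: "\<And>k. k \<in> I \<Longrightarrow> norm (\<alpha> k) = 1 \<and> norm (\<alpha> k - \<beta> k) < c0 / (2 * N)" by blast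
    show "quantitative_general_position I (2 * N / c0) \<alpha>"
      unfolding quantitative_general_position_def
    proof (intro allI impI)
      fix J and v :: "complex^'k" assume J: "J \<subseteq> I" "card J = CARD('k)"
      then have J': "J \<in> \<J>" unfolding \<J>_def by simp
      obtain k where k: "k \<in> J" "c J * norm v \<le> norm (pairing (\<beta> k) v)" using c(2)[OF J'] by blast
      then have kI: "k \<in> I" using J by blast
      have "norm (pairing (\<alpha> k - \<beta> k) v) \<le> N * norm (\<alpha> k - \<beta> k) * norm v"
        unfolding N_def by (rule norm_pairing_le)
      also have "\<dots> \<le> N * (c0 / (2 * N)) * norm v"
        using \<alpha>[OF kI] N by (intro mult_right_mono mult_left_mono) auto
      also have "\<dots> = c0 / 2 * norm v" using N by simp
      finally have "norm (pairing (\<beta> k) v) \<le> norm (pairing (\<alpha> k) v) + c0 / 2 * norm v"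
        unfolding pairing_diff_left using norm_triangle_ineq4[of "pairing (\<alpha> k) v" "pairing (\<alpha> k) v - pairing (\<beta> k) v"] by simp
      moreover have "c0 * norm v \<le> c J * norm v" using c0(3)[OF J'] by (simp add: mult_right_mono)
      ultimately have low: "c0 / 2 * norm v \<le> norm (pairing (\<alpha> k) v)" using k(2) by simp
      then have nv: "norm v \<le> 2 / c0 * norm (pairing (\<alpha> k) v)" using c0 by (simp add: field_simps)
      also have "\<dots> \<le> 2 * N / c0 * norm (pairing (\<alpha> k) v)"
        using N c0 by (intro mult_right_mono divide_right_mono) auto
      finally have 1: "norm v \<le> 2 * N / c0 * norm (pairing (\<alpha> k) v)" .
      have "norm (pairing (\<alpha> l) v) \<le> 2 * N / c0 * norm (pairing (\<alpha> k) v)" if "l \<in> I" for l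
      proof -
        have "norm (pairing (\<alpha> l) v) \<le> N * norm v" using norm_pairing_le[of "\<alpha> l" v] \<alpha>[OF that] unfolding N_def by simp
        also have "\<dots> \<le> N * (2 / c0 * norm (pairing (\<alpha> k) v))" using nv N by (intro mult_left_mono) auto
        finally show ?thesis by (simp add: field_simps)
      qed
      then show "\<exists>k\<in>J. norm v \<le> 2 * N / c0 * norm (pairing (\<alpha> k) v) \<and> (\<forall>l\<in>I. norm (pairing (\<alpha> l) v) \<le> 2 * N / c0 * norm (pairing (\<alpha> k) v))"
        using 1 k by blast
    qed
  qed
qed

lemma tendsto_det:
  fixes A :: "'a \<Rightarrow> complex^'k::finite^'k"
  assumes "\<And>i j. ((\<lambda>x. A x $ i $ j) \<longlongrightarrow> B $ i $ j) F"
  shows "((\<lambda>x. det (A x)) \<longlongrightarrow> det B) F"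
  unfolding det_def by (intro tendsto_sum tendsto_mult tendsto_const tendsto_prod assms)

text \<open>
  The product of the determinants converges, so it is still positive in the limit, and so is each of
  its finitely many factors.
\<close>

lemma general_position_limit:
  fixes H :: "nat \<Rightarrow> nat \<Rightarrow> 'k::finite cproj set"
  assumes lim: "\<And>k. k \<in> {1..q} \<Longrightarrow> (\<lambda>j. unit_normal (H j k)) \<longlonglongrightarrow> \<beta> k"
    and d: "0 < d" "\<And>j. d \<le> hyp_D q (H j)"
  shows "general_position {1..q} \<beta>"
proof -
  define e :: "nat set \<Rightarrow> 'k \<Rightarrow> nat" where "e S = (SOME e. bij_betw e UNIV S)" for S
  define \<J> where "\<J> = {S. S \<subseteq> {1..q} \<and> card S = CARD('k)}"
  have e: "bij_betw (e S) UNIV S" if "S \<in> \<J>" for S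
  proof -
    have "finite S" "card S = CARD('k)" using that finite_subset unfolding \<J>_def by auto
    then have "\<exists>e. bij_betw e (UNIV::'k set) S" by (metis finite_same_card_bij finite)
    then show ?thesis unfolding e_def by (rule someI_ex)
  qed
  have D_eq: "hyp_D q (H j) = (\<Prod>S\<in>\<J>. norm (det (\<chi> i. unit_normal (H j (e S i)))))" for j
    unfolding hyp_D_def hyp_det_def \<J>_def e_def by simp
  have "(\<lambda>j. norm (det (\<chi> i. unit_normal (H j (e S i))))) \<longlonglongrightarrow> norm (det (\<chi> i. \<beta> (e S i)))"
    if S: "S \<in> \<J>" for S
  proof (rule tendsto_norm, rule tendsto_det)
    fix i l
    have "e S i \<in> {1..q}" using bij_betwE[OF e[OF S]] S unfolding \<J>_def by blast
    then show "(\<lambda>j. (\<chi> i. unit_normal (H j (e S i))) $ i $ l) \<longlonglongrightarrow> (\<chi> i. \<beta> (e S i)) $ i $ l"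
      using tendsto_vec_nth[OF lim] by simp
  qed
  then have "(\<lambda>j. hyp_D q (H j)) \<longlonglongrightarrow> (\<Prod>S\<in>\<J>. norm (det (\<chi> i. \<beta> (e S i))))"
    unfolding D_eq by (intro tendsto_prod)
  then have "d \<le> (\<Prod>S\<in>\<J>. norm (det (\<chi> i. \<beta> (e S i))))"
    by (rule LIMSEQ_le_const) (use d in blast)
  then have "(\<Prod>S\<in>\<J>. norm (det (\<chi> i. \<beta> (e S i)))) \<noteq> 0" using d by linarith
  moreover have "finite \<J>" unfolding \<J>_def by simp
  ultimately have det: "det (\<chi> i. \<beta> (e S i)) \<noteq> 0" if "S \<in> \<J>" for S using that by auto
  show ?thesis
    unfolding general_position_def
  proof (intro allI impI)
    fix J and v :: "complex^'k" assume "J \<subseteq> {1..q}" "card J = CARD('k)" "v \<noteq> 0"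
    then have J: "J \<in> \<J>" unfolding \<J>_def by simp
    obtain i where "pairing (\<beta> (e J i)) v \<noteq> 0"
      using det_nonzero_imp_pairing_nonzero[OF det[OF J] \<open>v \<noteq> 0\<close>] by blast
    then show "\<exists>k\<in>J. pairing (\<beta> k) v \<noteq> 0" using bij_betwE[OF e[OF J]] by blast
  qed
qed

section \<open>Values omitted outside the support of the divisor\<close>

lemma admissible_rep_subset:
  "admissible_rep D f U F \<Longrightarrow> open V \<Longrightarrow> V \<subseteq> U \<Longrightarrow> admissible_rep D f V F"
  unfolding admissible_rep_def using holo_vec_on_subset by blast

text \<open>
  In particular \<open>z\<close> is not a point of indeterminacy.
\<close>

definition omits_at :: "('a \<rightharpoonup> 'k cproj) \<Rightarrow> 'k cproj set \<Rightarrow> 'a \<Rightarrow> bool" where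
  "omits_at f H z \<longleftrightarrow> (\<exists>p. f z = Some p \<and> p \<notin> H)"

lemma admissible_rep_pairing_nonzero_iff:
  assumes "admissible_rep D f U F" "z \<in> U"
  shows "pairing \<alpha> (F z) \<noteq> 0 \<longleftrightarrow> omits_at f (hyperplane \<alpha>) z"
  using assms proj_in_hyperplane_pairing[of "F z" \<alpha>]
  unfolding admissible_rep_def omits_at_def by (cases "F z = 0") auto

text \<open>
  The value of the divisor is computed by some representation \<open>F'\<close> and some normal \<open>\<gamma>\<close> of the same
  hyperplane, chosen arbitrarily. Zeros of the linear form, and its not vanishing identically, can be
  read off from \<open>f\<close> and the hyperplane, so they transfer from \<open>F\<close> to \<open>F'\<close>.
\<close>

lemma divisor_zero_imp_nonvanishing:
  assumes rep: "admissible_rep D f U F" and z: "z \<in> U" and \<alpha>: "\<alpha> \<noteq> 0"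
    and nz: "\<And>V. open V \<Longrightarrow> z \<in> V \<Longrightarrow> \<exists>w\<in>V \<inter> U. pairing \<alpha> (F w) \<noteq> 0"
    and div: "divisor D f (hyperplane \<alpha>) z = 0"
  shows "pairing \<alpha> (F z) \<noteq> 0"
proof
  assume zero: "pairing \<alpha> (F z) = 0"
  let ?P = "\<lambda>d. \<exists>U F \<gamma>. z \<in> U \<and> admissible_rep D f U F \<and> \<gamma> \<noteq> 0 \<and> hyperplane \<alpha> = hyperplane \<gamma> \<and>
     d = vanishing_order (\<lambda>z. \<Sum>l\<in>UNIV. \<gamma> $ l * F z $ l) z"
  have "?P (vanishing_order (\<lambda>z. \<Sum>l\<in>UNIV. \<alpha> $ l * F z $ l) z)" using rep z \<alpha> by blast
  then have "?P (divisor D f (hyperplane \<alpha>) z)" unfolding divisor_def by (rule someI)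
  then obtain U' F' \<gamma> where rep': "z \<in> U'" "admissible_rep D f U' F'" and \<gamma>: "hyperplane \<alpha> = hyperplane \<gamma>"
    and ord: "vanishing_order (\<lambda>z. pairing \<gamma> (F' z)) z = 0" unfolding pairing_def using div by auto
  have "vanishing_order (\<lambda>z. pairing \<gamma> (F' z)) z \<noteq> 0"
  proof (rule vanishing_order_nonzero)
    show "holo_on (\<lambda>z. pairing \<gamma> (F' z)) U'" "open U'" "z \<in> U'"
      using rep' holo_on_pairing unfolding admissible_rep_def by blast+
    show "pairing \<gamma> (F' z) = 0"
      using zero \<gamma> admissible_rep_pairing_nonzero_iff[OF rep z] admissible_rep_pairing_nonzero_iff[OF rep'(2,1)] by metis
    fix V assume V: "open V" "z \<in> V"
    have "open (V \<inter> U')" "z \<in> V \<inter> U'" using V rep' unfolding admissible_rep_def by auto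
    then obtain w where w: "w \<in> V" "w \<in> U'" "w \<in> U" "pairing \<alpha> (F w) \<noteq> 0" using nz by blast
    then have "pairing \<gamma> (F' w) \<noteq> 0"
      using \<gamma> admissible_rep_pairing_nonzero_iff[OF rep] admissible_rep_pairing_nonzero_iff[OF rep'(2)] by metis
    then show "\<exists>z\<in>V. pairing \<gamma> (F' z) \<noteq> 0" using w by blast
  qed
  then show False using ord by simp
qed

text \<open>
  The points of \<open>D\<close> in the interior of \<open>Z\<close> form an open set, and by the identity theorem so do the other
  points of \<open>D\<close>.
\<close>

lemma zero_set_propagates:
  fixes D :: "(complex^'m) set"
  assumes D: "open D" "connected D"
    and loc: "\<And>a. a \<in> D \<Longrightarrow> \<exists>r h. 0 < r \<and> ball a r \<subseteq> D \<and> holo_on h (ball a r) \<and> (\<forall>z\<in>ball a r. z \<in> Z \<longleftrightarrow> h z = 0)"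
    and V: "open V" "V \<noteq> {}" "V \<subseteq> D" "V \<subseteq> Z"
  shows "D \<subseteq> Z"
proof -
  define W where "W = D \<inter> interior Z"
  define W' where "W' = {a\<in>D. \<exists>r>0. ball a r \<inter> W = {}}"
  have dich: "a \<in> W \<or> a \<in> W'" if a: "a \<in> D" for a
  proof -
    obtain r h where r: "0 < r" "ball a r \<subseteq> D" "holo_on h (ball a r)" "\<And>z. z \<in> ball a r \<Longrightarrow> z \<in> Z \<longleftrightarrow> h z = 0"
      using loc[OF a] by blast
    show ?thesis
    proof (cases "ball a r \<inter> W = {}")
      case True
      then show ?thesis unfolding W'_def using a r by blast
    next
      case False
      have "h z = 0" if "z \<in> ball a r" for z
      proof (rule holo_on_identity_convex[OF r(3) open_ball convex_ball _ False _ _ that])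
        show "open (ball a r \<inter> W)" unfolding W_def using D by auto
        show "h w = 0" if "w \<in> ball a r \<inter> W" for w using that r(4) interior_subset unfolding W_def by blast
      qed auto
      then have "ball a r \<subseteq> Z" using r by blast
      then have "a \<in> interior Z" using r interior_maximal[OF _ open_ball] by (meson centre_in_ball subsetD)
      then show ?thesis unfolding W_def using a by blast
    qed
  qed
  have "open W" unfolding W_def using D by auto
  moreover have "open W'"
    unfolding open_contains_ball
  proof
    fix a assume "a \<in> W'"
    then obtain r where r: "a \<in> D" "r > 0" "ball a r \<inter> W = {}" unfolding W'_def by blast
    obtain s where s: "s > 0" "ball a s \<subseteq> D" using D(1) r(1) open_contains_ball by blast
    have "ball a (min r s) \<subseteq> W'"
    proof
      fix b assume b: "b \<in> ball a (min r s)"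
      then have "b \<in> ball a r" by simp
      then obtain e where "e > 0" "ball b e \<subseteq> ball a r" using open_contains_ball open_ball by blast
      then show "b \<in> W'" unfolding W'_def using r s b by auto
    qed
    then show "\<exists>e>0. ball a e \<subseteq> W'" using r s by (intro exI[of _ "min r s"]) auto
  qed
  moreover have "W \<inter> W' \<inter> D = {}" unfolding W'_def using centre_in_ball by blast
  moreover have "D \<subseteq> W \<union> W'" using dich by blast
  ultimately have "W \<inter> D = {} \<or> W' \<inter> D = {}" using connectedD[OF D(2)] by blast
  moreover have "V \<subseteq> W" unfolding W_def using V interior_maximal by blast
  ultimately have "W' \<inter> D = {}" using V by blast
  then show ?thesis using dich interior_subset unfolding W_def by blast
qed

lemma closed_hyperplane: "closed (hyperplane \<alpha>)"
proof -
  have "{v. v \<noteq> 0 \<and> proj v \<in> - hyperplane \<alpha>} = - {0} \<inter> {v. pairing \<alpha> v \<noteq> 0}"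
    using proj_in_hyperplane_pairing by auto
  moreover have "open {v. pairing \<alpha> v \<noteq> 0}"
    by (intro open_Collect_neq continuous_on_pairing continuous_intros)
  ultimately have "open (- hyperplane \<alpha>)" unfolding open_cproj_def by auto
  then show ?thesis by (simp add: closed_def)
qed

text \<open>
  Otherwise the mapping would take all its values in the hyperplane, which is closed and hence contains
  the limit values that the closure of the graph adds.
\<close>

lemma pairing_not_identically_zero:
  assumes f: "meromorphic_map D f" and D: "open D" "connected D"
    and nr: "\<not> range_in_hyperplane D f (hyperplane \<alpha>)"
    and rep: "admissible_rep D f U F" and V: "open V" "V \<subseteq> U" "V \<noteq> {}"
  shows "\<exists>w\<in>V. pairing \<alpha> (F w) \<noteq> 0"
proof (rule ccontr)
  assume "\<not> ?thesis"
  then have zero: "\<And>w. w \<in> V \<Longrightarrow> pairing \<alpha> (F w) = 0" by blast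
  define Z where "Z = {z. \<not> omits_at f (hyperplane \<alpha>) z}"
  have "D \<subseteq> Z"
  proof (rule zero_set_propagates[OF D _ V(1,3)])
    fix a assume "a \<in> D"
    then obtain U F where U: "a \<in> U" "admissible_rep D f U F" using f unfolding meromorphic_map_def by blast
    then obtain r where r: "0 < r" "ball a r \<subseteq> U" unfolding admissible_rep_def using open_contains_ball by blast
    show "\<exists>r h. 0 < r \<and> ball a r \<subseteq> D \<and> holo_on h (ball a r) \<and> (\<forall>z\<in>ball a r. z \<in> Z \<longleftrightarrow> h z = 0)"
    proof (intro exI[of _ r] exI[of _ "\<lambda>z. pairing \<alpha> (F z)"] conjI ballI)
      show "ball a r \<subseteq> D" using r U unfolding admissible_rep_def by blast
      show "holo_on (\<lambda>z. pairing \<alpha> (F z)) (ball a r)"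
        using U(2) r holo_on_pairing holo_vec_on_subset unfolding admissible_rep_def by blast
      show "z \<in> Z \<longleftrightarrow> pairing \<alpha> (F z) = 0" if "z \<in> ball a r" for z
        using admissible_rep_pairing_nonzero_iff[OF U(2), of z \<alpha>] that r unfolding Z_def by auto
    qed (use r in auto)
  next
    show "V \<subseteq> D" using V rep unfolding admissible_rep_def by blast
    show "V \<subseteq> Z" using zero admissible_rep_pairing_nonzero_iff[OF rep] V unfolding Z_def by blast
  qed
  then have "{(z, p). z \<in> D \<and> f z = Some p} \<subseteq> UNIV \<times> hyperplane \<alpha>"
    unfolding Z_def omits_at_def by auto
  then have "closure {(z, p). z \<in> D \<and> f z = Some p} \<subseteq> UNIV \<times> hyperplane \<alpha>"
    by (rule closure_minimal) (intro closed_Times closed_UNIV closed_hyperplane)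
  then have "range_in_hyperplane D f (hyperplane \<alpha>)"
    unfolding range_in_hyperplane_def graph_closure_def by auto
  then show False using nr by simp
qed

text \<open>
  This turns information on the support of the divisor into information on omitted values.
\<close>

lemma outside_divisor_support_omits:
  assumes f: "meromorphic_map D f" and D: "open D" "connected D" and \<alpha>: "\<alpha> \<noteq> 0"
    and nr: "\<not> range_in_hyperplane D f (hyperplane \<alpha>)"
    and z: "z \<in> D" "z \<notin> divisor_supp D f (hyperplane \<alpha>)"
  shows "omits_at f (hyperplane \<alpha>) z"
proof -
  obtain U F where U: "z \<in> U" "admissible_rep D f U F" using f z unfolding meromorphic_map_def by blast
  have "pairing \<alpha> (F z) \<noteq> 0"
  proof (rule divisor_zero_imp_nonvanishing[OF U(2,1) \<alpha>])
    fix V assume "open V" "z \<in> V"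
    then show "\<exists>w\<in>V \<inter> U. pairing \<alpha> (F w) \<noteq> 0"
      using U by (intro pairing_not_identically_zero[OF f D nr U(2)]) (auto simp: admissible_rep_def)
  qed (use z in \<open>auto simp: divisor_supp_def\<close>)
  then show ?thesis using admissible_rep_pairing_nonzero_iff[OF U(2,1)] by blast
qed

text \<open>
  A representation on which the linear form equals \<open>1\<close> is unique, so the local ones fit together on all
  of \<open>U\<close>.
\<close>

lemma exists_normalised_rep:
  assumes f: "meromorphic_map D f" and U: "open U" "U \<subseteq> D"
    and om: "\<And>z. z \<in> U \<Longrightarrow> omits_at f (hyperplane \<alpha>) z"
  obtains F where "admissible_rep D f U F" "\<And>z. z \<in> U \<Longrightarrow> pairing \<alpha> (F z) = 1"
proof -
  define P where "P z v \<longleftrightarrow> v \<noteq> 0 \<and> f z = Some (proj v) \<and> pairing \<alpha> v = 1" for z v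
  have uniq: "v = w" if "P z v" "P z w" for z v w
  proof -
    have "proj v = proj w" "v \<noteq> 0" "w \<noteq> 0" using that unfolding P_def by auto
    then obtain c where c: "w = c *s v" using proj_eq_iff by blast
    then have "c = 1" using that unfolding P_def by (simp add: pairing_smult_right)
    then show ?thesis using c by simp
  qed
  define F where "F z = (SOME v. P z v)" for z
  have loc: "\<exists>V F'. open V \<and> a \<in> V \<and> V \<subseteq> U \<and> holo_vec_on F' V \<and> (\<forall>z\<in>V. P z (F' z))" if a: "a \<in> U" for a
  proof -
    obtain U' F' where U': "a \<in> U'" "admissible_rep D f U' F'" using f a U unfolding meromorphic_map_def by blast
    have nz: "pairing \<alpha> (F' z) \<noteq> 0" if "z \<in> U \<inter> U'" for z
      using admissible_rep_pairing_nonzero_iff[OF U'(2), of z \<alpha>] om[of z] that by auto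
    define G where "G z = inverse (pairing \<alpha> (F' z)) *s F' z" for z
    have "holo_vec_on G (U \<inter> U')"
      unfolding holo_vec_on_def G_def vector_smult_component
      using U'(2) nz unfolding admissible_rep_def
      by (intro allI holo_on_mult holo_on_inverse holo_on_pairing)
         (auto simp: holo_vec_on_def intro: holo_on_subset)
    moreover have "P z (G z)" if z: "z \<in> U \<inter> U'" for z
    proof -
      have F0: "F' z \<noteq> 0" using nz[OF z] by auto
      then have "f z = Some (proj (F' z))" using U'(2) z unfolding admissible_rep_def by auto
      moreover have G0: "G z \<noteq> 0" using F0 nz[OF z] unfolding G_def by (simp add: vector_mul_eq_0)
      moreover have "proj (F' z) = proj (G z)" using proj_eq_iff[OF F0 G0] unfolding G_def by blast
      ultimately show ?thesis unfolding P_def using nz[OF z] by (simp add: G_def pairing_smult_right)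
    qed
    moreover have "open (U \<inter> U')" using U U' unfolding admissible_rep_def by auto
    ultimately show ?thesis using a U' by blast
  qed
  have PF: "P z (F z)" if "z \<in> U" for z
    unfolding F_def using loc[OF that] by (metis someI)
  have "holo_vec_on F U"
    unfolding holo_vec_on_def holo_on_def
  proof (intro allI ballI)
    fix l a assume "a \<in> U"
    then obtain V F' where V: "open V" "a \<in> V" "V \<subseteq> U" "holo_vec_on F' V" "\<forall>z\<in>V. P z (F' z)" using loc by blast
    have "F' z = F z" if "z \<in> V" for z using uniq[of z] V PF that by blast
    then have "holo_on (\<lambda>z. F z $ l) V"
      using holo_on_cong_open[of "\<lambda>z. F' z $ l" V "\<lambda>z. F z $ l"] V unfolding holo_vec_on_def by simp
    then show "\<exists>h'. ((\<lambda>z. F z $ l) has_derivative h') (at a) \<and> (\<forall>c v. h' (c *s v) = c * h' v)"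
      using V(2) unfolding holo_on_def by blast
  qed
  then have "admissible_rep D f U F"
    unfolding admissible_rep_def using U PF unfolding P_def by auto
  then show ?thesis using that PF unfolding P_def by blast
qed

section \<open>Zero-free functions on balls and along chains of balls\<close>

text \<open>
  The analogue on \<open>U\<close> of balanced logarithms, stated for the zero-free functions themselves since they
  need not have logarithms on \<open>U\<close>.
\<close>

definition unit_system ::
    "'i set \<Rightarrow> nat \<Rightarrow> real \<Rightarrow> (complex^'m) set \<Rightarrow> ('i \<Rightarrow> complex^'m \<Rightarrow> complex) \<Rightarrow> bool" where
  "unit_system I n C U u \<longleftrightarrow> (\<forall>i\<in>I. holo_on (u i) U \<and> (\<forall>z\<in>U. u i z \<noteq> 0)) \<and>
     (\<forall>z\<in>U. \<forall>l\<in>I. \<forall>J\<subseteq>I. card J = Suc n \<longrightarrow> (\<exists>k\<in>J. norm (u l z) \<le> C * norm (u k z)))"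

lemma unit_system_mono:
  assumes "unit_system I n C U u" "C \<le> C'"
  shows "unit_system I n C' U u"
  using assms mult_right_mono[OF assms(2) norm_ge_zero] unfolding unit_system_def
  by (meson order_trans)

definition dominates ::
    "'i set \<Rightarrow> real \<Rightarrow> ('i \<Rightarrow> complex^'m \<Rightarrow> complex) \<Rightarrow> (complex^'m) set \<Rightarrow> 'i \<Rightarrow> bool" where
  "dominates I C u U k \<longleftrightarrow> k \<in> I \<and> (\<forall>l\<in>I. \<forall>z\<in>U. norm (u l z) \<le> C * norm (u k z))"

lemma dominatesD:
  "dominates I C u U k \<Longrightarrow> l \<in> I \<Longrightarrow> z \<in> U \<Longrightarrow> norm (u l z) \<le> C * norm (u k z)"
  unfolding dominates_def by blast

lemma dominates_mono:
  assumes "dominates I C u U k" "C \<le> C'" "V \<subseteq> U"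
  shows "dominates I C' u V k"
  using assms mult_right_mono[OF assms(2) norm_ge_zero] unfolding dominates_def
  by (meson order_trans subsetD)

text \<open>
  The speed \<open>s\<close> lies strictly between \<open>norm v\<close> and \<open>r / c\<close>; being positive, it covers \<open>v = 0\<close> as well.
\<close>

lemma complex_line_in_ball:
  fixes a v :: "complex^'m"
  assumes c: "0 < c" and v: "c * norm v < r"
  obtains R where "c < R" "\<And>t. norm t < R \<Longrightarrow> a + t *s v \<in> ball a r"
proof -
  have r: "0 < r" using v c norm_ge_zero[of v] by (meson le_less_trans mult_nonneg_nonneg less_imp_le)
  define s where "s = (norm v + r / c) / 2"
  have vr: "norm v < r / c" using v c by (simp add: field_simps)
  have "0 < s" unfolding s_def using r c by (intro divide_pos_pos add_nonneg_pos) auto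
  moreover have "x < (x + y) / 2" "(x + y) / 2 < y" if "x < y" for x y :: real using that by simp_all
  note this[OF vr, folded s_def]
  ultimately have s: "0 < s" "norm v < s" "s < r / c" .
  show ?thesis
  proof (rule that[of "r / s"])
    show "c < r / s" using s c by (simp add: field_simps)
    fix t :: complex assume t: "norm t < r / s"
    have "norm t * norm v \<le> norm t * s" using s by (intro mult_left_mono) auto
    also have "\<dots> < r" using t s by (simp add: field_simps)
    finally have "norm (t *s v) < r" by (simp only: norm_vector_smult)
    moreover have "dist a (a + x) = norm x" for x by (simp add: dist_norm)
    ultimately show "a + t *s v \<in> ball a r" unfolding mem_ball by (simp only:)
  qed
qed

text \<open>
  Restrict to the complex line through \<open>a\<close> and \<open>z\<close> and take logarithms there.
\<close>

lemma units_ratio_bound: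
  fixes I :: "'i set"
  assumes I: "finite I" "card I = 2 * n + 1" and C: "1 \<le> C"
  obtains K where "1 \<le> K"
    "\<And>(u :: 'i \<Rightarrow> complex^'m \<Rightarrow> complex) a r k. 0 < r \<Longrightarrow> unit_system I n C (ball a r) u \<Longrightarrow>
      dominates I C u {a} k \<Longrightarrow> dominates I K u (ball a (r/4)) k"
proof -
  have lnC: "0 \<le> ln C" using C by simp
  obtain K where K: "\<And>\<phi> k a r. balanced I n (ln C) (ball a r) \<phi> \<Longrightarrow> 0 < r \<Longrightarrow>
      dominant I (ln C) \<phi> {a} k \<Longrightarrow> dominant I K \<phi> (ball a (r/4)) k"
    using gap_bound[OF I lnC] by blast
  show ?thesis
  proof (rule that[of "exp \<bar>K\<bar>"])
    fix u :: "'i \<Rightarrow> complex^'m \<Rightarrow> complex" and a r k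
    assume r: "0 < r" and sys: "unit_system I n C (ball a r) u" and dom: "dominates I C u {a} k"
    have k: "k \<in> I" using dom unfolding dominates_def by blast
    show "dominates I (exp \<bar>K\<bar>) u (ball a (r/4)) k"
      unfolding dominates_def
    proof (intro conjI ballI k)
      fix l z assume l: "l \<in> I" and z: "z \<in> ball a (r/4)"
      have hol: "\<And>i. i \<in> I \<Longrightarrow> holo_on (u i) (ball a r)"
        and nz: "\<And>i z. i \<in> I \<Longrightarrow> z \<in> ball a r \<Longrightarrow> u i z \<noteq> 0"
        and gp: "\<And>z l J. z \<in> ball a r \<Longrightarrow> l \<in> I \<Longrightarrow> J \<subseteq> I \<Longrightarrow> card J = Suc n \<Longrightarrow> \<exists>k\<in>J. norm (u l z) \<le> C * norm (u k z)"
        using sys unfolding unit_system_def by blast+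
      define L where "L t = a + t *s (z - a)" for t
      have "4 * norm (z - a) < r" using z by (simp add: dist_norm norm_minus_commute)
      then obtain R where R4: "4 < R" and LR: "\<And>t. norm t < R \<Longrightarrow> L t \<in> ball a r"
        using complex_line_in_ball[of 4 "z - a" r a] unfolding L_def by auto
      have R: "0 < R" "4 < R" using R4 by auto
      have inb: "L t \<in> ball a r" if "t \<in> ball 0 R" for t using LR that by simp
      have holL: "(\<lambda>t. u i (L t)) holomorphic_on ball 0 R" if "i \<in> I" for i
        unfolding L_def by (rule holo_on_line[OF hol[OF that]]) (use inb in \<open>simp add: L_def\<close>)
      have "\<exists>\<psi>. \<psi> holomorphic_on ball 0 R \<and> (\<forall>t\<in>ball 0 R. exp (\<psi> t) = u i (L t))" if "i \<in> I" for i
      proof -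
        have nzL: "u i (L t) \<noteq> 0" if "t \<in> ball 0 R" for t by (rule nz[OF \<open>i \<in> I\<close> inb[OF that]])
        have "0 \<in> ball (0::complex) R" using R by simp
        with holomorphic_logarithm_exists[OF convex_ball open_ball holL[OF that] nzL]
        obtain g where "g holomorphic_on ball 0 R" "\<And>t. t \<in> ball 0 R \<Longrightarrow> exp (g t) = u i (L t)" by (metis (no_types, lifting))
        then show ?thesis by blast
      qed
      then obtain \<psi> where \<psi>: "\<And>i. i \<in> I \<Longrightarrow> \<psi> i holomorphic_on ball 0 R"
        "\<And>i t. i \<in> I \<Longrightarrow> t \<in> ball 0 R \<Longrightarrow> exp (\<psi> i t) = u i (L t)" by metis
      have Re: "norm (u i (L t)) = exp (Re (\<psi> i t))" if "i \<in> I" "t \<in> ball 0 R" for i t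
        using \<psi>(2)[OF that] norm_exp_eq_Re by metis
      have le_iff: "norm (u i (L t)) \<le> C * norm (u j (L t)) \<longleftrightarrow> Re (\<psi> i t) \<le> Re (\<psi> j t) + ln C"
        if "i \<in> I" "j \<in> I" "t \<in> ball 0 R" for i j t
      proof -
        have "C * norm (u j (L t)) = exp (Re (\<psi> j t) + ln C)"
          using C Re[OF that(2,3)] by (simp add: exp_add)
        then show ?thesis using Re[OF that(1,3)] by simp
      qed
      have bal: "balanced I n (ln C) (ball 0 R) \<psi>"
        unfolding balanced_def
      proof (intro conjI ballI allI impI)
        fix t :: complex and i J assume t: "t \<in> ball 0 R" and i: "i \<in> I" and J: "J \<subseteq> I" "card J = Suc n"
        obtain q where "q \<in> J" "norm (u i (L t)) \<le> C * norm (u q (L t))" using gp[OF inb[OF t] i J] by blast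
        then show "\<exists>k\<in>J. Re (\<psi> i t) \<le> Re (\<psi> k t) + ln C" using le_iff[OF i _ t] J by blast
      qed (rule \<psi>(1))
      have "0 \<in> ball 0 R" "L 0 = a" using R by (auto simp: L_def)
      then have "dominant I (ln C) \<psi> {0} k"
        unfolding dominant_def using k dominatesD[OF dom] le_iff[of _ k 0] by auto
      then have "Re (\<psi> l 1) \<le> Re (\<psi> k 1) + K"
        using dominantD[OF K[OF bal R(1)] l, of k 1] R by simp
      moreover have 1: "(1::complex) \<in> ball 0 R" "L 1 = z" using R by (auto simp: L_def)
      ultimately have "Re (\<psi> l 1) \<le> Re (\<psi> k 1) + \<bar>K\<bar>" by simp
      then have "exp (Re (\<psi> l 1)) \<le> exp \<bar>K\<bar> * exp (Re (\<psi> k 1))" by (simp add: exp_add[symmetric] add.commute)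
      then show "norm (u l z) \<le> exp \<bar>K\<bar> * norm (u k z)" using Re[OF l 1(1)] Re[OF k 1(1)] 1(2) by simp
    qed
  qed simp
qed

text \<open>
  An index that dominates at the first centre up to \<open>C\<close> dominates at the next ones up to constants that
  grow with each step but are uniform in the functions and the centres.
\<close>

lemma chain_ratio_bound:
  fixes I :: "'i set"
  assumes I: "finite I" "card I = 2 * n + 1" and C: "1 \<le> C"
  shows "\<exists>K\<ge>1. \<forall>(u :: 'i \<Rightarrow> complex^'m \<Rightarrow> complex) x \<delta> k. 0 < \<delta> \<longrightarrow>
      (\<forall>i<N. dist (x i) (x (Suc i)) < \<delta>/4) \<longrightarrow> (\<forall>i\<le>N. unit_system I n C (ball (x i) \<delta>) u) \<longrightarrow>
      dominates I C u {x 0} k \<longrightarrow> dominates I K u (ball (x N) (\<delta>/4)) k"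
proof (induction N)
  case 0
  obtain K where K: "1 \<le> K"
    "\<And>(u :: 'i \<Rightarrow> complex^'m \<Rightarrow> complex) a r k. 0 < r \<Longrightarrow> unit_system I n C (ball a r) u \<Longrightarrow>
      dominates I C u {a} k \<Longrightarrow> dominates I K u (ball a (r/4)) k"
    using units_ratio_bound[OF I C] by blast
  show ?case by (intro exI[of _ K] conjI K(1) allI impI, rule K(2)) auto
next
  case (Suc N)
  then obtain K1 where K1: "1 \<le> K1"
    "\<And>(u :: 'i \<Rightarrow> complex^'m \<Rightarrow> complex) x \<delta> k. 0 < \<delta> \<Longrightarrow>
      \<forall>i<N. dist (x i) (x (Suc i)) < \<delta>/4 \<Longrightarrow> \<forall>i\<le>N. unit_system I n C (ball (x i) \<delta>) u \<Longrightarrow>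
      dominates I C u {x 0} k \<Longrightarrow> dominates I K1 u (ball (x N) (\<delta>/4)) k"
    by blast
  define C' where "C' = max C K1"
  have C': "1 \<le> C'" "C \<le> C'" "K1 \<le> C'" unfolding C'_def using C by auto
  obtain K where K: "1 \<le> K"
    "\<And>(u :: 'i \<Rightarrow> complex^'m \<Rightarrow> complex) a r k. 0 < r \<Longrightarrow> unit_system I n C' (ball a r) u \<Longrightarrow>
      dominates I C' u {a} k \<Longrightarrow> dominates I K u (ball a (r/4)) k"
    using units_ratio_bound[OF I C'(1)] by blast
  show ?case
  proof (intro exI[of _ K] conjI K(1) allI impI)
    fix u :: "'i \<Rightarrow> complex^'m \<Rightarrow> complex" and x \<delta> k
    assume \<delta>: "0 < \<delta>" and d: "\<forall>i<Suc N. dist (x i) (x (Suc i)) < \<delta>/4"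
      and sys: "\<forall>i\<le>Suc N. unit_system I n C (ball (x i) \<delta>) u" and dom: "dominates I C u {x 0} k"
    have "dominates I K1 u (ball (x N) (\<delta>/4)) k" 
      by (rule K1(2)[where x = x and \<delta> = \<delta> and u = u]) (use \<delta> dom d sys in auto)
    then have "dominates I C' u {x (Suc N)} k" by (rule dominates_mono[OF _ C'(3)]) (use d in auto)
    moreover have "unit_system I n C' (ball (x (Suc N)) \<delta>) u"
      by (rule unit_system_mono[OF _ C'(2)]) (use sys in blast)
    ultimately show "dominates I K u (ball (x (Suc N)) (\<delta>/4)) k" by (intro K(2)[OF \<delta>])
  qed
qed

text \<open>
  The first clause makes it possible to normalise by a form with index in \<open>K\<close>, the second gives a bound
  near the circle of radius \<open>\<rho>\<close> in the direction \<open>e\<close>, and the third leaves room for the translated discs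
  on which the maximum principle extends this bound to points near \<open>a\<close>.
\<close>

definition omits_around_disc where
  "omits_around_disc f I K \<alpha> a e \<rho> \<delta> R \<longleftrightarrow>
     (\<forall>k\<in>K. \<forall>z\<in>ball a R. omits_at f (hyperplane (\<alpha> k)) z) \<and>
     (\<forall>k\<in>I. \<forall>t y. norm t = \<rho> \<longrightarrow> norm y < \<delta> \<longrightarrow> omits_at f (hyperplane (\<alpha> k)) (a + t *s e + y)) \<and>
     (\<forall>t y. norm t \<le> \<rho> \<longrightarrow> norm y < \<delta> \<longrightarrow> a + t *s e + y \<in> ball a R)"

text \<open>
  Choose \<open>k\<close> in \<open>K\<close> dominating at one point of the circle and normalise by it. Along a chain of balls
  around the circle the other linear forms stay bounded by the constant form \<open>1\<close>, hence so does the
  representation. It is holomorphic on the whole ball, so the maximum principle on translated discs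
  bounds it near \<open>a\<close>. The constant is uniform in the mapping and the hyperplanes.
\<close>

lemma bounded_normalised_reps:
  fixes a e :: "complex^'m" and I :: "nat set"
  assumes n: "CARD('k::finite) = Suc n" and I: "finite I" "card I = 2 * n + 1" and C: "1 \<le> C"
    and \<rho>: "0 < \<rho>" and \<delta>: "0 < \<delta>"
  obtains B where "\<And>D (f :: complex^'m \<rightharpoonup> 'k cproj) \<alpha> K R.
      meromorphic_map D f \<Longrightarrow> ball a R \<subseteq> D \<Longrightarrow> K \<subseteq> I \<Longrightarrow> Suc n \<le> card K \<Longrightarrow>
      omits_around_disc f I K \<alpha> a e \<rho> \<delta> R \<Longrightarrow>
      quantitative_general_position I C \<alpha> \<Longrightarrow>
      \<exists>k\<in>K. \<exists>F. admissible_rep D f (ball a R) F \<and> (\<forall>z\<in>ball a R. pairing (\<alpha> k) (F z) = 1) \<and>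
        (\<forall>z\<in>ball a (\<delta>/8). norm (F z) \<le> B)"
proof -
  \<comment> \<open>The circle is cut into \<open>M\<close> arcs so short that consecutive division points are less than \<open>\<delta>/8\<close> apart.\<close>
  define \<Gamma> where "\<Gamma> s = a + (of_real \<rho> * cis (2 * pi * s)) *s e" for s
  have "continuous_on {0..1} (\<lambda>s. of_real \<rho> * cis (2 * pi * s))"
    by (intro continuous_intros)
  then have "continuous_on {0..1} ((\<lambda>t. t *s e) \<circ> (\<lambda>s. of_real \<rho> * cis (2 * pi * s)))"
    by (rule continuous_on_compose)
       (intro linear_continuous_on linear_smult_left[THEN linear_conv_bounded_linear[THEN iffD1]])
  then have "continuous_on {0..1} \<Gamma>" unfolding \<Gamma>_def o_def by (intro continuous_intros)
  then have "uniformly_continuous_on {0..1} \<Gamma>" by (rule compact_uniformly_continuous) simp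
  then obtain \<eta> where \<eta>: "0 < \<eta>" "\<And>s s'. s \<in> {0..1} \<Longrightarrow> s' \<in> {0..1} \<Longrightarrow> dist s' s < \<eta> \<Longrightarrow> dist (\<Gamma> s') (\<Gamma> s) < \<delta>/8"
    unfolding uniformly_continuous_on_def using \<delta> by (metis divide_pos_pos zero_less_numeral)
  obtain N where N: "inverse (real (Suc N)) < \<eta>" using reals_Archimedean[OF \<eta>(1)] by blast
  define M where "M = Suc N"
  define x where "x i = \<Gamma> (real i / real M)" for i
  have M: "0 < real M" "1 / real M < \<eta>" using N by (auto simp: M_def inverse_eq_divide)
  have xd: "dist (x i) (x (Suc i)) < \<delta>/8" if "i < M" for i
    unfolding x_def
  proof (rule \<eta>(2))
    have "dist (real i / real M) (real (Suc i) / real M) = 1 / real M"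
      using M by (simp add: dist_real_def field_simps)
    then show "dist (real i / real M) (real (Suc i) / real M) < \<eta>" using M by simp
  qed (use that in \<open>auto simp: field_simps\<close>)
  have near: "\<exists>i\<le>M. dist (a + t *s e) (x i) < \<delta>/8" if t: "norm t = \<rho>" for t
  proof -
    define s where "s = Arg2pi t / (2 * pi)"
    have s: "0 \<le> s" "s < 1" unfolding s_def using Arg2pi_ge_0 Arg2pi_lt_2pi by auto
    have "t = of_real \<rho> * cis (2 * pi * s)"
      using complex_norm_eq_1_exp Arg2pi_eq[of t] t by (simp add: s_def cis_conv_exp mult.commute)
    then have ts: "a + t *s e = \<Gamma> s" by (simp add: \<Gamma>_def)
    define i where "i = nat \<lfloor>s * real M\<rfloor>"
    have i: "real i \<le> s * real M" "s * real M < real i + 1"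
      unfolding i_def using s M by (auto simp: of_nat_nat)
    have "s * real M \<le> real M" using s M by simp
    then have iM: "i \<le> M" using i by linarith
    have "dist s (real i / real M) < \<eta>"
    proof -
      have "real i / real M \<le> s" "s < real i / real M + 1 / real M" using i M by (simp_all add: field_simps)
      then show ?thesis using M(2) unfolding dist_real_def by linarith
    qed
    then have "dist (\<Gamma> s) (x i) < \<delta>/8"
      unfolding x_def by (intro \<eta>(2)) (use s iM M in auto)
    then show ?thesis using iM ts by auto
  qed
  have xt: "\<exists>t. norm t = \<rho> \<and> x i = a + t *s e" for i
    unfolding x_def \<Gamma>_def using \<rho> by (intro exI[of _ "of_real \<rho> * cis (2 * pi * (real i / real M))"]) (simp add: norm_mult)
  from choice[OF allI[OF chain_ratio_bound[OF I C]]] obtain Kc where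
    Kc: "\<forall>N. 1 \<le> Kc N \<and> (\<forall>(u :: nat \<Rightarrow> complex^'m \<Rightarrow> complex) x \<delta> k. 0 < \<delta> \<longrightarrow>
      (\<forall>i<N. dist (x i) (x (Suc i)) < \<delta>/4) \<longrightarrow> (\<forall>i\<le>N. unit_system I n C (ball (x i) \<delta>) u) \<longrightarrow>
      dominates I C u {x 0} k \<longrightarrow> dominates I (Kc N) u (ball (x N) (\<delta>/4)) k)" ..
  note chain = conjunct2[OF spec[OF Kc], THEN spec, THEN spec, THEN spec, THEN spec, THEN mp, THEN mp, THEN mp, THEN mp]
  define KM where "KM = Max (Kc ` {..M})"
  have KM: "Kc i \<le> KM" if "i \<le> M" for i unfolding KM_def using that by (intro Max_ge) auto
  show ?thesis
  proof (rule that[of "real CARD('k) * (C * KM)"])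
    fix D and f :: "complex^'m \<rightharpoonup> 'k cproj" and \<alpha> K R
    assume f: "meromorphic_map D f" and RD: "ball a R \<subseteq> D" and K: "K \<subseteq> I" "Suc n \<le> card K"
      and om_all: "omits_around_disc f I K \<alpha> a e \<rho> \<delta> R"
      and qgp: "quantitative_general_position I C \<alpha>"
    have omK: "\<And>k z. k \<in> K \<Longrightarrow> z \<in> ball a R \<Longrightarrow> omits_at f (hyperplane (\<alpha> k)) z"
      and om: "\<And>k t y. k \<in> I \<Longrightarrow> norm t = \<rho> \<Longrightarrow> norm y < \<delta> \<Longrightarrow> omits_at f (hyperplane (\<alpha> k)) (a + t *s e + y)"
      and inR: "\<And>t y. norm t \<le> \<rho> \<Longrightarrow> norm y < \<delta> \<Longrightarrow> a + t *s e + y \<in> ball a R"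
      using om_all unfolding omits_around_disc_def by blast+
    have gp: "\<And>J v. J \<subseteq> I \<Longrightarrow> card J = Suc n \<Longrightarrow> \<exists>k\<in>J. norm v \<le> C * norm (pairing (\<alpha> k) v) \<and>
         (\<forall>l\<in>I. norm (pairing (\<alpha> l) v) \<le> C * norm (pairing (\<alpha> k) v))"
      using qgp n unfolding quantitative_general_position_def by simp
    obtain J where J: "J \<subseteq> K" "card J = Suc n" using obtain_subset_with_card_n[OF K(2)] by metis
    have x0R: "x i \<in> ball a R" for i using xt[of i] inR[of _ 0] \<delta> by auto
    obtain k0 where k0: "k0 \<in> J" using J by fastforce
    then obtain p where p: "f (x 0) = Some p" using omK x0R J unfolding omits_at_def by blast
    obtain v0 where v0: "v0 \<noteq> 0" "p = proj v0" using proj_surj by blast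
    obtain k where k: "k \<in> J" "\<And>l. l \<in> I \<Longrightarrow> norm (pairing (\<alpha> l) v0) \<le> C * norm (pairing (\<alpha> k) v0)"
      using gp[of J v0] J K by blast
    have kK: "k \<in> K" "k \<in> I" using k J K by auto
    obtain F where F: "admissible_rep D f (ball a R) F" "\<And>z. z \<in> ball a R \<Longrightarrow> pairing (\<alpha> k) (F z) = 1"
      using exists_normalised_rep[OF f open_ball RD omK[OF kK(1)]] by blast
    have holF: "holo_vec_on F (ball a R)" using F(1) unfolding admissible_rep_def by blast
    define u where "u l z = pairing (\<alpha> l) (F z)" for l z
    have ball_sub: "\<exists>t. norm t = \<rho> \<and> norm (z - x i) < \<delta> \<and> z = a + t *s e + (z - x i)" if "z \<in> ball (x i) \<delta>" for z i
    proof -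
      obtain t where t: "norm t = \<rho>" "x i = a + t *s e" using xt by blast
      then have "z = a + t *s e + (z - x i)" by simp
      then show ?thesis using t that by (auto simp: dist_norm norm_minus_commute)
    qed
    have inR': "z \<in> ball a R" if "z \<in> ball (x i) \<delta>" for z i
      using ball_sub[OF that] inR[of _ "z - x i"] by (metis order_refl)
    have sys: "unit_system I n C (ball (x i) \<delta>) u" for i
      unfolding unit_system_def
    proof (intro conjI ballI allI impI)
      fix l assume l: "l \<in> I"
      show "holo_on (u l) (ball (x i) \<delta>)"
        unfolding u_def using holo_on_subset[OF holo_on_pairing[OF holF]] inR' by blast
      fix z assume z: "z \<in> ball (x i) \<delta>"
      have "omits_at f (hyperplane (\<alpha> l)) z" using ball_sub[OF z] om[OF l] by metis
      then show "u l z \<noteq> 0" unfolding u_def admissible_rep_pairing_nonzero_iff[OF F(1) inR'[OF z]] .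
    next
      fix z l J' assume "l \<in> I" "J' \<subseteq> I" "card J' = Suc n"
      then show "\<exists>k\<in>J'. norm (u l z) \<le> C * norm (u k z)" unfolding u_def using gp[of J' "F z"] by blast
    qed
    have dom: "dominates I C u {x 0} k"
    proof -
      have F0: "F (x 0) \<noteq> 0" using F(2)[OF x0R, of 0] by auto
      then have "f (x 0) = Some (proj (F (x 0)))" using F(1) x0R unfolding admissible_rep_def by auto
      then have "proj v0 = proj (F (x 0))" using p v0 by simp
      then obtain c where c: "F (x 0) = c *s v0" using proj_eq_iff[OF v0(1) F0] by blast
      show ?thesis
        unfolding dominates_def u_def using kK(2) mult_left_mono[OF k(2) norm_ge_zero[of c]]
        by (simp add: c pairing_smult_right norm_mult mult.left_commute)
    qed
    \<comment> \<open>Here the normalisation of the form \<open>k\<close> to \<open>1\<close> is used.\<close>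
    have tube: "norm (F z) \<le> C * KM" if z: "z \<in> ball (x i) (\<delta>/4)" and i: "i \<le> M" for z i
    proof -
      have zR: "z \<in> ball a R"
        by (rule inR'[of z i]) (use z subset_ball[of "\<delta>/4" \<delta> "x i"] \<delta> in auto)
      obtain l where l: "l \<in> J" "norm (F z) \<le> C * norm (u l z)" unfolding u_def using gp[of J "F z"] J K by blast
      then have lI: "l \<in> I" using J K by blast
      have d4: "\<forall>i'<i. dist (x i') (x (Suc i')) < \<delta>/4" proof (intro allI impI)
        fix i' assume "i' < i"
        then have "dist (x i') (x (Suc i')) < \<delta>/8" using xd i by simp
        then show "dist (x i') (x (Suc i')) < \<delta>/4" using \<delta> by simp
      qed
      have "dominates I (Kc i) u (ball (x i) (\<delta>/4)) k"
        by (rule chain) (use \<delta> d4 sys dom in auto)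
      from dominatesD[OF this lI z] have "norm (u l z) \<le> Kc i * norm (u k z)" .
      also have "norm (u k z) = 1" unfolding u_def using F(2)[OF zR] by simp
      finally have "norm (u l z) \<le> KM" using KM[OF i] by simp
      then have "C * norm (u l z) \<le> C * KM" using C by (intro mult_left_mono) auto
      then show ?thesis using l(2) by linarith
    qed
    have "norm (F z) \<le> real CARD('k) * (C * KM)" if z: "z \<in> ball a (\<delta>/8)" for z
    proof -
      define y where "y = z - a"
      have y: "norm y < \<delta>/8" using z by (simp add: y_def dist_norm norm_minus_commute)
      have zt: "z + t *s e = a + t *s e + y" for t by (simp add: y_def)
      have "norm (F z $ l) \<le> C * KM" for l
      proof (rule holo_on_center_le_circle[where h = "\<lambda>z. F z $ l" and U = "ball a R" and b = e, OF _ \<rho>])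
        show "holo_on (\<lambda>z. F z $ l) (ball a R)" using holF unfolding holo_vec_on_def by blast
        show "z + t *s e \<in> ball a R" if "norm t \<le> \<rho>" for t
          unfolding zt by (rule inR[OF that]) (use y \<delta> in simp)
        fix t :: complex assume t: "norm t = \<rho>"
        obtain i where i: "i \<le> M" "dist (a + t *s e) (x i) < \<delta>/8" using near[OF t] by blast
        have "dist (z + t *s e) (a + t *s e) < \<delta>/8" unfolding zt using y by (simp add: dist_norm)
        then have "dist (x i) (z + t *s e) < \<delta>/8 + \<delta>/8"
          using i(2) dist_triangle2[of "x i" "z + t *s e" "a + t *s e"] by (simp add: dist_commute)
        then have "norm (F (z + t *s e)) \<le> C * KM" by (intro tube[OF _ i(1)]) simp
        then show "norm (F (z + t *s e) $ l) \<le> C * KM" using norm_component_le order_trans by blast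
      qed
      then have "(\<Sum>l\<in>UNIV. norm (F z $ l)) \<le> (\<Sum>l\<in>(UNIV::'k set). C * KM)" by (rule sum_mono)
      then show ?thesis using norm_vec_le_sum[of "F z"] by simp
    qed
    then show "\<exists>k\<in>K. \<exists>F. admissible_rep D f (ball a R) F \<and> (\<forall>z\<in>ball a R. pairing (\<alpha> k) (F z) = 1) \<and>
        (\<forall>z\<in>ball a (\<delta>/8). norm (F z) \<le> real CARD('k) * (C * KM))"
      using kK F by blast
  qed
qed

section \<open>Uniform bounds near a limit of holomorphic mappings\<close>

text \<open>
  On the compact set \<open>K\<close> the ratio of the linear form to the norm is bounded below; the points of
  projective space where it exceeds half of this bound form the neighbourhood.
\<close>

lemma hyperplane_avoiding_neighbourhood:
  fixes G :: "complex^'m \<Rightarrow> complex^'k::finite"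
  assumes G: "continuous_on U G" and K: "compact K" "K \<subseteq> U"
    and nz: "\<And>z. z \<in> K \<Longrightarrow> pairing \<beta> (G z) \<noteq> 0" and g: "\<And>z. z \<in> K \<Longrightarrow> g z = proj (G z)"
  shows "\<exists>W \<epsilon>. open W \<and> 0 < \<epsilon> \<and> g ` K \<subseteq> W \<and> (\<forall>\<alpha>. norm (\<alpha> - \<beta>) < \<epsilon> \<longrightarrow> W \<inter> hyperplane \<alpha> = {})"
proof -
  have Gnz: "G z \<noteq> 0" if "z \<in> K" for z using nz[OF that] by auto
  have GK: "continuous_on K G" using G K continuous_on_subset by blast
  obtain m where m: "0 < m" "\<And>z. z \<in> K \<Longrightarrow> m * norm (G z) < norm (pairing \<beta> (G z))"
  proof (cases "K = {}")
    case True
    then show ?thesis using that[of 1] by simp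
  next
    case False
    let ?q = "\<lambda>z. norm (pairing \<beta> (G z)) / norm (G z)"
    have "continuous_on K ?q"
      using Gnz by (intro continuous_intros continuous_on_pairing GK) auto
    then obtain w where w: "w \<in> K" "\<And>z. z \<in> K \<Longrightarrow> ?q w \<le> ?q z"
      using continuous_attains_inf[OF K(1) False] by blast
    have qw: "0 < ?q w" using nz[OF w(1)] Gnz[OF w(1)] by simp
    show ?thesis
    proof (rule that[of "?q w / 2"])
      show "0 < ?q w / 2" using qw by simp
      fix z assume z: "z \<in> K"
      have "x / 2 < y" if "0 < x" "x \<le> y" for x y :: real using that by simp
      from this[OF qw w(2)[OF z]] have "?q w / 2 < ?q z" .
      then show "?q w / 2 * norm (G z) < norm (pairing \<beta> (G z))" using Gnz[OF z] by (simp add: field_simps)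
    qed
  qed
  define S where "S = {v. m * norm v < norm (pairing \<beta> v)}"
  define W where "W = proj ` S"
  have S_scale: "c *s v \<in> S" if "v \<in> S" "c \<noteq> 0" for c v
    using that unfolding S_def by (simp add: pairing_smult_right norm_mult norm_vector_smult mult.left_commute)
  have S0: "v \<noteq> 0" if "v \<in> S" for v using that unfolding S_def by auto
  have W_iff: "proj v \<in> W \<longleftrightarrow> v \<in> S" if v: "v \<noteq> 0" for v
  proof
    assume "proj v \<in> W"
    then obtain w where w: "w \<in> S" "proj w = proj v" unfolding W_def by auto
    then obtain c where c: "v = c *s w" using proj_eq_iff[OF S0[OF w(1)] v] by blast
    then have "c \<noteq> 0" using v by auto
    then show "v \<in> S" using c S_scale[OF w(1)] by simp
  qed (auto simp: W_def)
  have "{v. v \<noteq> 0 \<and> proj v \<in> W} = S" using W_iff S0 by auto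
  moreover have "open S"
    unfolding S_def by (intro open_Collect_less continuous_intros continuous_on_pairing)
  ultimately have oW: "open W" unfolding open_cproj_def by simp
  define N where "N = real CARD('k)"
  have N: "0 < N" unfolding N_def by simp
  have "W \<inter> hyperplane \<alpha> = {}" if \<alpha>: "norm (\<alpha> - \<beta>) < m / N" for \<alpha>
  proof -
    have "proj v \<notin> hyperplane \<alpha>" if v: "v \<in> S" for v
    proof -
      have "norm (pairing (\<alpha> - \<beta>) v) \<le> N * norm (\<alpha> - \<beta>) * norm v"
        unfolding N_def by (rule norm_pairing_le)
      also have "\<dots> \<le> N * (m / N) * norm v" using \<alpha> N by (intro mult_right_mono mult_left_mono) auto
      also have "\<dots> = m * norm v" using N by simp
      also have "\<dots> < norm (pairing \<beta> v)" using v unfolding S_def by simp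
      finally have "pairing \<alpha> v \<noteq> 0" unfolding pairing_diff_left by (auto simp: norm_minus_commute)
      then show ?thesis using proj_in_hyperplane_pairing[OF S0[OF v]] by blast
    qed
    then show ?thesis unfolding W_def by auto
  qed
  moreover have "g ` K \<subseteq> W" unfolding W_def S_def using g m(2) by auto
  ultimately show ?thesis using oW m(1) N by (intro exI[of _ W] exI[of _ "m / N"]) auto
qed

lemma openin_Hol_topology:
  assumes "compact K" "K \<subseteq> D" "open W"
  shows "openin (Hol_topology D) {h \<in> Hol D. h ` K \<subseteq> W}"
proof -
  have "openin (topology_generated_by {{g. g ` K \<subseteq> W} | K W. compact K \<and> K \<subseteq> D \<and> open W}) {h. h ` K \<subseteq> W}"
    by (rule topology_generated_by_Basis) (use assms in blast)
  then have "openin (Hol_topology D) ({h. h ` K \<subseteq> W} \<inter> Hol D)"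
    unfolding Hol_topology_def by (rule openin_subtopology_Int)
  moreover have "{h. h ` K \<subseteq> W} \<inter> Hol D = {h \<in> Hol D. h ` K \<subseteq> W}" by blast
  ultimately show ?thesis by simp
qed

text \<open>
  The zeros on the complex line are isolated because the function is not zero at \<open>t = 1\<close>.
\<close>

lemma holo_on_nonzero_on_punctured_disc:
  assumes s: "holo_on s (ball a R)" and R: "norm e < R" and nz: "s (a + e) \<noteq> 0"
  shows "\<exists>\<rho>>0. \<forall>t. 0 < norm t \<and> norm t < \<rho> \<longrightarrow> s (a + t *s e) \<noteq> 0"
proof -
  obtain r where r1: "1 < r" and inb: "\<And>t. norm t < r \<Longrightarrow> a + t *s e \<in> ball a R"
    using complex_line_in_ball[of 1 e R a] R by auto
  let ?f = "\<lambda>t. s (a + t *s e)"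
  have hol: "?f holomorphic_on ball 0 r" by (rule holo_on_line[OF s]) (use inb in auto)
  show ?thesis
  proof (cases "?f 0 = 0")
    case True
    obtain \<rho> where \<rho>: "0 < \<rho>" "\<And>t. t \<in> ball 0 \<rho> - {0} \<Longrightarrow> ?f t \<noteq> 0"
      by (rule isolated_zeros[OF hol open_ball _ _ True, of 1]) (use r1 nz in auto)
    then show ?thesis by (intro exI[of _ \<rho>]) auto
  next
    case False
    have "open (ball 0 r \<inter> ?f -` (- {0}))"
      by (rule continuous_open_preimage[OF holomorphic_on_imp_continuous_on[OF hol]]) auto
    moreover have "0 \<in> ball 0 r \<inter> ?f -` (- {0})" using False r1 by simp
    ultimately obtain \<rho> where "0 < \<rho>" "ball 0 \<rho> \<subseteq> ball 0 r \<inter> ?f -` (- {0})" using open_contains_ball by meson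
    then show ?thesis by (intro exI[of _ \<rho>]) auto
  qed
qed

text \<open>
  Each nonvanishing set is open and dense in \<open>U\<close>, so finitely many of them have a common point.
\<close>

lemma common_nonzero_point:
  assumes "finite I" and "\<And>k. k \<in> I \<Longrightarrow> continuous_on U (s k)" and "open U"
    and nz: "\<And>k V. k \<in> I \<Longrightarrow> open V \<Longrightarrow> V \<noteq> {} \<Longrightarrow> V \<subseteq> U \<Longrightarrow> \<exists>w\<in>V. s k w \<noteq> (0::complex)"
    and "U \<noteq> {}"
  shows "\<exists>p\<in>U. \<forall>k\<in>I. s k p \<noteq> 0"
proof -
  have "\<exists>V. open V \<and> V \<noteq> {} \<and> V \<subseteq> U \<and> (\<forall>p\<in>V. \<forall>k\<in>I. s k p \<noteq> 0)"
    using assms(1,2) nz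
  proof (induction I rule: finite_induct)
    case empty
    then show ?case using assms by (intro exI[of _ U]) auto
  next
    case (insert k I)
    have "\<exists>V. open V \<and> V \<noteq> {} \<and> V \<subseteq> U \<and> (\<forall>p\<in>V. \<forall>k\<in>I. s k p \<noteq> 0)"
      by (rule insert.IH) (use insert.prems in blast)+
    then obtain V where V: "open V" "V \<noteq> {}" "V \<subseteq> U" "\<forall>p\<in>V. \<forall>k\<in>I. s k p \<noteq> 0" by blast
    obtain w where w: "w \<in> V" "s k w \<noteq> 0" using insert.prems(2)[OF _ V(1-3), of k] by blast
    have "continuous_on V (s k)" using insert.prems(1)[of k] V continuous_on_subset by blast
    then have "open (V \<inter> s k -` (- {0}))" by (rule continuous_open_preimage[OF _ V(1)]) auto
    then show ?case using w V by (intro exI[of _ "V \<inter> s k -` (- {0})"]) auto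
  qed
  then show ?thesis by blast
qed

text \<open>
  The condition that the linear form be \<open>1\<close> prevents a limit of such representations from vanishing.
\<close>

definition has_bounded_normalised_rep where
  "has_bounded_normalised_rep D I \<alpha> B U f \<longleftrightarrow> (\<exists>k\<in>I. \<exists>F. admissible_rep D f U F \<and>
     (\<forall>z\<in>U. pairing (\<alpha> k) (F z) = 1 \<and> norm (F z) \<le> B))"

text \<open>
  A bound on a ball around \<open>a\<close> that holds for all meromorphic mappings attached to some \<open>g'\<close> in a
  neighbourhood \<open>NN\<close> of \<open>g\<close> and to hyperplanes with normals near \<open>\<beta>\<close>. As \<open>NN\<close> is
  chosen before any sequence, one cluster point \<open>g\<close> serves countably many points \<open>a\<close> at the same time.
\<close>

definition bounded_reps_near where
  "bounded_reps_near D I \<beta> g a \<delta> B NN \<epsilon> \<longleftrightarrow> 0 < \<delta> \<and> 0 < \<epsilon> \<and> openin (Hol_topology D) NN \<and> g \<in> NN \<and>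
     (\<forall>f g' \<alpha>. meromorphic_map D f \<longrightarrow> g' \<in> NN \<longrightarrow>
       (\<forall>k\<in>I. norm (\<alpha> k) = 1 \<and> norm (\<alpha> k - \<beta> k) < \<epsilon>) \<longrightarrow>
       (\<forall>k\<in>I. \<forall>z\<in>D. g' z \<notin> hyperplane (\<alpha> k) \<longrightarrow> omits_at f (hyperplane (\<alpha> k)) z) \<longrightarrow>
       has_bounded_normalised_rep D I \<alpha> B (ball a \<delta>) f)"

text \<open>
  At most \<open>n\<close> of the linear forms vanish at \<open>G a\<close>, where \<open>G\<close> represents \<open>g\<close>; the others, indexed by \<open>K\<close>,
  have no zeros on a ball. In the direction \<open>e\<close> of a point where no form vanishes, all of them are
  zero-free on small punctured discs, hence near small circles.
\<close>

lemma exists_bounded_reps_near: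
  fixes D :: "(complex^'m) set" and g :: "complex^'m \<Rightarrow> 'k::finite cproj" and \<beta> :: "nat \<Rightarrow> complex^'k"
  assumes n: "CARD('k) = Suc n" and I: "finite I" "card I = 2 * n + 1" and gp: "general_position I \<beta>"
    and D: "open D" "connected D" and g: "g \<in> Hol D"
    and nondeg: "\<And>k. k \<in> I \<Longrightarrow> \<not> g ` D \<subseteq> hyperplane (\<beta> k)" and a: "a \<in> D"
  shows "\<exists>\<delta> B NN \<epsilon>. bounded_reps_near D I \<beta> g a \<delta> B NN \<epsilon>"
proof -
  have charts: "\<exists>r G. 0 < r \<and> ball b r \<subseteq> D \<and> holo_vec_on G (ball b r) \<and> (\<forall>z\<in>ball b r. G z \<noteq> 0 \<and> g z = proj (G z))"
    if b: "b \<in> D" for b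
  proof -
    obtain U G where U: "open U" "b \<in> U" "U \<subseteq> D" "holo_vec_on G U" "\<forall>z\<in>U. G z \<noteq> 0 \<and> g z = proj (G z)"
      using g b unfolding Hol_def by blast
    obtain r where r: "r > 0" "ball b r \<subseteq> U" using U open_contains_ball by blast
    then show ?thesis using U holo_vec_on_subset by (intro exI[of _ r] exI[of _ G]) blast
  qed
  obtain R0 G where R0: "0 < R0" "ball a R0 \<subseteq> D" "holo_vec_on G (ball a R0)"
    and G: "\<And>z. z \<in> ball a R0 \<Longrightarrow> G z \<noteq> 0" "\<And>z. z \<in> ball a R0 \<Longrightarrow> g z = proj (G z)"
    using charts[OF a] by blast
  have contG: "continuous_on (ball a R0) G" by (rule holo_vec_on_imp_continuous_on[OF R0(3)])
  define s where "s k z = pairing (\<beta> k) (G z)" for k z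
  have hols: "holo_on (s k) (ball a R0)" for k unfolding s_def by (rule holo_on_pairing[OF R0(3)])
  have conts: "continuous_on (ball a R0) (s k)" for k by (rule holo_on_imp_continuous_on[OF hols])
  have nz: "\<exists>w\<in>V. s k w \<noteq> 0" if k: "k \<in> I" and V: "open V" "V \<noteq> {}" "V \<subseteq> ball a R0" for k V
  proof (rule ccontr)
    assume "\<not> ?thesis"
    then have V0: "V \<subseteq> {z. g z \<in> hyperplane (\<beta> k)}"
      using G V proj_in_hyperplane_pairing unfolding s_def by fastforce
    have "D \<subseteq> {z. g z \<in> hyperplane (\<beta> k)}"
    proof (rule zero_set_propagates[OF D _ V(1,2) _ V0])
      fix b assume "b \<in> D"
      then obtain r G where "0 < r" "ball b r \<subseteq> D" "holo_vec_on G (ball b r)" "\<forall>z\<in>ball b r. G z \<noteq> 0 \<and> g z = proj (G z)"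
        using charts by blast
      then show "\<exists>r h. 0 < r \<and> ball b r \<subseteq> D \<and> holo_on h (ball b r) \<and>
          (\<forall>z\<in>ball b r. z \<in> {z. g z \<in> hyperplane (\<beta> k)} \<longleftrightarrow> h z = 0)"
        using proj_in_hyperplane_pairing holo_on_pairing
        by (intro exI[of _ r] exI[of _ "\<lambda>z. pairing (\<beta> k) (G z)"]) auto
    qed (use V R0 in blast)
    then show False using nondeg[OF k] by blast
  qed
  obtain p where p: "p \<in> ball a R0" "\<And>k. k \<in> I \<Longrightarrow> s k p \<noteq> 0"
  proof -
    have "\<exists>p\<in>ball a R0. \<forall>k\<in>I. s k p \<noteq> 0"
      by (rule common_nonzero_point[OF I(1) conts open_ball nz]) (use R0(1) in auto)
    then show ?thesis using that by blast
  qed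
  define e where "e = p - a"
  have e: "norm e < R0" using p by (simp add: e_def dist_norm norm_minus_commute)
  have "\<exists>\<rho>>0. \<forall>t. 0 < norm t \<and> norm t < \<rho> \<longrightarrow> s k (a + t *s e) \<noteq> 0" if "k \<in> I" for k
    by (rule holo_on_nonzero_on_punctured_disc[OF hols e]) (use p that in \<open>simp add: e_def\<close>)
  then obtain \<rho>' where \<rho>': "\<And>k. k \<in> I \<Longrightarrow> 0 < \<rho>' k"
    "\<And>k t. k \<in> I \<Longrightarrow> 0 < norm t \<Longrightarrow> norm t < \<rho>' k \<Longrightarrow> s k (a + t *s e) \<noteq> 0" by metis
  define K where "K = {k\<in>I. s k a \<noteq> 0}"
  have K: "K \<subseteq> I" "finite K" unfolding K_def using I by auto
  have cardK: "Suc n \<le> card K"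
  proof (rule ccontr)
    assume "\<not> Suc n \<le> card K"
    moreover have "card (I - K) = card I - card K" by (rule card_Diff_subset[OF K(2,1)])
    ultimately have "Suc n \<le> card (I - K)" using I by linarith
    then obtain J where J: "J \<subseteq> I - K" "card J = Suc n" using obtain_subset_with_card_n by metis
    have "G a \<noteq> 0" using G R0 by simp
    then obtain k where "k \<in> J" "pairing (\<beta> k) (G a) \<noteq> 0"
      using gp J n unfolding general_position_def by (metis Diff_subset order_trans)
    then show False using J unfolding K_def s_def by blast
  qed
  have open_nz: "open {z \<in> ball a R0. \<forall>k\<in>J. s k z \<noteq> 0}" if "finite J" for J
  proof -
    define V where "V k = ball a R0 \<inter> s k -` (- {0})" for k
    have V: "open (V k)" for k unfolding V_def by (rule continuous_open_preimage[OF conts]) auto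
    have "{z \<in> ball a R0. \<forall>k\<in>J. s k z \<noteq> 0} = ball a R0 \<inter> (\<Inter>k\<in>J. V k)" unfolding V_def by auto
    moreover have "open (\<Inter>k\<in>J. V k)" using that V by (intro open_INT) auto
    ultimately show ?thesis by (simp add: open_Int)
  qed
  have "a \<in> {z \<in> ball a R0. \<forall>k\<in>K. s k z \<noteq> 0}" using R0 unfolding K_def by simp
  then obtain R where R: "0 < R" "cball a R \<subseteq> {z \<in> ball a R0. \<forall>k\<in>K. s k z \<noteq> 0}"
    using open_nz[OF K(2)] open_contains_cball by meson
  have cR0: "cball a R \<subseteq> ball a R0" using R(2) by blast
  define \<rho>0 where "\<rho>0 = Min (insert (R / (2 * (norm e + 1))) (\<rho>' ` I))"
  have ne: "0 < norm e + 1" using norm_ge_zero[of e] by linarith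
  have \<rho>0: "0 < \<rho>0" "\<rho>0 \<le> R / (2 * (norm e + 1))" "\<And>k. k \<in> I \<Longrightarrow> \<rho>0 \<le> \<rho>' k"
    unfolding \<rho>0_def using I \<rho>'(1) R(1) ne by (auto simp: Min_gr_iff)
  \<comment> \<open>Half of the bound, since the punctured discs are open and the circle must lie inside them.\<close>
  define \<rho> where "\<rho> = \<rho>0 / 2"
  have \<rho>: "0 < \<rho>" "\<And>k. k \<in> I \<Longrightarrow> \<rho> < \<rho>' k" using \<rho>0(1) \<rho>0(3) unfolding \<rho>_def by force+
  have \<rho>e: "\<rho> * norm e < R / 2"
  proof -
    have "\<rho> * norm e \<le> \<rho> * (norm e + 1)" using \<rho> by simp
    also have "\<dots> < \<rho>0 * (norm e + 1)" using \<rho>0(1) ne unfolding \<rho>_def by (intro mult_strict_right_mono) auto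
    also have "\<dots> \<le> R / (2 * (norm e + 1)) * (norm e + 1)" using \<rho>0(2) ne by (intro mult_right_mono) auto
    also have "\<dots> = R / 2"
    proof -
      have "R / (2 * x) * x = R / 2" if "0 < x" for x :: real using that by simp
      from this[OF ne] show ?thesis .
    qed
    finally show ?thesis .
  qed
  define \<Gamma> where "\<Gamma> = (\<lambda>t. a + t *s e) ` sphere 0 \<rho>"
  have "compact \<Gamma>"
    unfolding \<Gamma>_def
    by (intro compact_continuous_image continuous_intros compact_sphere
        linear_continuous_on linear_smult_left[THEN linear_conv_bounded_linear[THEN iffD1]])
  define Om where "Om = {z \<in> ball a R0. \<forall>k\<in>I. s k z \<noteq> 0}"
  have disc: "a + t *s e + y \<in> ball a R" if t: "norm t \<le> \<rho>" and y: "norm y < R / 2" for t y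
  proof -
    have "norm (t *s e + y) \<le> norm t * norm e + norm y"
      using norm_triangle_ineq[of "t *s e" y] by (simp add: norm_vector_smult)
    also have "norm t * norm e \<le> \<rho> * norm e" using t by (rule mult_right_mono) simp
    finally have "norm (t *s e + y) < R" using \<rho>e y by linarith
    moreover have "dist a (a + x) = norm x" for x by (simp add: dist_norm)
    ultimately show ?thesis unfolding mem_ball add.assoc by (simp only:)
  qed
  have \<Gamma>O: "\<Gamma> \<subseteq> Om"
  proof
    fix z assume "z \<in> \<Gamma>"
    then obtain t where t: "norm t = \<rho>" "z = a + t *s e" unfolding \<Gamma>_def by auto
    have "z \<in> ball a R" using disc[of t 0] t R by simp
    then have "z \<in> ball a R0" using cR0 ball_subset_cball by blast
    then show "z \<in> Om" unfolding Om_def using t \<rho>'(2)[of _ t] \<rho> by auto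
  qed
  obtain \<delta>1 where \<delta>1: "\<delta>1 > 0" "(\<Union>x\<in>\<Gamma>. cball x \<delta>1) \<subseteq> Om"
    using compact_subset_open_imp_cball_epsilon_subset[OF \<open>compact \<Gamma>\<close> _ \<Gamma>O] open_nz[OF I(1)] unfolding Om_def by blast
  define \<delta> where "\<delta> = min \<delta>1 (R / 2)"
  have \<delta>: "0 < \<delta>" "\<delta> \<le> \<delta>1" "\<delta> \<le> R / 2" unfolding \<delta>_def using \<delta>1 R by auto
  define Q where "Q = (\<lambda>(x, y). x + y) ` (\<Gamma> \<times> cball 0 \<delta>)"
  have "compact Q"
    unfolding Q_def
    by (intro compact_continuous_image compact_Times \<open>compact \<Gamma>\<close> compact_cball)
       (auto simp: split_beta intro!: continuous_intros)
  have QO: "Q \<subseteq> Om"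
  proof
    fix z assume "z \<in> Q"
    then obtain x y where "x \<in> \<Gamma>" "norm y \<le> \<delta>" "z = x + y" unfolding Q_def by auto
    then have "z \<in> (\<Union>x\<in>\<Gamma>. cball x \<delta>1)" using \<delta> by (auto intro!: bexI[of _ x] simp: dist_norm)
    then show "z \<in> Om" using \<delta>1 by blast
  qed
  have QR0: "Q \<subseteq> ball a R0" using QO unfolding Om_def by blast
  have "\<exists>W \<epsilon>. open W \<and> 0 < \<epsilon> \<and> g ` cball a R \<subseteq> W \<and> (\<forall>\<alpha>. norm (\<alpha> - \<beta> k) < \<epsilon> \<longrightarrow> W \<inter> hyperplane \<alpha> = {})"
    if "k \<in> K" for k
    by (rule hyperplane_avoiding_neighbourhood[OF contG compact_cball cR0])
       (use that R(2) G(2) cR0 in \<open>auto simp: s_def\<close>)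
  then obtain W1 \<epsilon>1 where W1: "\<And>k. k \<in> K \<Longrightarrow> open (W1 k)" "\<And>k. k \<in> K \<Longrightarrow> 0 < \<epsilon>1 k" "\<And>k. k \<in> K \<Longrightarrow> g ` cball a R \<subseteq> W1 k"
    "\<And>k \<alpha>. k \<in> K \<Longrightarrow> norm (\<alpha> - \<beta> k) < \<epsilon>1 k \<Longrightarrow> W1 k \<inter> hyperplane \<alpha> = {}" by metis
  have "\<exists>W \<epsilon>. open W \<and> 0 < \<epsilon> \<and> g ` Q \<subseteq> W \<and> (\<forall>\<alpha>. norm (\<alpha> - \<beta> k) < \<epsilon> \<longrightarrow> W \<inter> hyperplane \<alpha> = {})"
    if "k \<in> I" for k
    by (rule hyperplane_avoiding_neighbourhood[OF contG \<open>compact Q\<close> QR0])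
       (use that QO G(2) QR0 in \<open>auto simp: s_def Om_def\<close>)
  then obtain W2 \<epsilon>2 where W2: "\<And>k. k \<in> I \<Longrightarrow> open (W2 k)" "\<And>k. k \<in> I \<Longrightarrow> 0 < \<epsilon>2 k" "\<And>k. k \<in> I \<Longrightarrow> g ` Q \<subseteq> W2 k"
    "\<And>k \<alpha>. k \<in> I \<Longrightarrow> norm (\<alpha> - \<beta> k) < \<epsilon>2 k \<Longrightarrow> W2 k \<inter> hyperplane \<alpha> = {}" by metis
  obtain C \<epsilon>3 where C: "1 \<le> C" and \<epsilon>3: "0 < \<epsilon>3"
    "\<And>\<alpha>. \<forall>k\<in>I. norm (\<alpha> k) = 1 \<and> norm (\<alpha> k - \<beta> k) < \<epsilon>3 \<Longrightarrow> quantitative_general_position I C \<alpha>"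
    using general_position_perturbed[OF I(1) gp] by blast
  obtain B where B: "\<And>D (f :: complex^'m \<rightharpoonup> 'k cproj) \<alpha> K R.
      meromorphic_map D f \<Longrightarrow> ball a R \<subseteq> D \<Longrightarrow> K \<subseteq> I \<Longrightarrow> Suc n \<le> card K \<Longrightarrow>
      omits_around_disc f I K \<alpha> a e \<rho> \<delta> R \<Longrightarrow>
      quantitative_general_position I C \<alpha> \<Longrightarrow>
      \<exists>k\<in>K. \<exists>F. admissible_rep D f (ball a R) F \<and> (\<forall>z\<in>ball a R. pairing (\<alpha> k) (F z) = 1) \<and>
        (\<forall>z\<in>ball a (\<delta>/8). norm (F z) \<le> B)"
    by (rule bounded_normalised_reps[OF n I C \<rho>(1) \<delta>(1), of a e]) (rule that, blast)
  define \<epsilon> where "\<epsilon> = Min (insert \<epsilon>3 (\<epsilon>1 ` K \<union> \<epsilon>2 ` I))"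
  have \<epsilon>: "0 < \<epsilon>" "\<epsilon> \<le> \<epsilon>3" "\<And>k. k \<in> K \<Longrightarrow> \<epsilon> \<le> \<epsilon>1 k" "\<And>k. k \<in> I \<Longrightarrow> \<epsilon> \<le> \<epsilon>2 k"
    unfolding \<epsilon>_def using I K \<epsilon>3(1) W1(2) W2(2) by (auto simp: Min_gr_iff)
  define NN where "NN = (\<Inter>k\<in>K. {h \<in> Hol D. h ` cball a R \<subseteq> W1 k}) \<inter> (\<Inter>k\<in>I. {h \<in> Hol D. h ` Q \<subseteq> W2 k})"
  have "K \<noteq> {}" "I \<noteq> {}" using cardK K by auto
  have oN: "openin (Hol_topology D) NN"
    unfolding NN_def
    by (intro openin_Int openin_INT2 openin_Hol_topology I(1) K(2) \<open>K \<noteq> {}\<close> \<open>I \<noteq> {}\<close> compact_cball \<open>compact Q\<close> W1 W2)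
       (use R0 cR0 QR0 in blast)+
  have gN: "g \<in> NN" unfolding NN_def using g W1(3) W2(3) by blast
  have "has_bounded_normalised_rep D I \<alpha> B (ball a (\<delta>/8)) f"
    if f: "meromorphic_map D f" and g': "g' \<in> NN"
      and \<alpha>: "\<forall>k\<in>I. norm (\<alpha> k) = 1 \<and> norm (\<alpha> k - \<beta> k) < \<epsilon>"
      and om: "\<forall>k\<in>I. \<forall>z\<in>D. g' z \<notin> hyperplane (\<alpha> k) \<longrightarrow> omits_at f (hyperplane (\<alpha> k)) z"
    for f :: "complex^'m \<rightharpoonup> 'k cproj" and g' \<alpha>
  proof -
    have RD: "ball a R \<subseteq> D" using cR0 R0(2) ball_subset_cball by blast
    have "omits_around_disc f I K \<alpha> a e \<rho> \<delta> R"
      unfolding omits_around_disc_def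
    proof (intro conjI allI impI ballI)
      fix k z assume k: "k \<in> K" and z: "z \<in> ball a R"
      have kI: "k \<in> I" using k K by blast
      have "z \<in> cball a R" using z by simp
      moreover have "g' ` cball a R \<subseteq> W1 k" using g' k unfolding NN_def by blast
      moreover have "W1 k \<inter> hyperplane (\<alpha> k) = {}"
        using W1(4)[OF k, of "\<alpha> k"] bspec[OF \<alpha> kI] \<epsilon>(3)[OF k] by linarith
      ultimately have "g' z \<notin> hyperplane (\<alpha> k)" by blast
      then show "omits_at f (hyperplane (\<alpha> k)) z" using om kI z RD by blast
    next
      fix k t and y :: "complex^'m" assume k: "k \<in> I" and t: "norm (t::complex) = \<rho>" and y: "norm y < \<delta>"
      have zQ: "a + t *s e + y \<in> Q" unfolding Q_def \<Gamma>_def using t y by force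
      moreover have "g' ` Q \<subseteq> W2 k" using g' k unfolding NN_def by blast
      moreover have "W2 k \<inter> hyperplane (\<alpha> k) = {}"
        using W2(4)[OF k, of "\<alpha> k"] bspec[OF \<alpha> k] \<epsilon>(4)[OF k] by linarith
      ultimately have "g' (a + t *s e + y) \<notin> hyperplane (\<alpha> k)" by blast
      then show "omits_at f (hyperplane (\<alpha> k)) (a + t *s e + y)" using om k zQ QR0 R0(2) by blast
    next
      fix t and y :: "complex^'m" assume "norm (t::complex) \<le> \<rho>" "norm y < \<delta>"
      then show "a + t *s e + y \<in> ball a R" using disc[of t y] \<delta> by simp
    qed
    moreover have "quantitative_general_position I C \<alpha>"
      by (rule \<epsilon>3(2)) (use \<alpha> \<epsilon>(2) in \<open>auto intro: less_le_trans\<close>)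
    ultimately obtain k F where k: "k \<in> K" and F: "admissible_rep D f (ball a R) F"
      "\<forall>z\<in>ball a R. pairing (\<alpha> k) (F z) = 1" "\<forall>z\<in>ball a (\<delta>/8). norm (F z) \<le> B"
      using B[OF f RD K(1) cardK] by blast
    have sub: "ball a (\<delta>/8) \<subseteq> ball a R" using \<delta> R by (intro subset_ball) simp
    show ?thesis
      unfolding has_bounded_normalised_rep_def
      using k K F sub admissible_rep_subset[OF F(1) open_ball sub] by blast
  qed
  moreover have "0 < \<delta>/8" using \<delta> by simp
  ultimately have "bounded_reps_near D I \<beta> g a (\<delta>/8) B NN \<epsilon>"
    unfolding bounded_reps_near_def using \<epsilon>(1) oN gN by blast
  then show ?thesis by blast
qed

section \<open>Meromorphic convergence of a subsequence\<close>

text \<open>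
  For a topology given by a subbase, cluster points are easier to obtain than convergent subsequences;
  with countably many neighbourhoods of the cluster point, a subsequence is eventually in all of them.
\<close>

lemma compactin_cluster_point:
  assumes S: "compactin X S" and x: "\<And>j::nat. x j \<in> S"
  obtains y where "y \<in> S" "\<And>U. openin X U \<Longrightarrow> y \<in> U \<Longrightarrow> infinite {j. x j \<in> U}"
proof -
  have "\<exists>y\<in>S. \<forall>U. openin X U \<longrightarrow> y \<in> U \<longrightarrow> infinite {j. x j \<in> U}"
  proof (rule ccontr)
    assume neg: "\<not> ?thesis"
    define \<U> where "\<U> = {U. openin X U \<and> finite {j. x j \<in> U}}"
    have "S \<subseteq> \<Union>\<U>" using neg unfolding \<U>_def by blast
    then obtain \<F> where \<F>: "finite \<F>" "\<F> \<subseteq> \<U>" "S \<subseteq> \<Union>\<F>"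
      using S unfolding compactin_def \<U>_def by (metis (no_types, lifting) mem_Collect_eq)
    have "UNIV \<subseteq> (\<Union>U\<in>\<F>. {j. x j \<in> U})" using x \<F>(3) by blast
    moreover have "finite (\<Union>U\<in>\<F>. {j. x j \<in> U})" using \<F> unfolding \<U>_def by auto
    ultimately show False using finite_subset infinite_UNIV_nat by blast
  qed
  then show ?thesis using that by blast
qed

lemma strict_mono_selection:
  assumes "\<And>i::nat. infinite (M i :: nat set)"
  obtains s where "strict_mono s" "\<And>i. s i \<in> M i"
proof -
  have "\<exists>s. \<forall>i. s i \<in> M i \<and> s i < s (Suc i)"
  proof (rule dependent_nat_choice)
    show "\<exists>x. x \<in> M 0" using assms[of 0] by (metis ex_in_conv finite.emptyI)
    show "\<exists>y. y \<in> M (Suc i) \<and> x < y" for x i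
      using assms[of "Suc i"] infinite_nat_iff_unbounded by blast
  qed
  then show ?thesis using that strict_mono_Suc_iff by blast
qed

text \<open>
  On each ball of the cover a subsequence is normalised by a fixed index and converges by Montel's
  theorem; a diagonal sequence does so on all balls. Limits on overlapping balls are
  proportional, the factor being the limit of the factors between their approximants.
\<close>

lemma normalised_reps_imp_converges_meromorphically:
  fixes D :: "(complex^'m) set" and f :: "nat \<Rightarrow> complex^'m \<rightharpoonup> 'k::finite cproj"
    and \<alpha> :: "nat \<Rightarrow> nat \<Rightarrow> complex^'k"
  assumes f: "\<And>j. meromorphic_map D (f j)" and I: "finite I"
    and \<alpha>: "\<And>k. k \<in> I \<Longrightarrow> (\<lambda>j. \<alpha> j k) \<longlonglongrightarrow> \<beta> k"
    and \<delta>: "\<And>i::nat. 0 < \<delta> i" and cover: "D \<subseteq> (\<Union>i. ball (c i) (\<delta> i / 2))"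
    and reps: "\<And>i. \<forall>\<^sub>F j in sequentially. has_bounded_normalised_rep D I (\<alpha> j) (B i) (ball (c i) (\<delta> i)) (f j)"
  shows "\<exists>r g. strict_mono r \<and> meromorphic_map D g \<and> converges_meromorphically D (f \<circ> r) g"
proof -
  define R where "R i j k F \<longleftrightarrow> k \<in> I \<and> admissible_rep D (f j) (ball (c i) (\<delta> i)) F \<and>
      (\<forall>z\<in>ball (c i) (\<delta> i). pairing (\<alpha> j k) (F z) = 1 \<and> norm (F z) \<le> B i)" for i j k F
  have "\<exists>N. \<forall>j\<ge>N. \<exists>k F. R i j k F" for i
  proof -
    have "\<forall>\<^sub>F j in sequentially. \<exists>k F. R i j k F"
      using reps[of i] by (rule eventually_mono) (unfold has_bounded_normalised_rep_def R_def, blast)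
    then show ?thesis unfolding eventually_sequentially .
  qed
  then obtain N where N: "\<And>i j. N i \<le> j \<Longrightarrow> \<exists>k F. R i j k F" by metis
  then obtain \<kappa> F where R: "\<And>i j. N i \<le> j \<Longrightarrow> R i j (\<kappa> i j) (F i j)" by metis
  have \<kappa>F: "\<kappa> i j \<in> I \<and> admissible_rep D (f j) (ball (c i) (\<delta> i)) (F i j) \<and>
      (\<forall>z\<in>ball (c i) (\<delta> i). pairing (\<alpha> j (\<kappa> i j)) (F i j z) = 1 \<and> norm (F i j z) \<le> B i)" if "N i \<le> j" for i j
    using R[OF that] unfolding R_def .
  \<comment> \<open>The property of subsequences that is required on the \<open>i\<close>-th ball; it passes to subsequences.\<close>
  define P where "P i t \<longleftrightarrow> (\<exists>k\<in>I. \<forall>\<^sub>F j in sequentially. \<kappa> i (t j) = k) \<and>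
      (\<exists>G. uniform_limit (cball (c i) (\<delta> i / 2)) (\<lambda>j. F i (t j)) G sequentially \<and> holo_vec_on G (ball (c i) (\<delta> i / 2)))"
    for i and t :: "nat \<Rightarrow> nat"
  have stable: "P i (t \<circ> r)" if r: "strict_mono r" and P: "P i t" for r t i
  proof -
    obtain k G where "k \<in> I" and k: "\<forall>\<^sub>F j in sequentially. \<kappa> i (t j) = k"
      and G: "uniform_limit (cball (c i) (\<delta> i / 2)) (\<lambda>j. F i (t j)) G sequentially" "holo_vec_on G (ball (c i) (\<delta> i / 2))"
      using P unfolding P_def by blast
    have "\<forall>\<^sub>F j in sequentially. \<kappa> i (t (r j)) = k" by (rule eventually_subseq[OF r k])
    moreover have "uniform_limit (cball (c i) (\<delta> i / 2)) (\<lambda>j. F i (t (r j))) G sequentially"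
      by (rule filterlim_compose[OF G(1) filterlim_subseq[OF r]])
    ultimately show ?thesis unfolding P_def o_def using \<open>k \<in> I\<close> G(2) by blast
  qed
  interpret subseqs P
  proof
    fix i and t :: "nat \<Rightarrow> nat" assume t: "strict_mono t"
    have tN: "N i \<le> t j" if "N i \<le> j" for j using that seq_suble[OF t, of j] by linarith
    have "infinite {N i..}" by (rule infinite_Ici)
    moreover have "finite ((\<lambda>j. \<kappa> i (t j)) ` {N i..})"
      by (rule finite_subset[OF _ I]) (use \<kappa>F tN in auto)
    ultimately obtain j0 where j0: "j0 \<in> {N i..}" "infinite {j \<in> {N i..}. \<kappa> i (t j) = \<kappa> i (t j0)}"
      using pigeonhole_infinite[of "{N i..}" "\<lambda>j. \<kappa> i (t j)"] by blast
    then obtain r1 where r1: "strict_mono (r1 :: nat \<Rightarrow> nat)" "\<And>j. N i \<le> r1 j \<and> \<kappa> i (t (r1 j)) = \<kappa> i (t j0)"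
      using infinite_enumerate[OF j0(2)] by auto
    have FF: "admissible_rep D (f (t (r1 j))) (ball (c i) (\<delta> i)) (F i (t (r1 j))) \<and>
        (\<forall>z\<in>ball (c i) (\<delta> i). norm (F i (t (r1 j)) z) \<le> B i)" for j
      using \<kappa>F[of i "t (r1 j)"] tN r1(2) by blast
    obtain G s where s: "strict_mono (s :: nat \<Rightarrow> nat)"
      "uniform_limit (cball (c i) (\<delta> i / 2)) (\<lambda>j. F i (t (r1 (s j)))) G sequentially" "holo_vec_on G (ball (c i) (\<delta> i / 2))"
    proof (rule holo_vec_Montel[OF \<delta>[of i], of "\<lambda>j. F i (t (r1 j))" "c i" "B i"])
      show "holo_vec_on (F i (t (r1 j))) (ball (c i) (\<delta> i))" for j
        using FF unfolding admissible_rep_def by blast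
    qed (use FF that in blast)+
    have "P i (t \<circ> (r1 \<circ> s))"
      unfolding P_def o_def using s r1(2) \<kappa>F[of i "t j0"] tN j0(1) by auto
    then show "\<exists>r. strict_mono r \<and> P i (t \<circ> r)" using strict_mono_o[OF r1(1) s(1)] by blast
  qed
  define r where "r = diagseq"
  have r: "strict_mono r" unfolding r_def by (rule subseq_diagseq)
  have "P i r" for i
  proof -
    have "P i (r \<circ> (+) (Suc i))" unfolding r_def by (rule diagseq_holds) (rule stable)
    then obtain k G where k: "k \<in> I" "\<forall>\<^sub>F j in sequentially. \<kappa> i (r (j + Suc i)) = k"
      and G: "uniform_limit (cball (c i) (\<delta> i / 2)) (\<lambda>j. F i (r (j + Suc i))) G sequentially" "holo_vec_on G (ball (c i) (\<delta> i / 2))"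
      unfolding P_def o_def by (auto simp: add.commute)
    have "\<forall>\<^sub>F j in sequentially. \<kappa> i (r j) = k"
      using k(2) eventually_sequentially_seg[of "\<lambda>j. \<kappa> i (r j) = k" "Suc i"] by blast
    moreover have "uniform_limit (cball (c i) (\<delta> i / 2)) (\<lambda>j. F i (r j)) G sequentially"
      unfolding uniform_limit_iff
    proof (intro allI impI)
      fix e :: real assume "0 < e"
      then have "\<forall>\<^sub>F j in sequentially. \<forall>x\<in>cball (c i) (\<delta> i / 2). dist (F i (r (j + Suc i)) x) (G x) < e"
        using G(1) unfolding uniform_limit_iff by blast
      then show "\<forall>\<^sub>F j in sequentially. \<forall>x\<in>cball (c i) (\<delta> i / 2). dist (F i (r j) x) (G x) < e"
        by (rule eventually_sequentially_seg[THEN iffD1])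
    qed
    ultimately show ?thesis unfolding P_def using k(1) G(2) by blast
  qed
  then have "\<forall>i. \<exists>k G. k \<in> I \<and> (\<forall>\<^sub>F j in sequentially. \<kappa> i (r j) = k) \<and>
      uniform_limit (cball (c i) (\<delta> i / 2)) (\<lambda>j. F i (r j)) G sequentially \<and> holo_vec_on G (ball (c i) (\<delta> i / 2))"
    unfolding P_def by blast
  then obtain k G where k: "\<And>i. k i \<in> I" and \<kappa>k: "\<And>i. \<forall>\<^sub>F j in sequentially. \<kappa> i (r j) = k i"
    and G: "\<And>i. uniform_limit (cball (c i) (\<delta> i / 2)) (\<lambda>j. F i (r j)) (G i) sequentially"
    and holG: "\<And>i. holo_vec_on (G i) (ball (c i) (\<delta> i / 2))" by metis
  have rep: "\<forall>\<^sub>F j in sequentially. admissible_rep D (f (r j)) (ball (c i) (\<delta> i)) (F i (r j)) \<and>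
      (\<forall>z\<in>ball (c i) (\<delta> i). pairing (\<alpha> (r j) (k i)) (F i (r j) z) = 1)" for i
  proof -
    have "\<forall>\<^sub>F j in sequentially. N i \<le> r j"
      using eventually_ge_at_top[of "N i"] by (rule eventually_mono) (use seq_suble[OF r] order_trans in blast)
    then show ?thesis using \<kappa>k[of i]
    proof eventually_elim
      case (elim j)
      show ?case using \<kappa>F[OF elim(1)] by (simp add: elim(2))
    qed
  qed
  have half: "ball (c i) (\<delta> i / 2) \<subseteq> ball (c i) (\<delta> i)" for i using \<delta>[of i] by (intro subset_ball) simp
  have ballD: "ball (c i) (\<delta> i) \<subseteq> D" for i
    using eventually_happens[OF rep[of i]] unfolding admissible_rep_def by auto
  have limF: "(\<lambda>j. F i (r j) z) \<longlonglongrightarrow> G i z" if "z \<in> ball (c i) (\<delta> i / 2)" for i z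
    by (rule tendsto_uniform_limitI[OF G]) (use that in auto)
  have lim\<alpha>: "(\<lambda>j. \<alpha> (r j) (k i)) \<longlonglongrightarrow> \<beta> (k i)" for i
    using LIMSEQ_subseq_LIMSEQ[OF \<alpha>[OF k] r] by (simp add: o_def)
  have G1: "pairing (\<beta> (k i)) (G i z) = 1" if z: "z \<in> ball (c i) (\<delta> i / 2)" for i z
  proof -
    have "(\<lambda>j. pairing (\<alpha> (r j) (k i)) (F i (r j) z)) \<longlonglongrightarrow> pairing (\<beta> (k i)) (G i z)"
      by (rule tendsto_pairing[OF lim\<alpha> limF[OF z]])
    moreover have "(\<lambda>j. pairing (\<alpha> (r j) (k i)) (F i (r j) z)) \<longlonglongrightarrow> 1"
      by (rule tendsto_eventually, rule eventually_mono[OF rep[of i]]) (use z half in blast)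
    ultimately show ?thesis by (rule LIMSEQ_unique)
  qed
  have Gnz: "G i z \<noteq> 0" if "z \<in> ball (c i) (\<delta> i / 2)" for i z using G1[OF that] by auto
  \<comment> \<open>The factor between two normalised representations is read off from the linear form of one of them.\<close>
  have same: "proj (G i z) = proj (G i' z)"
    if z: "z \<in> ball (c i) (\<delta> i / 2)" and z': "z \<in> ball (c i') (\<delta> i' / 2)" for i i' z
  proof -
    have "\<forall>\<^sub>F j in sequentially. F i (r j) z = pairing (\<alpha> (r j) (k i')) (F i (r j) z) *s F i' (r j) z"
      using rep[of i] rep[of i']
    proof eventually_elim
      case (elim j)
      have nz: "F i (r j) z \<noteq> 0" "F i' (r j) z \<noteq> 0" and one: "pairing (\<alpha> (r j) (k i')) (F i' (r j) z) = 1"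
        using elim z z' half[of i] half[of i'] by fastforce+
      then have "proj (F i' (r j) z) = proj (F i (r j) z)"
        using elim z z' half[of i] half[of i'] unfolding admissible_rep_def by (metis option.inject subsetD)
      then obtain d where "F i (r j) z = d *s F i' (r j) z" using proj_eq_iff[OF nz(2,1)] by blast
      then show ?case using one by (simp add: pairing_smult_right)
    qed
    moreover have "(\<lambda>j. pairing (\<alpha> (r j) (k i')) (F i (r j) z) *s F i' (r j) z) \<longlonglongrightarrow> pairing (\<beta> (k i')) (G i z) *s G i' z"
      unfolding vector_scalar_mult_def
      by (intro tendsto_vec_lambda tendsto_mult tendsto_pairing tendsto_vec_nth lim\<alpha> limF z z')
    ultimately have "(\<lambda>j. F i (r j) z) \<longlonglongrightarrow> pairing (\<beta> (k i')) (G i z) *s G i' z"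
      by (rule tendsto_cong[THEN iffD2])
    then have "G i z = pairing (\<beta> (k i')) (G i z) *s G i' z" using LIMSEQ_unique limF[OF z] by blast
    then show ?thesis using proj_eq_iff[OF Gnz[OF z'] Gnz[OF z]] by metis
  qed
  define idx where "idx z = (SOME i. z \<in> ball (c i) (\<delta> i / 2))" for z
  have idx: "z \<in> ball (c (idx z)) (\<delta> (idx z) / 2)" if "z \<in> D" for z
    unfolding idx_def by (rule someI_ex) (use that cover in blast)
  define g where "g z = (if z \<in> D then Some (proj (G (idx z) z)) else None)" for z
  have g: "g z = Some (proj (G i z))" if z: "z \<in> ball (c i) (\<delta> i / 2)" for i z
  proof -
    have "z \<in> D" using z half ballD by blast
    then show ?thesis unfolding g_def using same[OF idx z] by simp
  qed
  have "dom g = D" unfolding g_def dom_def by auto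
  then have "D - dom g = {}" by simp
  have "meromorphic_map D g"
    unfolding meromorphic_map_def
  proof (intro conjI ballI)
    show "dom g \<subseteq> D" using \<open>dom g = D\<close> by simp
    show "codim_at_least (D - dom g) 2"
      unfolding \<open>D - dom g = {}\<close> codim_at_least_def regular_point_def by simp
    fix a assume "a \<in> D"
    moreover have "admissible_rep D g (ball (c i) (\<delta> i / 2)) (G i)" for i
      unfolding admissible_rep_def using half ballD holG Gnz g by (intro conjI ballI open_ball) (blast, simp_all)
    ultimately show "\<exists>U F. a \<in> U \<and> admissible_rep D g U F" using idx by blast
  qed
  moreover have "converges_meromorphically D (f \<circ> r) g"
    unfolding converges_meromorphically_def
  proof
    fix a assume a: "a \<in> D"
    define i where "i = idx a"
    have ai: "a \<in> ball (c i) (\<delta> i / 2)" unfolding i_def by (rule idx[OF a])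
    obtain J where J: "\<And>j. J \<le> j \<Longrightarrow> admissible_rep D (f (r j)) (ball (c i) (\<delta> i)) (F i (r j))"
      using rep[of i] unfolding eventually_sequentially by blast
    have "\<forall>j. \<exists>U F. a \<in> U \<and> admissible_rep D (f (r j)) U F"
      using f a unfolding meromorphic_map_def by blast
    then obtain V E where VE: "\<And>j. a \<in> V j" "\<And>j. admissible_rep D (f (r j)) (V j) (E j)" by metis
    have "open (ball (c i) (\<delta> i / 2) \<inter> (\<Inter>j\<in>{..<J}. V j))"
      using VE(2) unfolding admissible_rep_def by (intro open_Int open_ball open_INT) auto
    moreover have "a \<in> ball (c i) (\<delta> i / 2) \<inter> (\<Inter>j\<in>{..<J}. V j)" using ai VE by blast
    ultimately obtain \<rho> where \<rho>: "0 < \<rho>" "ball a \<rho> \<subseteq> ball (c i) (\<delta> i / 2) \<inter> (\<Inter>j\<in>{..<J}. V j)"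
      using open_contains_ball by meson
    \<comment> \<open>The finitely many mappings without a normalised representation here keep some other one.\<close>
    define F' where "F' j = (if j < J then E j else F i (r j))" for j
    have "admissible_rep D ((f \<circ> r) j) (ball a \<rho>) (F' j)" for j
    proof (cases "j < J")
      case True
      then show ?thesis
        unfolding F'_def using admissible_rep_subset[OF VE(2)[of j] open_ball, of a \<rho>] \<rho>(2) by auto
    next
      case False
      have "ball a \<rho> \<subseteq> ball (c i) (\<delta> i)" using \<rho>(2) half by blast
      then show ?thesis
        unfolding F'_def using admissible_rep_subset[OF J open_ball] False by simp
    qed
    moreover have "uniform_limit K (\<lambda>j z. F' j z $ l) (\<lambda>z. G i z $ l) sequentially"
      if K: "compact K" "K \<subseteq> ball a \<rho>" for l K
    proof (rule uniform_limit_component)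
      have "K \<subseteq> cball (c i) (\<delta> i / 2)" using K(2) \<rho>(2) ball_subset_cball by blast
      then have "uniform_limit K (\<lambda>j. F i (r j)) (G i) sequentially"
        using uniform_limit_on_subset[OF G] by blast
      then show "uniform_limit K F' (G i) sequentially"
        by (rule uniform_limit_cong[THEN iffD1, rotated 2])
           (auto simp: F'_def eventually_sequentially intro!: exI[of _ J])
    qed
    moreover have "holo_vec_on (G i) (ball a \<rho>)" using holo_vec_on_subset[OF holG] \<rho>(2) by blast
    moreover have "\<exists>l. \<exists>z\<in>ball a \<rho>. G i z $ l \<noteq> 0"
    proof -
      have "G i a \<noteq> 0" by (rule Gnz[OF ai])
      then obtain l where "G i a $ l \<noteq> 0" by (auto simp: vec_eq_iff)
      then show ?thesis using \<rho>(1) by (intro exI[of _ l] bexI[of _ a]) auto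
    qed
    moreover have "\<forall>z\<in>ball a \<rho>. G i z \<noteq> 0 \<longrightarrow> g z = Some (proj (G i z))" using g \<rho>(2) by blast
    ultimately show "\<exists>U F G. a \<in> U \<and> connected U \<and> (\<forall>j. admissible_rep D ((f \<circ> r) j) U (F j)) \<and>
        (\<forall>l K. compact K \<and> K \<subseteq> U \<longrightarrow> uniform_limit K (\<lambda>j z. F j z $ l) (\<lambda>z. G z $ l) sequentially) \<and>
        holo_vec_on G U \<and> (\<exists>l. \<exists>z\<in>U. G z $ l \<noteq> 0) \<and> (\<forall>z\<in>U. G z \<noteq> 0 \<longrightarrow> g z = Some (proj (G z)))"
      using \<rho>(1) by (intro exI[of _ "ball a \<rho>"] exI[of _ F'] exI[of _ "G i"]) auto
  qed
  ultimately show ?thesis using r by blast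
qed

lemma topspace_Hol_topology: "topspace (Hol_topology D) = Hol D"
proof -
  have "openin (Hol_topology D) {h \<in> Hol D. h ` {} \<subseteq> UNIV}" by (rule openin_Hol_topology) auto
  then have "Hol D \<subseteq> topspace (Hol_topology D)" using openin_subset by fastforce
  moreover have "topspace (Hol_topology D) \<subseteq> Hol D" unfolding Hol_topology_def by simp
  ultimately show ?thesis by blast
qed

text \<open>
  In the quotient topology the projection is continuous, so convergence of the normals suffices.
\<close>

lemma limit_hyperplane_in_closure:
  assumes \<alpha>: "\<And>j::nat. hyperplane (\<alpha> j) \<in> \<H>" "\<And>j. \<alpha> j \<noteq> 0" and lim: "\<alpha> \<longlonglongrightarrow> \<beta>" and \<beta>: "\<beta> \<noteq> 0"
  shows "hyperplane \<beta> \<in> hyperplane_closure \<H>"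
proof -
  let ?S = "{proj b | b. b \<noteq> 0 \<and> hyperplane b \<in> \<H>}"
  have "proj \<beta> \<in> closure ?S"
  proof (rule ccontr)
    assume "proj \<beta> \<notin> closure ?S"
    moreover have "open {v. v \<noteq> 0 \<and> proj v \<in> - closure ?S}"
      using open_Compl[OF closed_closure[of ?S]] unfolding open_cproj_def .
    ultimately have "\<forall>\<^sub>F j in sequentially. \<alpha> j \<in> {v. v \<noteq> 0 \<and> proj v \<in> - closure ?S}"
      using lim \<beta> unfolding tendsto_def by blast
    then obtain j where "proj (\<alpha> j) \<notin> closure ?S" using eventually_happens by fastforce
    moreover have "proj (\<alpha> j) \<in> ?S" using \<alpha> by blast
    ultimately show False using subsetD[OF closure_subset[of ?S]] by simp
  qed
  then show ?thesis unfolding hyperplane_closure_def using \<beta> by blast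
qed

lemma unit_vectors_convergent_subsequence:
  fixes \<alpha> :: "nat \<Rightarrow> 'i \<Rightarrow> complex^'k::finite"
  assumes I: "finite I" and unit: "\<And>j k. k \<in> I \<Longrightarrow> norm (\<alpha> j k) = 1"
  obtains r \<beta> where "strict_mono (r :: nat \<Rightarrow> nat)" "\<And>k. k \<in> I \<Longrightarrow> (\<lambda>j. \<alpha> (r j) k) \<longlonglongrightarrow> \<beta> k"
    "\<And>k. k \<in> I \<Longrightarrow> norm (\<beta> k) = 1"
proof -
  obtain r :: "nat \<Rightarrow> nat" where r: "strict_mono r" and conv: "\<And>k. k \<in> I \<Longrightarrow> \<exists>l. (\<lambda>j. \<alpha> (r j) k) \<longlonglongrightarrow> l"
  proof (rule finite_common_subsequence[OF I, of "\<lambda>k r. \<exists>l. (\<lambda>j. \<alpha> (r j) k) \<longlonglongrightarrow> l"])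
    fix k and s :: "nat \<Rightarrow> nat" assume k: "k \<in> I"
    have "bounded (range (\<lambda>j. \<alpha> (s j) k))" unfolding bounded_iff using unit[OF k] by auto
    then obtain l r where "strict_mono (r :: nat \<Rightarrow> nat)" "((\<lambda>j. \<alpha> (s j) k) \<circ> r) \<longlonglongrightarrow> l"
      using bounded_imp_convergent_subsequence by blast
    then show "\<exists>r. strict_mono r \<and> (\<exists>l. (\<lambda>j. \<alpha> ((s \<circ> r) j) k) \<longlonglongrightarrow> l)" by (auto simp: o_def)
  next
    fix k and s r :: "nat \<Rightarrow> nat" assume "\<exists>l. (\<lambda>j. \<alpha> (s j) k) \<longlonglongrightarrow> l" "strict_mono r"
    then show "\<exists>l. (\<lambda>j. \<alpha> ((s \<circ> r) j) k) \<longlonglongrightarrow> l"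
      using LIMSEQ_subseq_LIMSEQ[of "\<lambda>j. \<alpha> (s j) k" _ r] by (auto simp: o_def)
  qed (use that in blast)
  then obtain \<beta> where \<beta>: "\<And>k. k \<in> I \<Longrightarrow> (\<lambda>j. \<alpha> (r j) k) \<longlonglongrightarrow> \<beta> k" by metis
  have "norm (\<beta> k) = 1" if "k \<in> I" for k
    using LIMSEQ_unique[OF tendsto_norm[OF \<beta>[OF that]]] unit[OF that] by simp
  then show ?thesis using that r \<beta> by blast
qed

theorem theorem1p3:
  fixes n :: nat
    and D :: "(complex^'m) set"
    and \<F> :: "(complex^'m \<rightharpoonup> 'k::finite cproj) set"
    and \<G> :: "(complex^'m \<Rightarrow> 'k cproj) set"
    and \<H> :: "'k cproj set set"
    and g :: "(complex^'m \<rightharpoonup> 'k cproj) \<Rightarrow> (complex^'m \<Rightarrow> 'k cproj)"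
    and H :: "(complex^'m \<rightharpoonup> 'k cproj) \<Rightarrow> nat \<Rightarrow> 'k cproj set"
  assumes "n \<ge> 1" and "CARD('k) = n + 1"
    and "open D" and "connected D" and "D \<noteq> {}"
    and "\<forall>f\<in>\<F>. meromorphic_map D f"
    and "\<G> \<subseteq> Hol D"
    and "\<H> \<subseteq> hyperplanes"
    and "\<forall>f\<in>\<F>. g f \<in> \<G>"
    and "\<forall>f\<in>\<F>. \<forall>k\<in>{1..2*n+1}. H f k \<in> \<H>"
    and "\<forall>f\<in>\<F>. \<forall>k\<in>{1..2*n+1}. \<not> range_in_hyperplane D f (H f k)"
    and "(INF f\<in>\<F>. ereal (hyp_D (2*n+1) (H f))) > 0"
    and "\<forall>f\<in>\<F>. \<forall>k\<in>{1..2*n+1}. divisor_supp D f (H f k) \<subseteq> {z\<in>D. g f z \<in> H f k}"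
    and "\<forall>h \<in> Hol_topology D closure_of \<G>. \<forall>L \<in> hyperplane_closure \<H>. \<not> h ` D \<subseteq> L"
    and "normal_family D \<G>"
  shows "meromorphically_normal D \<F>"
proof -
  let ?I = "{1..2*n+1}"
  have I: "finite ?I" "card ?I = 2 * n + 1" by auto
  have n: "CARD('k) = Suc n" using assms(2) by simp
  obtain d where d: "0 < d" "\<And>f. f \<in> \<F> \<Longrightarrow> d \<le> hyp_D (2*n+1) (H f)"
  proof -
    obtain d where "0 < ereal d" "ereal d < (INF f\<in>\<F>. ereal (hyp_D (2*n+1) (H f)))"
      using ereal_dense2[of 0] assms(12) by blast
    then have "0 < d" "\<And>f. f \<in> \<F> \<Longrightarrow> d \<le> hyp_D (2*n+1) (H f)"
      using less_INF_D[of "ereal d" "\<lambda>f. ereal (hyp_D (2*n+1) (H f))" \<F>] by force+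
    then show ?thesis by (rule that)
  qed
  define \<nu> where "\<nu> f k = unit_normal (H f k)" for f k
  have \<nu>: "norm (\<nu> f k) = 1" "hyperplane (\<nu> f k) = H f k" if "f \<in> \<F>" "k \<in> ?I" for f k
  proof -
    have "H f k \<in> hyperplanes" using assms(8,10) that by blast
    from unit_normal[OF this] show "norm (\<nu> f k) = 1" "hyperplane (\<nu> f k) = H f k" unfolding \<nu>_def by simp_all
  qed
  show ?thesis
    unfolding meromorphically_normal_def
  proof (intro allI impI)
    fix f :: "nat \<Rightarrow> complex^'m \<rightharpoonup> 'k cproj" assume "range f \<subseteq> \<F>"
    then have f: "f j \<in> \<F>" for j by blast
    obtain r0 \<beta> where r0: "strict_mono (r0 :: nat \<Rightarrow> nat)"
      and \<beta>: "\<And>k. k \<in> ?I \<Longrightarrow> (\<lambda>j. \<nu> (f (r0 j)) k) \<longlonglongrightarrow> \<beta> k" "\<And>k. k \<in> ?I \<Longrightarrow> norm (\<beta> k) = 1"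
      using unit_vectors_convergent_subsequence[OF I(1), of "\<lambda>j. \<nu> (f j)"] \<nu>(1)[OF f] by metis
    have gp: "general_position ?I \<beta>"
      by (rule general_position_limit[where H = "\<lambda>j. H (f (r0 j))" and d = d])
         (use \<beta>(1) d f in \<open>auto simp: \<nu>_def\<close>)
    have GH: "\<G> \<subseteq> Hol_topology D closure_of \<G>"
      by (rule closure_of_subset) (use assms(7) topspace_Hol_topology in blast)
    obtain h where h: "h \<in> Hol_topology D closure_of \<G>"
      and cluster: "\<And>U. openin (Hol_topology D) U \<Longrightarrow> h \<in> U \<Longrightarrow> infinite {j. g (f (r0 j)) \<in> U}"
    proof (rule compactin_cluster_point)
      show "compactin (Hol_topology D) (Hol_topology D closure_of \<G>)"
        using assms(15) unfolding normal_family_def by blast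
      show "g (f (r0 j)) \<in> Hol_topology D closure_of \<G>" for j using GH assms(9) f by blast
    qed (rule that)
    have hHol: "h \<in> Hol D"
      using subsetD[OF closure_of_subset_topspace h] by (simp only: topspace_Hol_topology)
    have nondeg: "\<not> h ` D \<subseteq> hyperplane (\<beta> k)" if k: "k \<in> ?I" for k
    proof -
      have "hyperplane (\<beta> k) \<in> hyperplane_closure \<H>"
      proof (rule limit_hyperplane_in_closure[OF _ _ \<beta>(1)[OF k]])
        show "hyperplane (\<nu> (f (r0 j)) k) \<in> \<H>" for j using \<nu>(2)[OF f k] assms(10) f k by simp
        show "\<nu> (f (r0 j)) k \<noteq> 0" for j using \<nu>(1)[OF f k, of "r0 j"] by auto
        show "\<beta> k \<noteq> 0" using \<beta>(2)[OF k] by auto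
      qed
      then show ?thesis using assms(14) h by blast
    qed
    have "\<exists>\<delta> B NN \<epsilon>. bounded_reps_near D ?I \<beta> h a \<delta> B NN \<epsilon>" if "a \<in> D" for a
      by (rule exists_bounded_reps_near[OF n I gp assms(3,4) hHol nondeg that])
    then obtain \<delta> B NN \<epsilon> where near: "\<And>a. a \<in> D \<Longrightarrow> bounded_reps_near D ?I \<beta> h a (\<delta> a) (B a) (NN a) (\<epsilon> a)"
      by metis
    define \<B> where "\<B> = (\<lambda>a. ball a (\<delta> a / 2)) ` D"
    obtain \<B>' where \<B>': "\<B>' \<subseteq> \<B>" "countable \<B>'" "\<Union>\<B>' = \<Union>\<B>"
      by (rule Lindelof[of \<B>]) (auto simp: \<B>_def)
    obtain A where A: "countable A" "A \<subseteq> D" "\<B>' = (\<lambda>a. ball a (\<delta> a / 2)) ` A"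
      using countable_subset_image[of \<B>' "\<lambda>a. ball a (\<delta> a / 2)" D] \<B>' unfolding \<B>_def by blast
    have "D \<subseteq> \<Union>\<B>" unfolding \<B>_def using near unfolding bounded_reps_near_def by force
    then have cov: "D \<subseteq> (\<Union>a\<in>A. ball a (\<delta> a / 2))" using A(3) \<B>'(3) by simp
    then have "A \<noteq> {}" using assms(5) by blast
    define c where "c = from_nat_into A"
    have c: "range c = A" unfolding c_def by (rule range_from_nat_into[OF \<open>A \<noteq> {}\<close> A(1)])
    have cD: "c i \<in> D" for i using c A(2) by blast
    have Lc: "0 < \<delta> (c i)" "0 < \<epsilon> (c i)" "openin (Hol_topology D) (NN (c i))" "h \<in> NN (c i)" for i
      using near[OF cD[of i]] unfolding bounded_reps_near_def by blast+
    \<comment> \<open>Infinitely many mappings lie in the first \<open>i\<close> neighbourhoods, so one subsequence is eventually in all of them.\<close>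
    have "infinite {j. g (f (r0 j)) \<in> (\<Inter>i'\<in>{..i}. NN (c i'))}" for i
      by (rule cluster) (use Lc in \<open>auto intro!: openin_INT2\<close>)
    then obtain s where s: "strict_mono s" "\<And>i. s i \<in> {j. g (f (r0 j)) \<in> (\<Inter>i'\<in>{..i}. NN (c i'))}"
      using strict_mono_selection[of "\<lambda>i. {j. g (f (r0 j)) \<in> (\<Inter>i'\<in>{..i}. NN (c i'))}"] by blast
    define t where "t = r0 \<circ> s"
    have t: "strict_mono t" unfolding t_def by (rule strict_mono_o[OF r0 s(1)])
    have gt: "g (f (t j)) \<in> NN (c i)" if "i \<le> j" for i j
      using s(2)[of j] that unfolding t_def by auto
    have \<nu>t: "(\<lambda>j. \<nu> (f (t j)) k) \<longlonglongrightarrow> \<beta> k" if "k \<in> ?I" for k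
      using LIMSEQ_subseq_LIMSEQ[OF \<beta>(1)[OF that] s(1)] unfolding t_def by (simp add: o_def)
    have "\<exists>r G. strict_mono r \<and> meromorphic_map D G \<and> converges_meromorphically D ((\<lambda>j. f (t j)) \<circ> r) G"
    proof (rule normalised_reps_imp_converges_meromorphically[where \<delta> = "\<lambda>i. \<delta> (c i)" and c = c and B = "\<lambda>i. B (c i)", OF _ I(1) \<nu>t])
      show "meromorphic_map D (f (t j))" for j using assms(6) f by blast
      show "0 < \<delta> (c i)" for i by (rule Lc)
      show "D \<subseteq> (\<Union>i. ball (c i) (\<delta> (c i) / 2))" using cov unfolding c[symmetric] by blast
      fix i
      have "\<forall>\<^sub>F j in sequentially. \<forall>k\<in>?I. norm (\<nu> (f (t j)) k - \<beta> k) < \<epsilon> (c i)"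
      proof (rule eventually_ball_finite[OF I(1)], rule ballI)
        fix k assume "k \<in> ?I"
        from tendstoD[OF \<nu>t[OF this] Lc(2)[of i]]
        show "\<forall>\<^sub>F j in sequentially. norm (\<nu> (f (t j)) k - \<beta> k) < \<epsilon> (c i)" by (simp add: dist_norm)
      qed
      then show "\<forall>\<^sub>F j in sequentially. has_bounded_normalised_rep D ?I (\<nu> (f (t j))) (B (c i)) (ball (c i) (\<delta> (c i))) (f (t j))"
        using eventually_ge_at_top[of i]
      proof eventually_elim
        case (elim j)
        have mer: "meromorphic_map D (f (t j))" using assms(6) f by blast
        have close: "\<forall>k\<in>?I. norm (\<nu> (f (t j)) k) = 1 \<and> norm (\<nu> (f (t j)) k - \<beta> k) < \<epsilon> (c i)"
          using elim(1) \<nu>(1)[OF f] by blast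
        have omits: "\<forall>k\<in>?I. \<forall>z\<in>D. g (f (t j)) z \<notin> hyperplane (\<nu> (f (t j)) k) \<longrightarrow>
            omits_at (f (t j)) (hyperplane (\<nu> (f (t j)) k)) z"
        proof (intro ballI impI)
          fix k z assume k: "k \<in> ?I" and z: "z \<in> D" "g (f (t j)) z \<notin> hyperplane (\<nu> (f (t j)) k)"
          show "omits_at (f (t j)) (hyperplane (\<nu> (f (t j)) k)) z"
          proof (rule outside_divisor_support_omits[OF mer assms(3,4) _ _ z(1)])
            show "\<nu> (f (t j)) k \<noteq> 0" using close k by fastforce
            show "\<not> range_in_hyperplane D (f (t j)) (hyperplane (\<nu> (f (t j)) k))"
              using assms(11) f k \<nu>(2)[OF f k] by simp
            show "z \<notin> divisor_supp D (f (t j)) (hyperplane (\<nu> (f (t j)) k))"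
              using assms(13)[rule_format, OF f[of "t j"] k] \<nu>(2)[OF f k] z by auto
          qed
        qed
        show ?case using near[OF cD[of i]] mer gt[OF elim(2)] close omits unfolding bounded_reps_near_def by blast
      qed
    qed
    then obtain r G where r: "strict_mono r" "meromorphic_map D G" "converges_meromorphically D ((\<lambda>j. f (t j)) \<circ> r) G"
      by blast
    have "strict_mono (t \<circ> r)" by (rule strict_mono_o[OF t r(1)])
    moreover have "converges_meromorphically D (f \<circ> (t \<circ> r)) G" using r(3) by (simp add: o_def)
    ultimately show "\<exists>r g. strict_mono r \<and> meromorphic_map D g \<and> converges_meromorphically D (f \<circ> r) g"
      using r(2) by blast
  qed
qed

end
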